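(* Let $d\ge1$, $T>0$, $\gamma>1$, $h(\rho)=\rho^\gamma$, and let $\kappa:(0,\infty)\to\mathbb{R}$ be a twice continuously differentiable function satisfying, for all $\rho>0$, $$\kappa(\rho)>0,\quad\kappa(\rho)\kappa''(\rho)-2(\kappa'(\rho))^2\ge0,\quad\rho^2\kappa(\rho)\lesssim h(\rho)+\rho,\quad|\rho\kappa'(\rho)|\lesssim\kappa(\rho).$$ Let $(\rho,u)$ be a solution on $[0,T]\times\mathbb{T}^d$, with initial data $(\rho_0,u_0)$, of the Euler system $$\rho_t+\mathrm{div}_x(\rho u)=0,\qquad(\rho u)_t+\mathrm{div}_x(\rho u\otimes u)=-\rho\nabla_x\big(h'(\rho)\big),$$ satisfying $\rho\in C^0([0,T],C^3(\mathbb{T}^d,\mathbb{R}_+))\cap C^1((0,T),C^1(\mathbb{T}^d,\mathbb{R}_+))$ and $u\in C^0([0,T],C^2(\mathbb{T}^d,\mathbb{R}^d))\cap C^1((0,T),C^0(\mathbb{T}^d,\mathbb{R}^d))$. Let $\{(\rho^\varepsilon,u^\varepsilon)\}_{\varepsilon>0}$ be a family of (conservative or dissipative) weak solutions, each satisfying the finite mass and finite energy assumption (H), of the Euler-Korteweg system with capillarity $\varepsilon\kappa$, $$\rho^\varepsilon_t+\mathrm{div}_x(\rho^\varepsilon u^\varepsilon)=0,\qquad(\rho^\varepsilon u^\varepsilon)_t+\mathrm{div}_x(\rho^\varepsilon u^\varepsilon\otimes u^\varepsilon)=-\rho^\varepsilon\nabla_x\Big(h'(\rho^\varepsilon)+\tfrac{\varepsilon\kappa'(\rho^\varepsilon)}2|\nabla_x\rho^\varepsilon|^2-\mathrm{div}_x(\varepsilon\kappa(\rho^\varepsilon)\nabla_x\rho^\varepsilon)\Big),$$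 having the same initial data $(\rho_0,u_0)$. Then there exists a constant $C>0$ depending on $T$ and $(\rho,u)$ (and not on $\varepsilon$) such that $$\int_{\mathbb{T}^d}h(\rho^\varepsilon(t,\cdot)|\rho(t,\cdot))+\frac{\rho^\varepsilon(t,\cdot)}2\big|u^\varepsilon(t,\cdot)-u(t,\cdot)\big|^2\,dx\le C\varepsilon$$ for almost all $t\in[0,T]$.
   Context: $\mathbb{T}^d$ is the $d$-dimensional flat torus, $\mathbb{R}_+=(0,\infty)$, and $h(\rho|\bar\rho):=h(\rho)-h(\bar\rho)-h'(\bar\rho)(\rho-\bar\rho)$. The notation $a\lesssim b$ means that there is a constant $C>0$ (here independent of $\rho$) with $a\le Cb$. The data $\gamma,\kappa,d$ are fixed. Momentum is $m^\varepsilon=\rho^\varepsilon u^\varepsilon$, and the same initial data means $\rho^\varepsilon(0,\cdot)=\rho_0$, $m^\varepsilon(0,\cdot)=\rho_0u_0$. Weak solutions of the Euler-Korteweg system with capillarity $\varepsilon\kappa$: put $p(\rho)=\rho h'(\rho)-h(\rho)$ and $$S=\Big[-p(\rho)-\varepsilon\tfrac{\rho\kappa'(\rho)+\kappa(\rho)}2|\nabla_x\rho|^2+\varepsilon\,\mathrm{div}_x(\rho\kappa(\rho)\nabla_x\rho)\Big]\mathbb{I}-\varepsilon\kappa(\rho)\nabla_x\rho\otimes\nabla_x\rho.$$ A pair $(\rho,m)$ with $\rho\in C([0,\infty);L^1(\mathbb{T}^d))$, $\rho\ge0$, $m\in C([0,\infty);L^1(\mathbb{T}^d,\mathbb{R}^d))$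 is a weak solution if $\frac{m\otimes m}\rho,S\in L^1_{loc}((0,\infty)\times\mathbb{T}^d)^{d\times d}$ and $$-\iint\big(\rho\psi_t+m\cdot\nabla_x\psi\big)dx\,dt=\int\rho(0,x)\psi(0,x)\,dx\quad\forall\psi\in C^1_c([0,\infty);C^1(\mathbb{T}^d)),$$ $$-\iint\Big(m\cdot\varphi_t+\tfrac{m\otimes m}\rho:\nabla_x\varphi-S:\nabla_x\varphi\Big)dx\,dt=\int m(0,x)\cdot\varphi(0,x)\,dx\quad\forall\varphi\in C^1_c([0,\infty);(C^1(\mathbb{T}^d))^d).$$ It is dissipative if in addition $E:=\frac12\frac{|m|^2}\rho+h(\rho)+\frac{\varepsilon\kappa(\rho)}2|\nabla_x\rho|^2\in C([0,\infty);L^1(\mathbb{T}^d))$ and $-\iint E\,\dot\theta(t)\,dx\,dt\le\int E|_{t=0}\,\theta(0)\,dx$ for all non-negative $\theta\in W^{1,\infty}[0,\infty)$ compactly supported in $[0,\infty)$; it is conservative if this holds with equality. Assumption (H): $\sup_{t\in(0,\infty)}\int_{\mathbb{T}^d}\rho\,dx<\infty$ and $\sup_{t\in(0,\infty)}\int_{\mathbb{T}^d}E\,dx<\infty$. *)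

theory Defs
  imports "HOL-Analysis.Analysis"
begin

section \<open>The flat torus\<close>

text \<open>
  The torus is \<open>\<real>\<^sup>d/\<int>\<^sup>d\<close> with \<open>d = CARD('n)\<close>. Continuous functions on it are continuous
  functions on \<open>\<real>\<^sup>d\<close> that are 1-periodic in every coordinate. Measurable functions on it are
  represented by their values on the unit cell, which carries Lebesgue measure; their values
  outside the cell are never used.
\<close>

definition periodic :: "(real^'n \<Rightarrow> 'b) \<Rightarrow> bool" where
  "periodic f \<longleftrightarrow> (\<forall>x j. f (x + axis j 1) = f x)"

definition torus :: "(real^'n) measure" where
  "torus = restrict_space lborel {x. \<forall>j. 0 \<le> x $ j \<and> x $ j < 1}"

definition halfline :: "real measure" where
  "halfline = restrict_space lborel {0<..}"

definition spacetime :: "(real \<times> (real^'n)) measure" where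
  "spacetime = halfline \<Otimes>\<^sub>M torus"


section \<open>Classical differential operators\<close>

definition pd :: "'n \<Rightarrow> (real^'n \<Rightarrow> 'b::real_normed_vector) \<Rightarrow> real^'n \<Rightarrow> 'b" where
  "pd j f x = frechet_derivative f (at x) (axis j 1)"

definition grad :: "(real^'n \<Rightarrow> real) \<Rightarrow> real^'n \<Rightarrow> real^'n" where
  "grad f x = (\<chi> j. pd j f x)"

definition jacobian :: "(real^'n \<Rightarrow> real^'n) \<Rightarrow> real^'n \<Rightarrow> real^'n^'n" where
  "jacobian F x = (\<chi> i. grad (\<lambda>y. F y $ i) x)"

definition dvg :: "(real^'n \<Rightarrow> real^'n) \<Rightarrow> real^'n \<Rightarrow> real" where
  "dvg F x = (\<Sum>j\<in>UNIV. pd j (\<lambda>y. F y $ j) x)"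

definition tensor_dvg :: "(real^'n \<Rightarrow> real^'n^'n) \<Rightarrow> real^'n \<Rightarrow> real^'n" where
  "tensor_dvg A x = (\<chi> i. dvg (\<lambda>y. A y $ i) x)"

definition ddt :: "(real \<Rightarrow> real^'n \<Rightarrow> 'b::real_normed_vector) \<Rightarrow> real \<Rightarrow> real^'n \<Rightarrow> 'b" where
  "ddt f t x = vector_derivative (\<lambda>s. f s x) (at t)"

definition outer :: "real^'n \<Rightarrow> real^'n \<Rightarrow> real^'n^'n" where
  "outer a b = (\<chi> i j. a $ i * b $ j)"


section \<open>Spaces of continuously differentiable functions\<close>

primrec Ck :: "nat \<Rightarrow> (real^'n \<Rightarrow> 'b::real_normed_vector) \<Rightarrow> bool" where
  "Ck 0 f \<longleftrightarrow> continuous_on UNIV f"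
| "Ck (Suc k) f \<longleftrightarrow> (\<forall>x. f differentiable (at x)) \<and> (\<forall>j. Ck k (pd j f))"

primrec Ck_norm :: "nat \<Rightarrow> (real^'n \<Rightarrow> 'b::real_normed_vector) \<Rightarrow> real" where
  "Ck_norm 0 f = (SUP x. norm (f x))"
| "Ck_norm (Suc k) f = (SUP x. norm (f x)) + (\<Sum>j\<in>UNIV. Ck_norm k (pd j f))"

definition Ck_torus :: "nat \<Rightarrow> (real^'n \<Rightarrow> 'b::real_normed_vector) \<Rightarrow> bool" where
  "Ck_torus k f \<longleftrightarrow> periodic f \<and> Ck k f"

text \<open>
  \<open>C0_Ck I k\<close> is \<open>C\<^sup>0(I; C\<^sup>k(torus))\<close> and \<open>C1_Ck I k\<close> is \<open>C\<^sup>1(I; C\<^sup>k(torus))\<close>; continuity and time derivative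
  are taken in the Banach space \<open>C\<^sup>k(torus)\<close>.
\<close>

definition C0_Ck :: "real set \<Rightarrow> nat \<Rightarrow> (real \<Rightarrow> real^'n \<Rightarrow> 'b::real_normed_vector) \<Rightarrow> bool" where
  "C0_Ck I k f \<longleftrightarrow> (\<forall>t\<in>I. Ck_torus k (f t)) \<and>
     (\<forall>t\<in>I. ((\<lambda>s. Ck_norm k (\<lambda>x. f s x - f t x)) \<longlongrightarrow> 0) (at t within I))"

definition C1_Ck :: "real set \<Rightarrow> nat \<Rightarrow> (real \<Rightarrow> real^'n \<Rightarrow> 'b::real_normed_vector) \<Rightarrow> bool" where
  "C1_Ck I k f \<longleftrightarrow> C0_Ck I k f \<and>
     (\<exists>f'. C0_Ck I k f' \<and>
       (\<forall>t\<in>I. ((\<lambda>s. Ck_norm k (\<lambda>x. (f s x - f t x) /\<^sub>R (s - t) - f' t x)) \<longlongrightarrow> 0) (at t within I)))"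

text \<open>\<open>C\<^sup>1\<^sub>c([0,\<infinity>); C\<^sup>1(torus))\<close> and \<open>C\<^sup>1\<^sub>c((0,\<infinity>); C\<^sup>1(torus))\<close>\<close>

definition test_fun :: "(real \<Rightarrow> real^'n \<Rightarrow> 'b::real_normed_vector) \<Rightarrow> bool" where
  "test_fun \<psi> \<longleftrightarrow> C1_Ck {0..} 1 \<psi> \<and> (\<exists>R. \<forall>t\<ge>R. \<forall>x. \<psi> t x = 0)"

definition interior_test_fun :: "(real \<Rightarrow> real^'n \<Rightarrow> 'b::real_normed_vector) \<Rightarrow> bool" where
  "interior_test_fun \<psi> \<longleftrightarrow> test_fun \<psi> \<and> (\<exists>r>0. \<forall>t\<in>{0..r}. \<forall>x. \<psi> t x = 0)"


section \<open>Integrable functions and weak derivatives\<close>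

text \<open>
  \<open>CL1\<close> is \<open>C([0,\<infinity>); L\<^sup>1(torus))\<close>. Every element of that space has a Borel representative on space-time
  whose slice at each time represents the value at that time, so asking for joint measurability
  loses no generality.
\<close>

definition CL1 :: "(real \<Rightarrow> real^'n \<Rightarrow> 'b::{banach,second_countable_topology}) \<Rightarrow> bool" where
  "CL1 f \<longleftrightarrow> (\<lambda>(t,x). f t x) \<in> borel_measurable spacetime \<and>
     (\<forall>t\<ge>0. integrable torus (f t)) \<and>
     (\<forall>t\<ge>0. ((\<lambda>s. \<integral>x. norm (f s x - f t x) \<partial>torus) \<longlongrightarrow> 0) (at t within {0..}))"

text \<open>\<open>L\<^sup>1\<^sub>l\<^sub>o\<^sub>c((0,\<infinity>) \<times> torus)\<close>\<close>

definition L1loc :: "(real \<Rightarrow> real^'n \<Rightarrow> 'b::{banach,second_countable_topology}) \<Rightarrow> bool" where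
  "L1loc f \<longleftrightarrow> (\<forall>a b. 0 < a \<longrightarrow> a < b \<longrightarrow> set_integrable spacetime ({a..b} \<times> UNIV) (\<lambda>(t,x). f t x))"

definition weak_gradient ::
  "(real \<Rightarrow> real^'n \<Rightarrow> real) \<Rightarrow> (real \<Rightarrow> real^'n \<Rightarrow> real^'n) \<Rightarrow> bool" where
  "weak_gradient f G \<longleftrightarrow> L1loc f \<and> L1loc G \<and>
     (\<forall>\<psi> j. interior_test_fun \<psi> \<longrightarrow>
       (\<integral>(t,x). f t x * pd j (\<psi> t) x \<partial>spacetime) = - (\<integral>(t,x). G t x $ j * \<psi> t x \<partial>spacetime))"

definition weak_divergence ::
  "(real \<Rightarrow> real^'n \<Rightarrow> real^'n) \<Rightarrow> (real \<Rightarrow> real^'n \<Rightarrow> real) \<Rightarrow> bool" where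
  "weak_divergence F D \<longleftrightarrow> L1loc F \<and> L1loc D \<and>
     (\<forall>\<psi>. interior_test_fun \<psi> \<longrightarrow>
       (\<integral>(t,x). F t x \<bullet> grad (\<psi> t) x \<partial>spacetime) = - (\<integral>(t,x). D t x * \<psi> t x \<partial>spacetime))"

definition slice_weak_gradient ::
  "(real^'n \<Rightarrow> real) \<Rightarrow> (real^'n \<Rightarrow> real^'n) \<Rightarrow> bool" where
  "slice_weak_gradient f g \<longleftrightarrow> integrable torus f \<and> integrable torus g \<and>
     (\<forall>\<phi> j. Ck_torus 1 \<phi> \<longrightarrow>
       (\<integral>x. f x * pd j \<phi> x \<partial>torus) = - (\<integral>x. g x $ j * \<phi> x \<partial>torus))"

text \<open>
  \<open>\<theta> \<in> W\<^sup>1\<^sup>,\<^sup>\<infinity>[0,\<infinity>)\<close> with weak derivative \<open>\<theta>'\<close>; \<open>\<theta>\<close> is the continuous representative, so that \<open>\<theta> 0\<close>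
  makes sense.
\<close>

definition W1inf :: "(real \<Rightarrow> real) \<Rightarrow> (real \<Rightarrow> real) \<Rightarrow> bool" where
  "W1inf \<theta> \<theta>' \<longleftrightarrow> continuous_on {0..} \<theta> \<and> bounded (\<theta> ` {0..}) \<and>
     \<theta>' \<in> borel_measurable halfline \<and> (\<exists>B. AE t in halfline. \<bar>\<theta>' t\<bar> \<le> B) \<and>
     (\<forall>\<phi>. \<phi> C1_differentiable_on UNIV \<and> (\<exists>a b. 0 < a \<and> (\<forall>t. t \<notin> {a..b} \<longrightarrow> \<phi> t = 0)) \<longrightarrow>
       (\<integral>t. \<theta> t * deriv \<phi> t \<partial>halfline) = - (\<integral>t. \<theta>' t * \<phi> t \<partial>halfline))"


section \<open>Strong solutions of the Euler system\<close>

definition euler_solution ::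
  "(real \<Rightarrow> real) \<Rightarrow> real \<Rightarrow> (real \<Rightarrow> real^'n \<Rightarrow> real) \<Rightarrow> (real \<Rightarrow> real^'n \<Rightarrow> real^'n)
     \<Rightarrow> (real^'n \<Rightarrow> real) \<Rightarrow> (real^'n \<Rightarrow> real^'n) \<Rightarrow> bool" where
  "euler_solution h T \<rho> u \<rho>\<^sub>0 u\<^sub>0 \<longleftrightarrow>
     \<rho> 0 = \<rho>\<^sub>0 \<and> u 0 = u\<^sub>0 \<and>
     (\<forall>t\<in>{0<..<T}. \<forall>x.
        ddt \<rho> t x + dvg (\<lambda>y. \<rho> t y *\<^sub>R u t y) x = 0 \<and>
        ddt (\<lambda>s y. \<rho> s y *\<^sub>R u s y) t x + tensor_dvg (\<lambda>y. \<rho> t y *\<^sub>R outer (u t y) (u t y)) x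
          = - (\<rho> t x *\<^sub>R grad (\<lambda>y. deriv h (\<rho> t y)) x))"


section \<open>Weak solutions of the Euler-Korteweg system\<close>

text \<open>
  The capillarity is a function on \<open>(0,\<infinity>)\<close> only. All terms containing it carry a factor \<open>\<nabla>\<rho>\<close>, which
  vanishes almost everywhere on the vacuum set \<open>{\<rho> = 0}\<close>; they are read as \<open>0\<close> there.
\<close>

definition off_vacuum :: "(real \<Rightarrow> real) \<Rightarrow> real \<Rightarrow> real" where
  "off_vacuum f r = (if r > 0 then f r else 0)"

definition pressure :: "(real \<Rightarrow> real) \<Rightarrow> real \<Rightarrow> real" where
  "pressure h r = r * deriv h r - h r"

text \<open>
  In the next two definitions \<open>r\<close>, \<open>m\<close>, \<open>g\<close>, \<open>q\<close> are the values at a point of \<open>\<rho>\<close>, \<open>m\<close>, \<open>\<nabla>\<rho>\<close> and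
  \<open>div(\<rho> \<kappa>(\<rho>) \<nabla>\<rho>)\<close>.
\<close>

definition stress ::
  "(real \<Rightarrow> real) \<Rightarrow> (real \<Rightarrow> real) \<Rightarrow> real \<Rightarrow> real \<Rightarrow> real^'n \<Rightarrow> real \<Rightarrow> real^'n^'n" where
  "stress h \<kappa> \<epsilon> r g q =
     (- pressure h r
      - \<epsilon> * ((r * off_vacuum (deriv \<kappa>) r + off_vacuum \<kappa> r) / 2) * (norm g)\<^sup>2
      + \<epsilon> * q) *\<^sub>R mat 1
     - (\<epsilon> * off_vacuum \<kappa> r) *\<^sub>R outer g g"

definition energy ::
  "(real \<Rightarrow> real) \<Rightarrow> (real \<Rightarrow> real) \<Rightarrow> real \<Rightarrow> real \<Rightarrow> real^'n \<Rightarrow> real^'n \<Rightarrow> real" where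
  "energy h \<kappa> \<epsilon> r m g = (1 / 2) * ((norm m)\<^sup>2 / r) + h r + (\<epsilon> * off_vacuum \<kappa> r / 2) * (norm g)\<^sup>2"

text \<open>
  \<open>G\<close> is the weak gradient of \<open>\<rho>\<close>. The quotient \<open>m \<otimes> m / \<rho>\<close> only makes sense if \<open>m\<close> vanishes on
  the vacuum set; it is then \<open>0\<close> there. The test functions reach down to \<open>t = 0\<close>, whereas
  the fluxes are only locally integrable on \<open>t > 0\<close>: \<open>has_bochner_integral\<close> says that the
  space-time integrals exist and have the stated values. The inner product of matrices is the
  contraction \<open>A : B\<close>.
\<close>

definition EK_weak_solution ::
  "(real \<Rightarrow> real) \<Rightarrow> (real \<Rightarrow> real) \<Rightarrow> real \<Rightarrow> (real \<Rightarrow> real^'n \<Rightarrow> real) \<Rightarrow> (real \<Rightarrow> real^'n \<Rightarrow> real^'n)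
     \<Rightarrow> (real \<Rightarrow> real^'n \<Rightarrow> real^'n) \<Rightarrow> bool" where
  "EK_weak_solution h \<kappa> \<epsilon> \<rho> m G \<longleftrightarrow>
     CL1 \<rho> \<and> (\<forall>t\<ge>0. AE x in torus. 0 \<le> \<rho> t x) \<and> CL1 m \<and>
     (AE (t,x) in spacetime. \<rho> t x = 0 \<longrightarrow> m t x = 0) \<and>
     L1loc (\<lambda>t x. (1 / \<rho> t x) *\<^sub>R outer (m t x) (m t x)) \<and>
     weak_gradient \<rho> G \<and>
     (\<exists>D. weak_divergence (\<lambda>t x. (\<rho> t x * off_vacuum \<kappa> (\<rho> t x)) *\<^sub>R G t x) D \<and>
        L1loc (\<lambda>t x. stress h \<kappa> \<epsilon> (\<rho> t x) (G t x) (D t x)) \<and>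
        (\<forall>\<psi>. test_fun \<psi> \<longrightarrow>
           has_bochner_integral spacetime
             (\<lambda>(t,x). \<rho> t x * ddt \<psi> t x + m t x \<bullet> grad (\<psi> t) x)
             (- (\<integral>x. \<rho> 0 x * \<psi> 0 x \<partial>torus))) \<and>
        (\<forall>\<phi>. test_fun \<phi> \<longrightarrow>
           has_bochner_integral spacetime
             (\<lambda>(t,x). m t x \<bullet> ddt \<phi> t x
                + ((1 / \<rho> t x) *\<^sub>R outer (m t x) (m t x)) \<bullet> jacobian (\<phi> t) x
                - stress h \<kappa> \<epsilon> (\<rho> t x) (G t x) (D t x) \<bullet> jacobian (\<phi> t) x)
             (- (\<integral>x. m 0 x \<bullet> \<phi> 0 x \<partial>torus))))"

text \<open>
  \<open>E\<close> is the energy density as an element of \<open>C([0,\<infinity>); L\<^sup>1(torus))\<close>. Its value at \<open>t = 0\<close> is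
  the energy density of the initial data: this does not follow from the almost everywhere
  identity for \<open>t > 0\<close>, since \<open>\<rho>(t)\<close> may oscillate as \<open>t \<rightarrow> 0\<close> with \<open>|\<nabla>\<rho>(t)|\<^sup>2\<close> tending to
  a limit other than \<open>|\<nabla>\<rho>(0)|\<^sup>2\<close>.
\<close>

definition energy_density ::
  "(real \<Rightarrow> real) \<Rightarrow> (real \<Rightarrow> real) \<Rightarrow> real \<Rightarrow> (real \<Rightarrow> real^'n \<Rightarrow> real) \<Rightarrow> (real \<Rightarrow> real^'n \<Rightarrow> real^'n)
     \<Rightarrow> (real \<Rightarrow> real^'n \<Rightarrow> real^'n) \<Rightarrow> (real \<Rightarrow> real^'n \<Rightarrow> real) \<Rightarrow> bool" where
  "energy_density h \<kappa> \<epsilon> \<rho> m G E \<longleftrightarrow>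
     CL1 E \<and>
     (AE (t,x) in spacetime. E t x = energy h \<kappa> \<epsilon> (\<rho> t x) (m t x) (G t x)) \<and>
     slice_weak_gradient (\<rho> 0) (G 0) \<and>
     (AE x in torus. E 0 x = energy h \<kappa> \<epsilon> (\<rho> 0 x) (m 0 x) (G 0 x))"

text \<open>The non-negative, compactly supported elements of \<open>W\<^sup>1\<^sup>,\<^sup>\<infinity>[0,\<infinity>)\<close>\<close>

definition energy_test_fun :: "(real \<Rightarrow> real) \<Rightarrow> (real \<Rightarrow> real) \<Rightarrow> bool" where
  "energy_test_fun \<theta> \<theta>' \<longleftrightarrow> W1inf \<theta> \<theta>' \<and> (\<forall>t\<ge>0. 0 \<le> \<theta> t) \<and> (\<exists>R. \<forall>t\<ge>R. \<theta> t = 0)"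

definition EK_dissipative ::
  "(real \<Rightarrow> real) \<Rightarrow> (real \<Rightarrow> real) \<Rightarrow> real \<Rightarrow> (real \<Rightarrow> real^'n \<Rightarrow> real) \<Rightarrow> (real \<Rightarrow> real^'n \<Rightarrow> real^'n)
     \<Rightarrow> (real \<Rightarrow> real^'n \<Rightarrow> real) \<Rightarrow> bool" where
  "EK_dissipative h \<kappa> \<epsilon> \<rho> m E \<longleftrightarrow>
     (\<exists>G. EK_weak_solution h \<kappa> \<epsilon> \<rho> m G \<and> energy_density h \<kappa> \<epsilon> \<rho> m G E) \<and>
     (\<forall>\<theta> \<theta>'. energy_test_fun \<theta> \<theta>' \<longrightarrow>
        - (\<integral>(t,x). E t x * \<theta>' t \<partial>spacetime) \<le> (\<integral>x. E 0 x * \<theta> 0 \<partial>torus))"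

definition EK_conservative ::
  "(real \<Rightarrow> real) \<Rightarrow> (real \<Rightarrow> real) \<Rightarrow> real \<Rightarrow> (real \<Rightarrow> real^'n \<Rightarrow> real) \<Rightarrow> (real \<Rightarrow> real^'n \<Rightarrow> real^'n)
     \<Rightarrow> (real \<Rightarrow> real^'n \<Rightarrow> real) \<Rightarrow> bool" where
  "EK_conservative h \<kappa> \<epsilon> \<rho> m E \<longleftrightarrow>
     (\<exists>G. EK_weak_solution h \<kappa> \<epsilon> \<rho> m G \<and> energy_density h \<kappa> \<epsilon> \<rho> m G E) \<and>
     (\<forall>\<theta> \<theta>'. energy_test_fun \<theta> \<theta>' \<longrightarrow>
        - (\<integral>(t,x). E t x * \<theta>' t \<partial>spacetime) = (\<integral>x. E 0 x * \<theta> 0 \<partial>torus))"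

definition finite_mass_energy ::
  "(real \<Rightarrow> real^'n \<Rightarrow> real) \<Rightarrow> (real \<Rightarrow> real^'n \<Rightarrow> real) \<Rightarrow> bool" where
  "finite_mass_energy \<rho> E \<longleftrightarrow>
     (\<exists>M. \<forall>t>0. (\<integral>x. \<rho> t x \<partial>torus) \<le> M) \<and> (\<exists>M. \<forall>t>0. (\<integral>x. E t x \<partial>torus) \<le> M)"


section \<open>Capillarity and relative energy\<close>

definition C2_on_pos :: "(real \<Rightarrow> real) \<Rightarrow> bool" where
  "C2_on_pos \<kappa> \<longleftrightarrow>
     (\<forall>r>0. \<kappa> field_differentiable (at r) \<and> deriv \<kappa> field_differentiable (at r)) \<and>
     continuous_on {0<..} (deriv (deriv \<kappa>))"

definition relative :: "(real \<Rightarrow> real) \<Rightarrow> real \<Rightarrow> real \<Rightarrow> real" where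
  "relative h r s = h r - h s - deriv h s * (r - s)"

end

theory Submission
  imports Defs
begin

text \<open>
  The proof is a relative energy argument. Let \<open>R, U\<close> be density and velocity of the strong
  solution, \<open>r, m\<close> density and momentum of a weak solution with capillarity \<open>\<epsilon>\<kappa>\<close>, \<open>E\<close> its energy
  density and \<open>p\<close> the pressure. The quantity
  \<open>W(t) = \<integral> E - m \<bullet> U + r (|U|\<^sup>2/2 - h'(R)) + p(R) dx\<close>
  equals \<open>\<integral> h(r|R) + |m - r U|\<^sup>2/(2r) + \<epsilon> \<kappa>(r) |\<nabla>r|\<^sup>2/2 dx\<close> (\<open>rel_density_eq\<close>). It therefore bounds the
  quantity of interest from above, and at \<open>t = 0\<close> only the capillary energy of the common initial
  density is left, which is of order \<open>\<epsilon>\<close>.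

  The evolution of \<open>W\<close> follows from the energy inequality, the mass equation tested by
  \<open>|U|\<^sup>2/2 - h'(R)\<close> and the momentum equation tested by \<open>U\<close> (\<open>relative_energy_distributional\<close>). The
  Euler equations cancel everything that is linear in the differences (\<open>production_eq\<close>). The
  remaining terms are bounded by a multiple of the integrand of \<open>W\<close>, except for the capillary term
  \<open>\<epsilon> r \<kappa>(r) \<nabla>r \<bullet> \<nabla>div U\<close>, which costs an additional \<open>O(\<epsilon>)\<close> by \<open>r\<^sup>2 \<kappa>(r) \<lesssim> h(r) + r\<close>
  (\<open>production_bound\<close>). Gronwall's inequality then gives \<open>W = O(\<epsilon>)\<close> for \<open>\<epsilon> \<le> 1\<close>. For
  \<open>\<epsilon> > 1\<close> the decay of the total energy is enough, since the initial energy is itself \<open>O(\<epsilon>)\<close>.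

  Four points need care beyond this computation.

  \<^item> The fields of the strong solution are admissible test functions only after multiplication by a
    cutoff in time, and only because the Euler equations express \<open>\<partial>\<^sub>t R\<close> and \<open>\<partial>\<^sub>t U\<close> by fields that are
    continuously differentiable in space (\<open>pointwise_derivative_imp_C1_Ck\<close>). All cutoffs
    vanish near \<open>t = 0\<close>; the initial values enter through the continuity of \<open>W\<close>
    (\<open>distributional_gronwall\<close>).

  \<^item> The divergence of \<open>U\<close> is merely continuous in time as a field with values in \<open>C\<^sup>1\<close>, so it is not a
    test function for the weak divergence of \<open>r \<kappa>(r) \<nabla>r\<close>. That identity involves no time derivative
    and extends by approximation (\<open>weak_divergence_cutoff\<close>).

  \<^item> The weak gradient of the initial density has to be identified with the classical one, for
    otherwise the initial capillary energy would not be bounded uniformly over all families of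
    solutions. This is the fundamental lemma of the calculus of variations on the torus
    (\<open>torus_AE_zero\<close>).

  \<^item> Integration by parts on the torus rests on the invariance of the integral of periodic
    functions under translations (\<open>integral_torus_shift\<close>).
\<close>


section \<open>Periodic functions and partial derivatives\<close>

lemma periodic_add_axis_of_nat:
  fixes f :: "real^'n \<Rightarrow> 'b"
  assumes "periodic f"
  shows "f (x + of_nat k *\<^sub>R axis j 1) = f x"
proof (induction k)
  case (Suc k)
  have "x + of_nat (Suc k) *\<^sub>R axis j 1 = (x + of_nat k *\<^sub>R axis j 1) + axis j 1"
    by (simp add: scaleR_left_distrib)
  then show ?case using assms Suc unfolding periodic_def by metis
qed simp

lemma periodic_add_axis_of_int:
  fixes f :: "real^'n \<Rightarrow> 'b"
  assumes "periodic f"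
  shows "f (x + of_int k *\<^sub>R axis j 1) = f x"
proof (cases "k \<ge> 0")
  case True
  then show ?thesis using periodic_add_axis_of_nat[OF assms, of x "nat k" j] by simp
next
  case False
  then show ?thesis
    using periodic_add_axis_of_nat[OF assms, of "x + of_int k *\<^sub>R axis j 1" "nat (-k)" j] by simp
qed

lemma periodic_add_lattice:
  fixes f :: "real^'n \<Rightarrow> 'b"
  assumes "periodic f"
  shows "f (x + (\<Sum>j\<in>S. of_int (k j) *\<^sub>R axis j 1)) = f x"
proof (induction S arbitrary: x rule: infinite_finite_induct)
  case (insert i S)
  show ?case
    using insert.IH[of "x + of_int (k i) *\<^sub>R axis i 1"] periodic_add_axis_of_int[OF assms, of x "k i" i]
      insert.hyps
    by (simp add: algebra_simps)
qed auto

text \<open>Continuous periodic functions attain all their values on a compact set, which is what gives them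
  finite sup norms. This map moves a point there.\<close>

definition cell_point :: "real^'n \<Rightarrow> real^'n" where
  "cell_point x = (\<chi> j. frac (x $ j))"

lemma periodic_cell_point:
  fixes f :: "real^'n \<Rightarrow> 'b"
  assumes "periodic f"
  shows "f (cell_point x) = f x"
proof -
  have "cell_point x = x + (\<Sum>j\<in>UNIV. of_int (- \<lfloor>x $ j\<rfloor>) *\<^sub>R axis j 1)"
    by (simp add: cell_point_def vec_eq_iff frac_def axis_def if_distrib sum.delta cong: if_cong)
  then show ?thesis using periodic_add_lattice[OF assms] by metis
qed

lemma cell_point_in_cbox: "cell_point x \<in> cbox 0 (1 :: real^'n)"
  by (simp add: cell_point_def mem_box_cart frac_lt_1 less_imp_le)

lemma periodic_bounded:
  fixes f :: "real^'n \<Rightarrow> 'b::real_normed_vector"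
  assumes "periodic f" "continuous_on UNIV f"
  shows "\<exists>B. \<forall>x. norm (f x) \<le> B"
proof -
  have "compact (f ` cbox 0 1)"
    by (intro compact_continuous_image) (auto intro: continuous_on_subset[OF assms(2)])
  then obtain B where "\<forall>y\<in>f ` cbox 0 1. norm y \<le> B"
    using compact_imp_bounded bounded_iff by metis
  then show ?thesis using periodic_cell_point[OF assms(1)] cell_point_in_cbox by (metis imageI)
qed

lemma bdd_above_norm_periodic:
  fixes f :: "real^'n \<Rightarrow> 'b::real_normed_vector"
  assumes "periodic f" "continuous_on UNIV f"
  shows "bdd_above (range (\<lambda>x. norm (f x)))"
  using periodic_bounded[OF assms] by (auto simp: bdd_above_def)

lemma norm_le_Ck_norm_0:
  fixes f :: "real^'n \<Rightarrow> 'b::real_normed_vector"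
  assumes "periodic f" "continuous_on UNIV f"
  shows "norm (f x) \<le> Ck_norm 0 f"
  using cSUP_upper[OF _ bdd_above_norm_periodic[OF assms]] by simp

lemma pd_eq: "(f has_derivative f') (at x) \<Longrightarrow> pd j f x = f' (axis j 1)"
  unfolding pd_def using frechet_derivative_at by metis

lemma pd_has_derivative:
  "f differentiable (at x) \<Longrightarrow> (f has_derivative frechet_derivative f (at x)) (at x)"
  by (simp add: frechet_derivative_works)

lemma pd_add:
  assumes "f differentiable (at x)" "g differentiable (at x)"
  shows "pd j (\<lambda>x. f x + g x) x = pd j f x + pd j g x"
  using pd_eq[OF has_derivative_add[OF assms[THEN pd_has_derivative]]] by (simp add: pd_def)

lemma pd_diff:
  assumes "f differentiable (at x)" "g differentiable (at x)"
  shows "pd j (\<lambda>x. f x - g x) x = pd j f x - pd j g x"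
  using pd_eq[OF has_derivative_diff[OF assms[THEN pd_has_derivative]]] by (simp add: pd_def)

lemma pd_const [simp]: "pd j (\<lambda>x. c) x = 0"
  using pd_eq[OF has_derivative_const] by metis

lemma (in bounded_linear) pd_commute:
  assumes "g differentiable (at x)"
  shows "pd j (\<lambda>x. f (g x)) x = f (pd j g x)"
  using pd_eq[OF has_derivative[OF pd_has_derivative[OF assms]]] by (simp add: pd_def)

lemma (in bounded_bilinear) pd_product:
  assumes "f differentiable (at x)" "g differentiable (at x)"
  shows "pd j (\<lambda>x. prod (f x) (g x)) x = prod (f x) (pd j g x) + prod (pd j f x) (g x)"
  using pd_eq[OF FDERIV[OF assms[THEN pd_has_derivative]]] by (simp add: pd_def)

lemma pd_real_compose:
  fixes f :: "real^'n \<Rightarrow> real"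
  assumes "f differentiable (at x)" "(\<phi> has_real_derivative c) (at (f x))"
  shows "(\<lambda>x. \<phi> (f x)) differentiable (at x)" "pd j (\<lambda>x. \<phi> (f x)) x = c * pd j f x"
proof -
  have "((\<lambda>x. \<phi> (f x)) has_derivative (\<lambda>h. c * frechet_derivative f (at x) h)) (at x)"
    using has_derivative_compose[OF pd_has_derivative[OF assms(1)], of \<phi> "\<lambda>h. c * h"] assms(2)
    by (simp add: has_field_derivative_def)
  then show "(\<lambda>x. \<phi> (f x)) differentiable (at x)" "pd j (\<lambda>x. \<phi> (f x)) x = c * pd j f x"
    using pd_eq by (auto simp: differentiable_def pd_def)
qed

lemma pd_vector_derivative:
  assumes "f differentiable (at x)"
  shows "((\<lambda>s. f (x + s *\<^sub>R axis j 1)) has_vector_derivative pd j f x) (at 0)"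
proof -
  have "((\<lambda>s. f (x + s *\<^sub>R axis j 1)) has_derivative
      (\<lambda>s. frechet_derivative f (at x) (s *\<^sub>R axis j 1))) (at 0)"
    by (rule has_derivative_compose[of "\<lambda>s. x + s *\<^sub>R axis j 1"])
      (auto intro!: derivative_eq_intros pd_has_derivative assms)
  moreover have "linear (frechet_derivative f (at x))"
    using assms by (simp add: linear_frechet_derivative)
  ultimately show ?thesis
    by (simp add: has_vector_derivative_def pd_def linear_scale)
qed

lemma has_vector_derivative_iff_quotient:
  "(f has_vector_derivative D) (at t) \<longleftrightarrow> ((\<lambda>s. (f s - f t) /\<^sub>R (s - t)) \<longlongrightarrow> D) (at t)"
proof -
  have "norm ((f s - f t) /\<^sub>R (s - t) - D) = norm (f s - f t - (s - t) *\<^sub>R D) / norm (s - t)"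
    if "s \<noteq> t" for s
  proof -
    have "(f s - f t) /\<^sub>R (s - t) - D = (f s - f t - (s - t) *\<^sub>R D) /\<^sub>R (s - t)"
      using that by (simp add: scaleR_diff_right)
    then show ?thesis by (simp add: divide_inverse mult.commute)
  qed
  then have "((\<lambda>s. norm (f s - f t - (s - t) *\<^sub>R D) / norm (s - t)) \<longlongrightarrow> 0) (at t) \<longleftrightarrow>
      ((\<lambda>s. norm ((f s - f t) /\<^sub>R (s - t) - D)) \<longlongrightarrow> 0) (at t)"
    by (intro tendsto_cong) (auto simp: eventually_at intro!: exI[of _ 1])
  then show ?thesis
    unfolding has_vector_derivative_def has_derivative_iff_norm
    using bounded_linear_scaleR_left[of D] by (simp add: tendsto_norm_zero_iff Lim_null[of _ D])
qed

lemma norm_pd_le: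
  assumes "f differentiable (at x)" "\<And>s. norm (f (x + s *\<^sub>R axis j 1) - f x) \<le> C * \<bar>s\<bar>"
  shows "norm (pd j f x) \<le> C"
proof -
  have lim: "((\<lambda>s. norm ((f (x + s *\<^sub>R axis j 1) - f x) /\<^sub>R s)) \<longlongrightarrow> norm (pd j f x)) (at 0)"
    using pd_vector_derivative[OF assms(1), of j]
    by (intro tendsto_norm) (simp add: has_vector_derivative_iff_quotient)
  have "norm ((f (x + s *\<^sub>R axis j 1) - f x) /\<^sub>R s) \<le> C" if "s \<noteq> 0" for s
    using assms(2)[of s] that by (simp add: inverse_eq_divide pos_divide_le_eq)
  then show ?thesis
    by (intro tendsto_upperbound[OF lim]) (auto simp: eventually_at intro!: exI[of _ 1])
qed

lemma periodic_pd:
  fixes f :: "real^'n \<Rightarrow> 'b::real_normed_vector"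
  assumes "periodic f" "\<And>x. f differentiable (at x)"
  shows "periodic (pd i f)"
  unfolding periodic_def
proof safe
  fix x j
  have "((\<lambda>y. f (y + axis j 1)) has_derivative frechet_derivative f (at (x + axis j 1))) (at x)"
    by (rule has_derivative_compose[of "\<lambda>y. y + axis j 1" "\<lambda>h. h"])
      (auto intro!: derivative_eq_intros pd_has_derivative assms)
  moreover have "(\<lambda>y. f (y + axis j 1)) = f" using assms(1) by (auto simp: periodic_def)
  ultimately show "pd i f (x + axis j 1) = pd i f x"
    using pd_eq[of f _ x i] by (simp add: pd_def)
qed


section \<open>Fields with jointly continuous spatial derivatives\<close>

text \<open>Continuity in time with values in \<open>C\<^sup>k\<close> of the torus is the same as joint continuity in space and
  time of all derivatives up to order \<open>k\<close>. The latter form is stable under products and compositions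
  without any estimate of norms. The fields live on the whole time axis, so that no interval has
  to be carried along.\<close>

primrec joint_Ck :: "nat \<Rightarrow> (real \<Rightarrow> real^'n \<Rightarrow> 'b::real_normed_vector) \<Rightarrow> bool" where
  "joint_Ck 0 f \<longleftrightarrow> (\<forall>t. periodic (f t)) \<and> continuous_on UNIV (\<lambda>(t,x). f t x)"
| "joint_Ck (Suc k) f \<longleftrightarrow> (\<forall>t. periodic (f t)) \<and> continuous_on UNIV (\<lambda>(t,x). f t x) \<and>
     (\<forall>t x. f t differentiable (at x)) \<and> (\<forall>j. joint_Ck k (\<lambda>t. pd j (f t)))"

lemma joint_Ck_imp_0: "joint_Ck k f \<Longrightarrow> joint_Ck 0 f"
  by (cases k) auto

lemma joint_Ck_Suc_iff:
  "joint_Ck (Suc k) f \<longleftrightarrow>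
     joint_Ck 0 f \<and> (\<forall>t x. f t differentiable (at x)) \<and> (\<forall>j. joint_Ck k (\<lambda>t. pd j (f t)))"
  by auto

lemma joint_Ck_pd: "joint_Ck (Suc k) f \<Longrightarrow> joint_Ck k (\<lambda>t. pd j (f t))"
  by simp

lemma joint_Ck_differentiable: "joint_Ck (Suc k) f \<Longrightarrow> f t differentiable (at x)"
  by simp

lemma joint_Ck_Suc: "joint_Ck (Suc k) f \<Longrightarrow> joint_Ck k f"
proof (induction k arbitrary: f)
  case 0
  then show ?case by simp
next
  case (Suc k)
  show ?case unfolding joint_Ck_Suc_iff[of k f]
    using Suc.prems Suc.IH[of "\<lambda>t. pd _ (f t)"] by simp
qed

lemma joint_Ck_mono: "k \<le> n \<Longrightarrow> joint_Ck n f \<Longrightarrow> joint_Ck k f"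
  by (induction rule: inc_induct) (blast intro: joint_Ck_Suc)+

lemma joint_Ck_periodic: "joint_Ck k f \<Longrightarrow> periodic (f t)"
  by (cases k) auto

lemma joint_Ck_continuous: "joint_Ck k f \<Longrightarrow> continuous_on UNIV (\<lambda>(t,x). f t x)"
  by (cases k) auto

lemma joint_Ck_continuous_compose:
  assumes "joint_Ck k f" "continuous_on S a" "continuous_on S b"
  shows "continuous_on S (\<lambda>y. f (a y) (b y))"
  using continuous_on_compose2[OF joint_Ck_continuous[OF assms(1)], of S "\<lambda>y. (a y, b y)"] assms(2,3)
  by (auto intro: continuous_intros)

lemma joint_Ck_add: "joint_Ck k f \<Longrightarrow> joint_Ck k g \<Longrightarrow> joint_Ck k (\<lambda>t x. f t x + g t x)"
proof (induction k arbitrary: f g)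
  case 0
  then show ?case
    by (auto simp: periodic_def case_prod_unfold intro!: continuous_intros)
next
  case (Suc k)
  have "pd j (\<lambda>x. f t x + g t x) = (\<lambda>x. pd j (f t) x + pd j (g t) x)" for t j
    using Suc.prems by (auto simp: pd_add)
  with Suc show ?case
    by (auto simp: periodic_def case_prod_unfold intro!: continuous_intros)
qed

lemma joint_Ck_const: "periodic f \<Longrightarrow> Ck k f \<Longrightarrow> joint_Ck k (\<lambda>t. f)"
proof (induction k arbitrary: f)
  case 0
  then show ?case
    by (auto simp: case_prod_unfold intro!: continuous_on_compose2[of UNIV f] continuous_intros)
next
  case (Suc k)
  then have "continuous_on UNIV f"
    by (auto simp: continuous_on_eq_continuous_at differentiable_imp_continuous_within)
  with Suc show ?case
    by (auto simp: case_prod_unfold intro!: continuous_on_compose2[of UNIV f] continuous_intros periodic_pd)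
qed

lemma joint_Ck_time:
  fixes \<theta> :: "real \<Rightarrow> 'b::real_normed_vector"
  assumes "continuous_on UNIV \<theta>"
  shows "joint_Ck k (\<lambda>t (x :: real^'n). \<theta> t)"
proof -
  have *: "continuous_on UNIV (\<lambda>(t, x :: real^'n). \<theta> t)" 
    by (auto simp: case_prod_unfold intro!: continuous_on_compose2[OF assms] continuous_intros)
  have d: "pd j (\<lambda>x. c) = (\<lambda>x. 0)" for j :: 'n and c :: 'b by auto
  have "joint_Ck k (\<lambda>t (x :: real^'n). 0 :: 'b)" for k
    by (induction k) (auto simp: periodic_def case_prod_unfold d)
  then show ?thesis
    using * by (cases k) (auto simp: periodic_def d)
qed

lemma (in bounded_linear) joint_Ck: 
  fixes g :: "real \<Rightarrow> real^'n \<Rightarrow> 'a"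
  shows "joint_Ck k g \<Longrightarrow> joint_Ck k (\<lambda>t x. f (g t x))"
proof (induction k arbitrary: g)
  case 0
  then show ?case
    by (auto simp: periodic_def case_prod_unfold intro!: continuous_on)
next
  case (Suc k)
  have eq: "pd j (\<lambda>x. f (g t x)) = (\<lambda>x. f (pd j (g t) x))" for t j
    using Suc.prems by (auto simp: pd_commute)
  have "(\<lambda>x. f (g t x)) differentiable (at x)" for t x
    using has_derivative[OF Suc.prems[THEN joint_Ck_differentiable, THEN pd_has_derivative]]
    by (auto simp: differentiable_def)
  moreover have "joint_Ck 0 (\<lambda>t x. f (g t x))"
    using joint_Ck_imp_0[OF Suc.prems] by (auto simp: periodic_def case_prod_unfold intro!: continuous_on)
  ultimately show ?case using Suc by (simp add: eq)
qed

lemma (in bounded_bilinear) joint_Ck: 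
  fixes f :: "real \<Rightarrow> real^'n \<Rightarrow> 'a"
  shows "joint_Ck k f \<Longrightarrow> joint_Ck k g \<Longrightarrow> joint_Ck k (\<lambda>t x. prod (f t x) (g t x))"
proof (induction k arbitrary: f g)
  case 0
  then show ?case
    by (auto simp: periodic_def case_prod_unfold intro!: continuous_on)
next
  case (Suc k)
  have eq: "pd j (\<lambda>x. prod (f t x) (g t x)) = (\<lambda>x. prod (f t x) (pd j (g t) x) + prod (pd j (f t) x) (g t x))" for t j
    using Suc.prems by (auto simp: pd_product)
  have "(\<lambda>x. prod (f t x) (g t x)) differentiable (at x)" for t x
    using FDERIV[OF Suc.prems[THEN joint_Ck_differentiable, THEN pd_has_derivative]]
    by (auto simp: differentiable_def)
  moreover have "joint_Ck k (\<lambda>t x. prod (f t x) (pd j (g t) x) + prod (pd j (f t) x) (g t x))" for j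
    by (rule joint_Ck_add[OF Suc.IH[OF joint_Ck_Suc[OF Suc.prems(1)] joint_Ck_pd[OF Suc.prems(2)]]
          Suc.IH[OF joint_Ck_pd[OF Suc.prems(1)] joint_Ck_Suc[OF Suc.prems(2)]]])
  moreover have "joint_Ck 0 (\<lambda>t x. prod (f t x) (g t x))"
    using Suc.prems[THEN joint_Ck_imp_0]
    by (auto simp: periodic_def case_prod_unfold intro!: continuous_on)
  ultimately show ?case by (simp add: eq)
qed

lemmas joint_Ck_mult = bounded_bilinear.joint_Ck[OF bounded_bilinear_mult]
lemmas joint_Ck_scaleR = bounded_bilinear.joint_Ck[OF bounded_bilinear_scaleR]
lemmas joint_Ck_inner = bounded_bilinear.joint_Ck[OF bounded_bilinear_inner]
lemmas joint_Ck_nth = bounded_linear.joint_Ck[OF bounded_linear_vec_nth]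
lemmas joint_Ck_uminus = bounded_linear.joint_Ck[OF bounded_linear_minus[OF bounded_linear_ident]]

lemma joint_Ck_diff: "joint_Ck k f \<Longrightarrow> joint_Ck k g \<Longrightarrow> joint_Ck k (\<lambda>t x. f t x - g t x)"
  using joint_Ck_add[of k f "\<lambda>t x. - g t x"] joint_Ck_uminus[of k g] by simp

lemma joint_Ck_sum:
  "finite S \<Longrightarrow> (\<And>i. i \<in> S \<Longrightarrow> joint_Ck k (f i)) \<Longrightarrow> joint_Ck k (\<lambda>t x. \<Sum>i\<in>S. f i t x)"
proof (induction S rule: finite_induct)
  case empty
  then show ?case using joint_Ck_time[OF continuous_on_const, of k 0] by simp
next
  case (insert i S)
  then show ?case using joint_Ck_add[of k "f i"] by simp
qed

lemma joint_Ck_cmult: "joint_Ck k f \<Longrightarrow> joint_Ck k (\<lambda>t x. c *\<^sub>R f t x)"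
  using joint_Ck_scaleR[OF joint_Ck_time[OF continuous_on_const]] by blast

lemma joint_Ck_powr:
  fixes f :: "real \<Rightarrow> real^'n \<Rightarrow> real"
  assumes "\<And>t x. f t x > 0"
  shows "joint_Ck k f \<Longrightarrow> joint_Ck k (\<lambda>t x. f t x powr a)"
proof (induction k arbitrary: a)
  case 0
  have "f t x \<noteq> 0" for t x using assms[of t x] by simp
  with 0 show ?case
    by (auto simp: periodic_def case_prod_unfold intro!: continuous_intros)
next
  case (Suc k)
  have d: "((\<lambda>r. r powr a) has_real_derivative a * f t x powr (a - 1)) (at (f t x))" for t x
    using assms[of t x] by (auto intro!: derivative_eq_intros)
  have eq: "pd j (\<lambda>x. f t x powr a) = (\<lambda>x. a *\<^sub>R (f t x powr (a - 1) * pd j (f t) x))" for t j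
    using pd_real_compose(2)[OF joint_Ck_differentiable[OF Suc.prems] d] by (simp add: fun_eq_iff)
  have "joint_Ck k (\<lambda>t x. a *\<^sub>R (f t x powr (a - 1) * pd j (f t) x))" for j
    by (rule joint_Ck_cmult[OF joint_Ck_mult[OF Suc.IH[OF joint_Ck_Suc[OF Suc.prems]] joint_Ck_pd[OF Suc.prems]]])
  moreover have "f t x \<noteq> 0" for t x using assms[of t x] by simp
  ultimately show ?case using Suc.prems pd_real_compose(1)[OF joint_Ck_differentiable[OF Suc.prems] d]
    by (auto simp: eq periodic_def case_prod_unfold intro!: continuous_intros)
qed

lemma joint_Ck_imp_Ck_torus: "joint_Ck k f \<Longrightarrow> Ck_torus k (f t)"
proof (induction k arbitrary: f)
  case 0
  then show ?case
    using joint_Ck_continuous_compose[OF 0, of UNIV "\<lambda>x. t" "\<lambda>x. x"] by (auto simp: Ck_torus_def)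
next
  case (Suc k)
  have "Ck k (pd j (f t))" for j
    using Suc.IH[OF joint_Ck_pd[OF Suc.prems]] by (simp add: Ck_torus_def)
  then show ?case using Suc.prems by (simp add: Ck_torus_def)
qed

lemma Ck_torus_iff_joint_Ck: "Ck_torus k f \<longleftrightarrow> joint_Ck k (\<lambda>t. f)"
  using joint_Ck_const joint_Ck_imp_Ck_torus unfolding Ck_torus_def by blast

lemma Ck_torus_pd: "Ck_torus (Suc k) f \<Longrightarrow> Ck_torus k (pd j f)"
  unfolding Ck_torus_iff_joint_Ck by (rule joint_Ck_pd)

lemma Ck_torus_diff: "Ck_torus k f \<Longrightarrow> Ck_torus k g \<Longrightarrow> Ck_torus k (\<lambda>x. f x - g x)"
  unfolding Ck_torus_iff_joint_Ck by (rule joint_Ck_diff)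

lemma Ck_torus_imp_0: "Ck_torus k f \<Longrightarrow> Ck_torus 0 f"
  unfolding Ck_torus_iff_joint_Ck by (rule joint_Ck_imp_0)

lemma Ck_norm_0_nonneg: "Ck_torus 0 f \<Longrightarrow> 0 \<le> Ck_norm 0 f"
  using norm_le_Ck_norm_0[of f 0] norm_ge_zero order_trans unfolding Ck_torus_def Ck.simps by blast

lemma Ck_norm_Suc: "Ck_norm (Suc k) f = Ck_norm 0 f + (\<Sum>j\<in>UNIV. Ck_norm k (pd j f))"
  by simp

lemma Ck_norm_nonneg: "Ck_torus k f \<Longrightarrow> 0 \<le> Ck_norm k f"
proof (induction k arbitrary: f)
  case 0
  then show ?case by (rule Ck_norm_0_nonneg)
next
  case (Suc k)
  then show ?case unfolding Ck_norm_Suc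
    by (intro add_nonneg_nonneg sum_nonneg Ck_norm_0_nonneg Ck_torus_imp_0[of "Suc k"]) (auto intro: Ck_torus_pd)
qed

lemma Ck_norm_0_le:
  fixes g :: "real^'n \<Rightarrow> 'b::real_normed_vector"
  assumes "\<And>x. norm (g x) \<le> e"
  shows "Ck_norm 0 g \<le> e"
  using assms by (auto intro!: cSUP_least)

lemma pd_diff_fun:
  assumes "Ck_torus (Suc k) f" "Ck_torus (Suc k) g"
  shows "pd j (\<lambda>x. f x - g x) = (\<lambda>x. pd j f x - pd j g x)"
  using assms by (auto simp: Ck_torus_def pd_diff)

lemma C0_Ck_SucD:
  fixes f :: "real \<Rightarrow> real^'n \<Rightarrow> 'b::real_normed_vector"
  assumes "C0_Ck I (Suc k) f"
  shows "C0_Ck I 0 f" "C0_Ck I k (\<lambda>t. pd j (f t))"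
proof -
  have f: "Ck_torus (Suc k) (f t)" if "t \<in> I" for t using assms that by (simp add: C0_Ck_def)
  have lim: "((\<lambda>s. Ck_norm (Suc k) (\<lambda>x. f s x - f t x)) \<longlongrightarrow> 0) (at t within I)" if "t \<in> I" for t
    using assms that unfolding C0_Ck_def by blast
  have nonneg: "0 \<le> Ck_norm 0 (\<lambda>x. f s x - f t x)" "0 \<le> Ck_norm k (pd j (\<lambda>x. f s x - f t x))"
    if "s \<in> I" "t \<in> I" for s t j
    using Ck_norm_nonneg[OF Ck_torus_imp_0[OF Ck_torus_diff[OF f f]]]
      Ck_norm_nonneg[OF Ck_torus_pd[OF Ck_torus_diff[OF f f]]] that by blast+
  have in_I: "eventually (\<lambda>s. s \<in> I) (at t within I)" for t
    by (simp add: eventually_at_filter)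
  have "((\<lambda>s. Ck_norm 0 (\<lambda>x. f s x - f t x)) \<longlongrightarrow> 0) (at t within I)" if "t \<in> I" for t
  proof (rule tendsto_sandwich[OF _ _ tendsto_const lim[OF that]])
    show "eventually (\<lambda>s. 0 \<le> Ck_norm 0 (\<lambda>x. f s x - f t x)) (at t within I)"
      using in_I by eventually_elim (use nonneg that in blast)
    show "eventually (\<lambda>s. Ck_norm 0 (\<lambda>x. f s x - f t x) \<le> Ck_norm (Suc k) (\<lambda>x. f s x - f t x)) (at t within I)"
      using in_I unfolding Ck_norm_Suc
      by eventually_elim (simp add: sum_nonneg nonneg that del: Ck_norm.simps)
  qed
  then show "C0_Ck I 0 f" using f Ck_torus_imp_0 unfolding C0_Ck_def by blast
  have lim_pd: "((\<lambda>s. Ck_norm k (pd j (\<lambda>x. f s x - f t x))) \<longlongrightarrow> 0) (at t within I)" if "t \<in> I" for t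
  proof (rule tendsto_sandwich[OF _ _ tendsto_const lim[OF that]])
    show "eventually (\<lambda>s. 0 \<le> Ck_norm k (pd j (\<lambda>x. f s x - f t x))) (at t within I)"
      using in_I by eventually_elim (use nonneg that in blast)
    show "eventually (\<lambda>s. Ck_norm k (pd j (\<lambda>x. f s x - f t x)) \<le> Ck_norm (Suc k) (\<lambda>x. f s x - f t x)) (at t within I)"
      using in_I
    proof eventually_elim
      case (elim s)
      have "Ck_norm k (pd j (\<lambda>x. f s x - f t x)) \<le> (\<Sum>j\<in>UNIV. Ck_norm k (pd j (\<lambda>x. f s x - f t x)))"
        by (rule member_le_sum) (use elim that nonneg in auto)
      then show ?case unfolding Ck_norm_Suc using nonneg(1)[OF elim that] by linarith
    qed
  qed
  have "((\<lambda>s. Ck_norm k (\<lambda>x. pd j (f s) x - pd j (f t) x)) \<longlongrightarrow> 0) (at t within I)" if t: "t \<in> I" for t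
  proof (rule Lim_transform_eventually[OF lim_pd[OF t]])
    show "eventually (\<lambda>s. Ck_norm k (pd j (\<lambda>x. f s x - f t x)) = Ck_norm k (\<lambda>x. pd j (f s) x - pd j (f t) x)) (at t within I)"
      using in_I[of t]
    proof eventually_elim
      case (elim s)
      show ?case by (simp only: pd_diff_fun[OF f[OF elim] f[OF t]])
    qed
  qed
  then show "C0_Ck I k (\<lambda>t. pd j (f t))" using f Ck_torus_pd unfolding C0_Ck_def by blast
qed

lemma C0_Ck_0_imp_joint_Ck:
  fixes f :: "real \<Rightarrow> real^'n \<Rightarrow> 'b::real_normed_vector"
  assumes "T \<ge> 0" and 0: "C0_Ck {0..T} 0 f"
  shows "joint_Ck 0 (\<lambda>t. f (max 0 (min T t)))"
proof -
  define c where "c t = max 0 (min T t)" for t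
  have c: "c t \<in> {0..T}" for t using assms by (auto simp: c_def)
  have cc: "continuous_on UNIV c" unfolding c_def by (intro continuous_intros)
  have f: "periodic (f (c t))" "continuous_on UNIV (f (c t))" for t
    using 0 c by (auto simp: C0_Ck_def Ck_torus_def)
  have "isCont (\<lambda>(t,x). f (c t) x) (t0, x0)" for t0 x0
  proof -
    define N where "N = (\<lambda>s. Ck_norm 0 (\<lambda>x. f s x - f (c t0) x))"
    have "continuous (at (c t0) within {0..T}) (\<lambda>s. Ck_norm 0 (\<lambda>x. f s x - f (c t0) x))"
      using 0 c[of t0] unfolding C0_Ck_def continuous_within by simp
    moreover have "c ` UNIV \<subseteq> {0..T}" using c by auto
    ultimately have "continuous (at (c t0) within c ` UNIV) N"
      unfolding N_def using continuous_within_subset by blast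
    moreover have "continuous (at t0) c" using cc by (simp add: continuous_on_eq_continuous_at)
    ultimately have "isCont (\<lambda>t. N (c t)) t0"
      using continuous_within_compose2[of t0 UNIV c N] by blast
    then have "isCont (\<lambda>p. N (c (fst p))) (t0, x0)"
      using isCont_o2[of "(t0, x0)" fst "\<lambda>t. N (c t)"] by simp
    then have A: "((\<lambda>p. Ck_norm 0 (\<lambda>x. f (c (fst p)) x - f (c t0) x)) \<longlongrightarrow> 0) (at (t0, x0))"
      by (simp add: isCont_def N_def)
    have "continuous_on UNIV (\<lambda>p :: real \<times> (real^'n). f (c t0) (snd p))"
      by (rule continuous_on_compose2[OF f(2)]) (auto intro: continuous_intros)
    then have "isCont (\<lambda>p. norm (f (c t0) (snd p) - f (c t0) x0)) (t0, x0)"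
      by (intro continuous_intros) (simp add: continuous_on_eq_continuous_at)
    then have B: "((\<lambda>p. norm (f (c t0) (snd p) - f (c t0) x0)) \<longlongrightarrow> 0) (at (t0, x0))"
      by (simp add: isCont_def)
    have "norm (f (c t) x - f (c t0) x0) \<le>
        Ck_norm 0 (\<lambda>x. f (c t) x - f (c t0) x) + norm (f (c t0) x - f (c t0) x0)" for t x
    proof -
      have "norm (f (c t) x - f (c t0) x) \<le> Ck_norm 0 (\<lambda>x. f (c t) x - f (c t0) x)"
        by (rule norm_le_Ck_norm_0) (use f in \<open>auto simp: periodic_def intro: continuous_on_diff\<close>)
      then show ?thesis
        using norm_triangle_ineq[of "f (c t) x - f (c t0) x" "f (c t0) x - f (c t0) x0"] by simp
    qed
    then have "((\<lambda>p. f (c (fst p)) (snd p) - f (c t0) x0) \<longlongrightarrow> 0) (at (t0, x0))"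
      by (intro Lim_null_comparison[OF always_eventually tendsto_add_zero[OF A B]]) (simp del: Ck_norm.simps)
    then show ?thesis by (simp add: isCont_def case_prod_unfold LIM_zero_iff)
  qed
  then show ?thesis
    using f(1) by (auto simp: c_def continuous_on_eq_continuous_at)
qed

text \<open>Freezing a field at the ends of its time interval keeps its spatial regularity and makes it
  jointly continuous for all times.\<close>

lemma C0_Ck_imp_joint_Ck:
  fixes f :: "real \<Rightarrow> real^'n \<Rightarrow> 'b::real_normed_vector"
  assumes "T \<ge> 0"
  shows "C0_Ck {0..T} k f \<Longrightarrow> joint_Ck k (\<lambda>t. f (max 0 (min T t)))"
proof (induction k arbitrary: f)
  case 0
  then show ?case by (rule C0_Ck_0_imp_joint_Ck[OF assms])
next
  case (Suc k)
  have "f (max 0 (min T t)) differentiable (at x)" for t x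
    using Suc.prems assms by (auto simp: C0_Ck_def Ck_torus_def)
  moreover have "joint_Ck k (\<lambda>t. pd j (f (max 0 (min T t))))" for j
    by (rule Suc.IH[OF C0_Ck_SucD(2)[OF Suc.prems]])
  ultimately show ?case
    unfolding joint_Ck_Suc_iff using C0_Ck_0_imp_joint_Ck[OF assms C0_Ck_SucD(1)[OF Suc.prems]] by blast
qed

text \<open>By periodicity only the compact unit cell matters, so continuity in time is uniform in space.\<close>

lemma joint_Ck_uniformly_continuous:
  fixes f :: "real \<Rightarrow> real^'n \<Rightarrow> 'b::real_normed_vector"
  assumes "joint_Ck k f" "e > 0"
  shows "\<exists>\<delta>>0. \<forall>s\<in>{a..b}. \<forall>t\<in>{a..b}. \<bar>s - t\<bar> < \<delta> \<longrightarrow> (\<forall>x. norm (f s x - f t x) < e)"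
proof -
  have "uniformly_continuous_on ({a..b} \<times> cbox 0 1) (\<lambda>(t,x). f t x)"
    by (intro compact_uniformly_continuous compact_Times)
      (auto intro: continuous_on_subset[OF joint_Ck_continuous[OF assms(1)]])
  then obtain \<delta> where \<delta>: "\<delta> > 0"
    "\<And>p q. p \<in> {a..b} \<times> cbox 0 1 \<Longrightarrow> q \<in> {a..b} \<times> cbox 0 1 \<Longrightarrow> dist q p < \<delta> \<Longrightarrow>
       dist (case q of (t,x) \<Rightarrow> f t x) (case p of (t,x) \<Rightarrow> f t x) < e"
    unfolding uniformly_continuous_on_def using assms(2) by metis
  have "norm (f s x - f t x) < e" if "s \<in> {a..b}" "t \<in> {a..b}" "\<bar>s - t\<bar> < \<delta>" for s t x
    using \<delta>(2)[of "(t, cell_point x)" "(s, cell_point x)"] that cell_point_in_cbox[of x]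
      periodic_cell_point[OF joint_Ck_periodic[OF assms(1)], of _ x]
    by (simp add: dist_norm norm_Pair)
  with \<delta>(1) show ?thesis by blast
qed

lemma joint_Ck_bounded:
  fixes f :: "real \<Rightarrow> real^'n \<Rightarrow> 'b::real_normed_vector"
  assumes "joint_Ck k f"
  shows "\<exists>B>0. \<forall>t\<in>{a..b}. \<forall>x. norm (f t x) \<le> B"
proof -
  have "compact ((\<lambda>(t,x). f t x) ` ({a..b} \<times> cbox 0 1))"
    by (intro compact_continuous_image compact_Times)
      (auto intro: continuous_on_subset[OF joint_Ck_continuous[OF assms(1)]])
  then obtain B where B: "B > 0" "\<forall>y\<in>(\<lambda>(t,x). f t x) ` ({a..b} \<times> cbox 0 1). norm y \<le> B"
    using compact_imp_bounded bounded_pos by metis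
  have "norm (f t x) \<le> B" if "t \<in> {a..b}" for t x
    using B(2) that cell_point_in_cbox[of x] periodic_cell_point[OF joint_Ck_periodic[OF assms(1)], of t x]
    by force
  with B(1) show ?thesis by blast
qed

lemma joint_Ck_tendsto_Ck_norm_0:
  fixes f :: "real \<Rightarrow> real^'n \<Rightarrow> 'b::real_normed_vector"
  assumes "joint_Ck k f"
  shows "((\<lambda>s. Ck_norm 0 (\<lambda>x. f s x - f t x)) \<longlongrightarrow> 0) (at t)"
proof (rule tendstoI)
  fix e :: real assume e: "e > 0"
  obtain \<delta> where \<delta>: "\<delta> > 0"
    "\<forall>s\<in>{t-1..t+1}. \<forall>t'\<in>{t-1..t+1}. \<bar>s - t'\<bar> < \<delta> \<longrightarrow> (\<forall>x. norm (f s x - f t' x) < e/2)"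
    using joint_Ck_uniformly_continuous[OF assms, of "e/2" "t-1" "t+1"] e by auto
  have "dist (Ck_norm 0 (\<lambda>x. f s x - f t x)) 0 < e" if st: "dist s t < min 1 \<delta>" for s
  proof -
    have "s \<in> {t-1..t+1}" "t \<in> {t-1..t+1}" "\<bar>s - t\<bar> < \<delta>" using st by (auto simp: dist_real_def)
    then have "norm (f s x - f t x) \<le> e/2" for x using \<delta>(2) less_imp_le by blast
    then have "Ck_norm 0 (\<lambda>x. f s x - f t x) \<le> e/2" by (rule Ck_norm_0_le)
    moreover have "0 \<le> Ck_norm 0 (\<lambda>x. f s x - f t x)"
      by (intro Ck_norm_0_nonneg Ck_torus_diff Ck_torus_imp_0[OF joint_Ck_imp_Ck_torus[OF assms]])
    ultimately show ?thesis using e by (simp add: dist_real_def)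
  qed
  then show "eventually (\<lambda>s. dist (Ck_norm 0 (\<lambda>x. f s x - f t x)) 0 < e) (at t)"
    unfolding eventually_at using \<delta>(1) by (intro exI[of _ "min 1 \<delta>"]) auto
qed

lemma joint_Ck_imp_C0_Ck:
  fixes f :: "real \<Rightarrow> real^'n \<Rightarrow> 'b::real_normed_vector"
  assumes "joint_Ck k f"
  shows "C0_Ck I k f"
proof -
  have lim: "((\<lambda>s. Ck_norm k (\<lambda>x. f s x - f t x)) \<longlongrightarrow> 0) (at t)" if "joint_Ck k f" for t k and f :: "real \<Rightarrow> real^'n \<Rightarrow> 'b"
    using that
  proof (induction k arbitrary: f)
    case 0
    then show ?case by (rule joint_Ck_tendsto_Ck_norm_0)
  next
    case (Suc k)
    have "pd j (\<lambda>x. f s x - f t x) = (\<lambda>x. pd j (f s) x - pd j (f t) x)" for s j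
      by (rule pd_diff_fun[OF joint_Ck_imp_Ck_torus joint_Ck_imp_Ck_torus]) (rule Suc.prems)+
    then have "((\<lambda>s. Ck_norm k (pd j (\<lambda>x. f s x - f t x))) \<longlongrightarrow> 0) (at t)" for j
      using Suc.IH[OF joint_Ck_pd[OF Suc.prems]] by simp
    moreover have "((\<lambda>s. Ck_norm 0 (\<lambda>x. f s x - f t x)) \<longlongrightarrow> 0) (at t)"
      by (rule joint_Ck_tendsto_Ck_norm_0[OF Suc.prems])
    ultimately show ?case unfolding Ck_norm_Suc by (auto intro!: tendsto_add_zero tendsto_null_sum)
  qed
  show ?thesis unfolding C0_Ck_def
    using joint_Ck_imp_Ck_torus[OF assms] tendsto_within_subset[OF lim[OF assms] subset_UNIV] by blast
qed


section \<open>Time derivatives and test functions\<close>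

lemma Ck_torus_scaleR: "Ck_torus k f \<Longrightarrow> Ck_torus k (\<lambda>x. c *\<^sub>R f x)"
  unfolding Ck_torus_iff_joint_Ck by (rule joint_Ck_cmult)

lemma pd_vector_derivative_shift:
  assumes "\<And>y. f differentiable (at y)"
  shows "((\<lambda>s. f (x + s *\<^sub>R axis j 1)) has_vector_derivative pd j f (x + s *\<^sub>R axis j 1)) (at s)"
proof -
  have "((\<lambda>h. f ((x + s *\<^sub>R axis j 1) + h *\<^sub>R axis j 1)) has_vector_derivative pd j f (x + s *\<^sub>R axis j 1)) (at (s - s))"
    using pd_vector_derivative[OF assms, of "x + s *\<^sub>R axis j 1" j] by simp
  then have "((\<lambda>r. f ((x + s *\<^sub>R axis j 1) + (r - s) *\<^sub>R axis j 1)) has_vector_derivative 1 *\<^sub>R pd j f (x + s *\<^sub>R axis j 1)) (at s)"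
    by (intro vector_diff_chain_at[of "\<lambda>r. r - s" 1 s, unfolded o_def]) (auto intro!: derivative_eq_intros)
  then show ?thesis by (simp add: algebra_simps)
qed

text \<open>Only derivatives in the coordinate direction are controlled, hence only increments along the axis.\<close>

lemma lipschitz_pd:
  assumes "\<And>y. f differentiable (at y)" "\<And>y. norm (pd j f y) \<le> C"
  shows "norm (f (x + s *\<^sub>R axis j 1) - f x) \<le> C * \<bar>s\<bar>"
proof -
  have "((\<lambda>s. f (x + s *\<^sub>R axis j 1)) has_vector_derivative pd j f (x + s *\<^sub>R axis j 1)) (at s)" for s
    by (rule pd_vector_derivative_shift[OF assms(1)])
  then have "norm (f (x + s *\<^sub>R axis j 1) - f (x + 0 *\<^sub>R axis j 1)) \<le> C * norm (s - 0)"
    by (intro differentiable_bound[of UNIV "\<lambda>s. f (x + s *\<^sub>R axis j 1)"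
          "\<lambda>s h. h *\<^sub>R pd j f (x + s *\<^sub>R axis j 1)"])
      (auto simp: has_vector_derivative_def intro!: onorm_le mult_left_mono assms(2) simp: mult.commute[of C])
  then show ?thesis by simp
qed

lemma vector_mvt_linearization:
  fixes g :: "real \<Rightarrow> 'b::real_normed_vector"
  assumes "\<And>\<tau>. (g has_vector_derivative g' \<tau>) (at \<tau>)" "\<And>\<tau>. \<bar>\<tau> - t\<bar> \<le> \<bar>s - t\<bar> \<Longrightarrow> norm (g' \<tau> - g' t) \<le> B"
  shows "norm (g s - g t - (s - t) *\<^sub>R g' t) \<le> B * \<bar>s - t\<bar>"
proof -
  have "norm (g s - g t - (s - t) *\<^sub>R g' t) \<le> norm (s - t) * B"
  proof (rule vector_differentiable_bound_linearization[of "closed_segment t s" g g'])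
    show "norm (g' \<tau> - g' t) \<le> B" if "\<tau> \<in> closed_segment t s" for \<tau>
      using that by (intro assms(2)) (auto simp: closed_segment_eq_real_ivl split: if_splits)
  qed (auto intro: has_vector_derivative_at_within assms(1))
  then show ?thesis by (simp add: mult.commute)
qed

text \<open>The mean value theorem, applied once in time and once to increments in space, upgrades a
  pointwise time derivative to a derivative in the norm of \<open>C\<^sup>1\<close>.\<close>

lemma pointwise_derivative_imp_C1_Ck:
  fixes g g' :: "real \<Rightarrow> real^'n \<Rightarrow> 'b::real_normed_vector"
  assumes g: "joint_Ck 1 g" and g': "joint_Ck 1 g'"
    and deriv: "\<And>t x. ((\<lambda>s. g s x) has_vector_derivative g' t x) (at t)"
  shows "C1_Ck I 1 g"
proof -
  have dg: "g t differentiable (at x)" "g' t differentiable (at x)" for t x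
    using g g' by auto
  have lim: "((\<lambda>s. Ck_norm 1 (\<lambda>x. (g s x - g t x) /\<^sub>R (s - t) - g' t x)) \<longlongrightarrow> 0) (at t)" for t
  proof (rule tendstoI)
    fix e :: real assume e: "e > 0"
    define e1 where "e1 = e / (2 * (1 + CARD('n)))"
    have e1: "e1 > 0" "e1 * (1 + CARD('n)) < e" using e by (auto simp: e1_def field_simps add_pos_nonneg)
    obtain d0 where d0: "d0 > 0" "\<forall>s\<in>{t-1..t+1}. \<forall>r\<in>{t-1..t+1}. \<bar>s - r\<bar> < d0 \<longrightarrow> (\<forall>x. norm (g' s x - g' r x) < e1)"
      using joint_Ck_uniformly_continuous[OF g' e1(1)] by blast
    have "\<exists>d>0. \<forall>s\<in>{t-1..t+1}. \<forall>r\<in>{t-1..t+1}. \<bar>s - r\<bar> < d \<longrightarrow> (\<forall>x. norm (pd j (g' s) x - pd j (g' r) x) < e1)" for j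
      using joint_Ck_uniformly_continuous[OF joint_Ck_pd[of 0 g' j] e1(1)] g' by simp
    then obtain d where d: "\<And>j. d j > 0" "\<And>j. \<forall>s\<in>{t-1..t+1}. \<forall>r\<in>{t-1..t+1}. \<bar>s - r\<bar> < d j \<longrightarrow> (\<forall>x. norm (pd j (g' s) x - pd j (g' r) x) < e1)"
      by metis
    define \<delta> where "\<delta> = min 1 (min d0 (Min (range d)))"
    have \<delta>: "\<delta> > 0" "\<delta> \<le> 1" "\<delta> \<le> d0" "\<And>j. \<delta> \<le> d j"
      using d(1) d0(1) by (auto simp: \<delta>_def min.coboundedI2)
    have "dist (Ck_norm 1 (\<lambda>x. (g s x - g t x) /\<^sub>R (s - t) - g' t x)) 0 < e"
      if s: "s \<noteq> t" "dist s t < \<delta>" for s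
    proof -
      define q where "q = (\<lambda>x. (g s x - g t x) /\<^sub>R (s - t) - g' t x)"
      have q_diff: "q differentiable (at x)" for x
        unfolding q_def using dg by (intro derivative_intros) auto
      have scale: "norm (((A - B) /\<^sub>R (s - t)) - C) \<le> c" if "norm (A - B - (s - t) *\<^sub>R C) \<le> c * \<bar>s - t\<bar>" for A B C :: 'b and c
      proof -
        have "((A - B) /\<^sub>R (s - t)) - C = (A - B - (s - t) *\<^sub>R C) /\<^sub>R (s - t)"
          using s by (simp add: scaleR_diff_right)
        then show ?thesis using that s by (simp add: divide_simps mult.commute)
      qed
      have near: "r \<in> {t-1..t+1}" "\<bar>r - t\<bar> < \<delta>" if "\<bar>r - t\<bar> \<le> \<bar>s - t\<bar>" for r
        using that s \<delta>(2) by (auto simp: dist_real_def)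
      have t1: "t \<in> {t-1..t+1}" by simp
      have "norm (q x) \<le> e1" for x
        unfolding q_def
      proof (intro scale vector_mvt_linearization deriv)
        fix r assume "\<bar>r - t\<bar> \<le> \<bar>s - t\<bar>"
        from near[OF this] show "norm (g' r x - g' t x) \<le> e1" using d0(2) \<delta>(3) t1 by (meson less_imp_le less_le_trans)
      qed
      then have A: "Ck_norm 0 q \<le> e1" by (rule Ck_norm_0_le)
      have "norm (pd j q x) \<le> e1" for j x
      proof (rule norm_pd_le[OF q_diff])
        fix h :: real
        define y where "y = x + h *\<^sub>R axis j 1"
        have "norm ((g s y - g s x) - (g t y - g t x) - (s - t) *\<^sub>R (g' t y - g' t x)) \<le> (e1 * \<bar>h\<bar>) * \<bar>s - t\<bar>"
        proof (rule vector_mvt_linearization[where g' = "\<lambda>r. g' r y - g' r x"])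
          fix r assume r: "\<bar>r - t\<bar> \<le> \<bar>s - t\<bar>"
          have "norm (pd j (\<lambda>x. g' r x - g' t x) z) \<le> e1" for z
          proof -
            have "norm (pd j (g' r) z - pd j (g' t) z) < e1"
              using near[OF r] d(2)[of j] \<delta>(4)[of j] t1 less_le_trans by blast
            then show ?thesis using dg by (simp add: pd_diff)
          qed
          from lipschitz_pd[OF _ this] have "norm ((g' r y - g' t y) - (g' r x - g' t x)) \<le> e1 * \<bar>h\<bar>"
            unfolding y_def using dg by (auto intro: differentiable_diff)
          then show "norm ((g' r y - g' r x) - (g' t y - g' t x)) \<le> e1 * \<bar>h\<bar>"
            by (simp add: algebra_simps)
        qed (intro derivative_intros deriv)
        then have "norm (((g s y - g s x) - (g t y - g t x)) /\<^sub>R (s - t) - (g' t y - g' t x)) \<le> e1 * \<bar>h\<bar>"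
          by (rule scale)
        moreover have "((g s y - g s x) - (g t y - g t x)) /\<^sub>R (s - t) - (g' t y - g' t x) = q y - q x"
          by (simp add: q_def scaleR_diff_right)
        ultimately show "norm (q (x + h *\<^sub>R axis j 1) - q x) \<le> e1 * \<bar>h\<bar>" by (simp add: y_def)
      qed
      then have B: "Ck_norm 0 (pd j q) \<le> e1" for j by (rule Ck_norm_0_le)
      have "Ck_norm 1 q \<le> e1 + (\<Sum>j\<in>(UNIV :: 'n set). e1)"
        unfolding One_nat_def Ck_norm_Suc by (intro add_mono A sum_mono B)
      also have "\<dots> < e" using e1(2) by (simp add: algebra_simps)
      finally have up: "Ck_norm 1 q < e" .
      have "Ck_torus 1 q"
        unfolding q_def using g g'
        by (intro Ck_torus_diff Ck_torus_scaleR joint_Ck_imp_Ck_torus)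
      then have "0 \<le> Ck_norm 1 q" by (rule Ck_norm_nonneg)
      with up show ?thesis by (simp add: q_def dist_real_def)
    qed
    then show "eventually (\<lambda>s. dist (Ck_norm 1 (\<lambda>x. (g s x - g t x) /\<^sub>R (s - t) - g' t x)) 0 < e) (at t)"
      unfolding eventually_at using \<delta>(1) by blast
  qed
  show ?thesis
    unfolding C1_Ck_def
    using joint_Ck_imp_C0_Ck[OF g] joint_Ck_imp_C0_Ck[OF g'] tendsto_within_subset[OF lim subset_UNIV] by blast
qed

lemma C1_Ck_imp_pointwise_derivative:
  fixes f :: "real \<Rightarrow> real^'n \<Rightarrow> 'b::real_normed_vector"
  assumes "C1_Ck {a<..<b} k f" "t \<in> {a<..<b}"
  shows "((\<lambda>s. f s x) has_vector_derivative ddt f t x) (at t)"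
proof -
  obtain f' where f': "C0_Ck {a<..<b} k f'"
    "((\<lambda>s. Ck_norm k (\<lambda>x. (f s x - f t x) /\<^sub>R (s - t) - f' t x)) \<longlongrightarrow> 0) (at t within {a<..<b})"
    using assms unfolding C1_Ck_def by blast
  have f: "C0_Ck {a<..<b} k f" using assms unfolding C1_Ck_def by blast
  have lim: "((\<lambda>s. Ck_norm k (\<lambda>x. (f s x - f t x) /\<^sub>R (s - t) - f' t x)) \<longlongrightarrow> 0) (at t)"
    using f'(2) assms(2) by (simp add: at_within_open[of t "{a<..<b}"])
  have "eventually (\<lambda>s. s \<in> {a<..<b}) (at t)"
    using assms(2) unfolding eventually_at_topological by (intro exI[of _ "{a<..<b}"]) auto
  then have "eventually (\<lambda>s. norm ((f s x - f t x) /\<^sub>R (s - t) - f' t x) \<le>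
      Ck_norm k (\<lambda>x. (f s x - f t x) /\<^sub>R (s - t) - f' t x)) (at t)"
  proof eventually_elim
    case (elim s)
    have T: "Ck_torus k (f s)" "Ck_torus k (f t)" "Ck_torus k (f' t)"
      using f f'(1) elim assms(2) unfolding C0_Ck_def by auto
    have q: "Ck_torus k (\<lambda>x. (f s x - f t x) /\<^sub>R (s - t) - f' t x)"
      by (intro Ck_torus_diff Ck_torus_scaleR T)
    have "norm ((f s x - f t x) /\<^sub>R (s - t) - f' t x) \<le> Ck_norm 0 (\<lambda>x. (f s x - f t x) /\<^sub>R (s - t) - f' t x)"
      using Ck_torus_imp_0[OF q] unfolding Ck_torus_def by (intro norm_le_Ck_norm_0) auto
    also have "\<dots> \<le> Ck_norm k (\<lambda>x. (f s x - f t x) /\<^sub>R (s - t) - f' t x)"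
      using q Ck_norm_nonneg[OF Ck_torus_pd]
      by (cases k) (auto simp del: Ck_norm.simps simp: Ck_norm_Suc intro!: sum_nonneg)
    finally show ?case .
  qed
  then have "((\<lambda>s. (f s x - f t x) /\<^sub>R (s - t) - f' t x) \<longlongrightarrow> 0) (at t)"
    by (rule Lim_null_comparison[OF _ lim])
  then have "((\<lambda>s. f s x) has_vector_derivative f' t x) (at t)"
    unfolding has_vector_derivative_iff_quotient by (simp add: LIM_zero_iff)
  then show ?thesis by (simp add: ddt_def vector_derivative_at)
qed

text \<open>The derivative is an explicit argument, since it appears in all identities that are tested by a
  cutoff. A localized field vanishes outside of \<open>{a..b}\<close>, so the field
  itself has to be differentiable in time on \<open>{a..b}\<close> only.\<close>

definition cutoff :: "(real \<Rightarrow> real) \<Rightarrow> (real \<Rightarrow> real) \<Rightarrow> real \<Rightarrow> real \<Rightarrow> bool" where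
  "cutoff \<theta> \<theta>' a b \<longleftrightarrow> (\<forall>t. (\<theta> has_real_derivative \<theta>' t) (at t)) \<and> continuous_on UNIV \<theta>' \<and>
     (\<forall>t. t \<notin> {a..b} \<longrightarrow> \<theta> t = 0)"

lemma cutoff_deriv: "cutoff \<theta> \<theta>' a b \<Longrightarrow> (\<theta> has_real_derivative \<theta>' t) (at t)"
  by (simp add: cutoff_def)

lemma cutoff_continuous: "cutoff \<theta> \<theta>' a b \<Longrightarrow> continuous_on UNIV \<theta>"
  unfolding cutoff_def by (meson DERIV_isCont continuous_at_imp_continuous_on)

lemma cutoff_continuous': "cutoff \<theta> \<theta>' a b \<Longrightarrow> continuous_on UNIV \<theta>'"
  by (simp add: cutoff_def)

lemma cutoff_zero: "cutoff \<theta> \<theta>' a b \<Longrightarrow> t \<notin> {a..b} \<Longrightarrow> \<theta> t = 0"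
  by (simp add: cutoff_def)

lemma cutoff_zero':
  assumes "cutoff \<theta> \<theta>' a b" "t \<notin> {a..b}"
  shows "\<theta>' t = 0"
proof -
  have "open (- {a..b})" by auto
  then have "((\<lambda>t. 0) has_real_derivative \<theta>' t) (at t)"
    using has_field_derivative_transform_within_open[OF cutoff_deriv[OF assms(1)], of "-{a..b}" t "\<lambda>_. 0"]
      cutoff_zero[OF assms(1)] assms(2) by auto
  then show ?thesis using DERIV_unique[OF DERIV_const] by metis
qed

lemma cutoff_time_derivative:
  assumes "cutoff \<theta> \<theta>' a b" "\<And>t x. t \<in> {a..b} \<Longrightarrow> ((\<lambda>s. f s x) has_vector_derivative f' t x) (at t)"
  shows "((\<lambda>s. \<theta> s *\<^sub>R f s x) has_vector_derivative \<theta>' t *\<^sub>R f t x + \<theta> t *\<^sub>R f' t x) (at t)"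
proof (cases "t \<in> {a..b}")
  case True
  then show ?thesis
    using has_vector_derivative_scaleR[OF cutoff_deriv[OF assms(1), of t] assms(2)[OF True, of x]]
    by (simp add: add.commute)
next
  case False
  have "open (- {a..b})" by auto
  then have "((\<lambda>s. \<theta> s *\<^sub>R f s x) has_vector_derivative 0) (at t)"
    by (rule has_vector_derivative_transform_within_open[OF has_vector_derivative_const[of 0]])
      (use False cutoff_zero[OF assms(1)] in auto)
  then show ?thesis using cutoff_zero[OF assms(1) False] cutoff_zero'[OF assms(1) False] by simp
qed

lemma cutoff_test_fun:
  fixes f f' :: "real \<Rightarrow> real^'n \<Rightarrow> 'b::real_normed_vector"
  assumes \<theta>: "cutoff \<theta> \<theta>' a b" "0 < a" and f: "joint_Ck 1 f" "joint_Ck 1 f'"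
    and deriv: "\<And>t x. t \<in> {a..b} \<Longrightarrow> ((\<lambda>s. f s x) has_vector_derivative f' t x) (at t)"
  shows "interior_test_fun (\<lambda>t x. \<theta> t *\<^sub>R f t x)"
    and "ddt (\<lambda>t x. \<theta> t *\<^sub>R f t x) t x = \<theta>' t *\<^sub>R f t x + \<theta> t *\<^sub>R f' t x"
proof -
  note d = cutoff_time_derivative[OF \<theta>(1) deriv]
  have "C1_Ck {0..} 1 (\<lambda>t x. \<theta> t *\<^sub>R f t x)"
    by (intro pointwise_derivative_imp_C1_Ck[OF _ _ d] joint_Ck_add joint_Ck_scaleR f
        joint_Ck_time[OF cutoff_continuous[OF \<theta>(1)]] joint_Ck_time[OF cutoff_continuous'[OF \<theta>(1)]])
  moreover have "\<exists>R. \<forall>t\<ge>R. \<forall>x. \<theta> t *\<^sub>R f t x = 0"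
    by (intro exI[of _ "b + 1"]) (auto simp: cutoff_zero[OF \<theta>(1)])
  moreover have "\<exists>r>0. \<forall>t\<in>{0..r}. \<forall>x. \<theta> t *\<^sub>R f t x = 0"
    using \<theta>(2) by (intro exI[of _ "a / 2"]) (auto simp: cutoff_zero[OF \<theta>(1)])
  ultimately show "interior_test_fun (\<lambda>t x. \<theta> t *\<^sub>R f t x)"
    unfolding interior_test_fun_def test_fun_def by blast
  show "ddt (\<lambda>t x. \<theta> t *\<^sub>R f t x) t x = \<theta>' t *\<^sub>R f t x + \<theta> t *\<^sub>R f' t x"
    unfolding ddt_def by (rule vector_derivative_at[OF d])
qed


section \<open>Integration over the torus\<close>

abbreviation cell :: "(real^'n) set" where
  "cell \<equiv> {x. \<forall>j. 0 \<le> x $ j \<and> x $ j < 1}"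

lemma cell_measurable [measurable]: "(cell :: (real^'n) set) \<in> sets borel"
  by measurable

lemma cell_subset_cbox: "cell \<subseteq> cbox 0 (1 :: real^'n)"
  by (auto simp: mem_box_cart less_imp_le)

lemma emeasure_cell_finite: "emeasure lborel (cell :: (real^'n) set) < \<infinity>"
  using emeasure_mono[OF cell_subset_cbox, of lborel] emeasure_lborel_cbox_finite[of 0 "1 :: real^'n"]
  by (auto intro: le_less_trans)

lemma space_torus: "space torus = cell"
  by (simp add: torus_def space_restrict_space)

lemma borel_measurable_torus: "f \<in> borel_measurable borel \<Longrightarrow> f \<in> borel_measurable torus"
  unfolding torus_def by (intro measurable_restrict_space1) simp

lemma finite_measure_torus: "finite_measure (torus :: (real^'n) measure)"
  by (rule finite_measureI) (use emeasure_cell_finite[where ?'n = 'n] in \<open>auto simp: torus_def space_restrict_space emeasure_restrict_space\<close>)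

interpretation torus: finite_measure "torus :: (real^'n) measure"
  by (rule finite_measure_torus)

lemma torus_volume: "measure torus (space (torus :: (real^'n) measure)) = 1"
proof -
  have "(\<Prod>b\<in>Basis. (1 - 0 :: real^'n) \<bullet> b) = 1"
    by (intro prod.neutral) (auto simp: Basis_vec_def inner_axis)
  then have "emeasure lborel (cbox 0 1 :: (real^'n) set) = 1" "emeasure lborel (box 0 1 :: (real^'n) set) = 1"
    by (simp_all add: emeasure_lborel_cbox_eq emeasure_lborel_box_eq)
      (auto simp: Basis_vec_def inner_axis)
  moreover have "box 0 1 \<subseteq> (cell :: (real^'n) set)" by (auto simp: mem_box_cart less_imp_le)
  ultimately have "emeasure lborel (cell :: (real^'n) set) = 1"
    using emeasure_mono[OF cell_subset_cbox[where ?'n = 'n], of lborel] emeasure_mono[of "box 0 1" "cell :: (real^'n) set" lborel]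
    by (intro antisym) simp_all
  then show ?thesis
    unfolding space_torus by (simp add: measure_def torus_def emeasure_restrict_space)
qed

lemma integral_torus:
  fixes f :: "real^'n \<Rightarrow> 'b::{banach,second_countable_topology}"
  shows "f \<in> borel_measurable borel \<Longrightarrow> integral\<^sup>L torus f = (\<integral>x. indicator cell x *\<^sub>R f x \<partial>lborel)"
  unfolding torus_def using integral_restrict_space[of cell lborel f] by simp

lemma integrable_torus_bounded:
  fixes f :: "real^'n \<Rightarrow> 'b::{banach,second_countable_topology}"
  assumes "f \<in> borel_measurable torus" "\<And>x. norm (f x) \<le> B"
  shows "integrable torus f"
  using assms by (intro torus.integrable_const_bound[where B = B]) auto

lemma lborel_integral_shift:
  fixes f :: "'a::euclidean_space \<Rightarrow> 'b::{banach,second_countable_topology}"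
  assumes "f \<in> borel_measurable borel"
  shows "(\<integral>x. f (x + c) \<partial>lborel) = integral\<^sup>L lborel f"
proof -
  have "(\<integral>x. f (c + x) \<partial>lborel) = integral\<^sup>L (distr lborel borel ((+) c)) f"
    using assms by (intro integral_distr[symmetric]) auto
  then show ?thesis by (simp add: lborel_distr_plus add.commute)
qed

text \<open>Periodic functions are integrated over any unit-cell translate alike: the part of the shifted cell
  that sticks out on one side is moved back by a period.\<close>

lemma integral_torus_shift:
  fixes f :: "real^'n \<Rightarrow> real"
  assumes per: "periodic f" and cont: "continuous_on UNIV f" and s: "0 \<le> s" "s \<le> 1"
  shows "(\<integral>x. f (x + s *\<^sub>R axis j 1) \<partial>torus) = integral\<^sup>L torus f"
proof -
  have [measurable]: "f \<in> borel_measurable borel" using cont by (rule borel_measurable_continuous_onI)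
  obtain M where M: "\<And>x. norm (f x) \<le> M" using periodic_bounded[OF per cont] by blast
  define D where "D l r = {x :: real^'n. (\<forall>i. i \<noteq> j \<longrightarrow> 0 \<le> x $ i \<and> x $ i < 1) \<and> l \<le> x $ j \<and> x $ j < r}" for l r
  have [measurable]: "D l r \<in> sets borel" for l r unfolding D_def by measurable
  have fin: "emeasure lborel (D l r) < \<infinity>" if "0 \<le> l" "r \<le> 2" for l r
  proof -
    have "D l r \<subseteq> cbox 0 (\<chi> i. 2)"
      using that by (auto simp: D_def mem_box_cart) (metis dual_order.trans, smt (verit))
    then show ?thesis
      using emeasure_mono[of "D l r" "cbox 0 (\<chi> i. 2)" lborel] emeasure_lborel_cbox_finite[of 0 "\<chi> i. 2 :: real^'n"]
      by (auto intro: le_less_trans)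
  qed
  have int: "integrable lborel (\<lambda>x. indicator (D l r) x *\<^sub>R f x)" if "0 \<le> l" "r \<le> 2" for l r
    by (rule integrableI_bounded_set[where A = "D l r" and B = M])
      (use fin[OF that] M in \<open>auto simp: indicator_def\<close>)
  have ax: "axis j (1::real) $ i = (if i = j then 1 else 0)" for i by (simp add: axis_def)
  have cellD: "indicator cell x = (indicator (D 0 s) x + indicator (D s 1) x :: real)" for x :: "real^'n"
    using s by (auto simp: indicator_def D_def split: if_splits) (metis order.trans order.strict_trans2 not_le)+
  have shiftD: "indicator cell (x + (- s) *\<^sub>R axis j 1) = (indicator (D s 1) x + indicator (D 1 (1 + s)) x :: real)" for x :: "real^'n"
  proof -
    have "x + (- s) *\<^sub>R axis j 1 \<in> cell \<longleftrightarrow> x \<in> D s (1 + s)"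
      unfolding D_def by (auto simp: ax split: if_splits)
    then show ?thesis using s by (auto simp: indicator_def D_def)
  qed
  have perD: "indicator (D 1 (1 + s)) (x + axis j 1) = (indicator (D 0 s) x :: real)" for x :: "real^'n"
    by (auto simp: indicator_def D_def ax)
  have "(\<integral>x. f (x + s *\<^sub>R axis j 1) \<partial>torus) = (\<integral>x. indicator cell x *\<^sub>R f (x + s *\<^sub>R axis j 1) \<partial>lborel)"
    by (intro integral_torus) measurable
  also have "\<dots> = (\<integral>x. indicator cell (x + (- s) *\<^sub>R axis j 1) *\<^sub>R f x \<partial>lborel)"
    using lborel_integral_shift[of "\<lambda>x. indicator cell (x + (- s) *\<^sub>R axis j 1) *\<^sub>R f x" "s *\<^sub>R axis j 1"]
    by (simp add: add.assoc scaleR_left_distrib[symmetric])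
  also have "\<dots> = (\<integral>x. indicator (D s 1) x *\<^sub>R f x \<partial>lborel) + (\<integral>x. indicator (D 1 (1 + s)) x *\<^sub>R f x \<partial>lborel)"
    unfolding shiftD scaleR_left_distrib using s by (intro Bochner_Integration.integral_add int) auto
  also have "(\<integral>x. indicator (D 1 (1 + s)) x *\<^sub>R f x \<partial>lborel) = (\<integral>x. indicator (D 0 s) x *\<^sub>R f x \<partial>lborel)"
    using lborel_integral_shift[of "\<lambda>x. indicator (D 1 (1 + s)) x *\<^sub>R f x" "axis j 1"] per
    unfolding perD periodic_def by simp
  also have "(\<integral>x. indicator (D s 1) x *\<^sub>R f x \<partial>lborel) + (\<integral>x. indicator (D 0 s) x *\<^sub>R f x \<partial>lborel)
      = (\<integral>x. indicator cell x *\<^sub>R f x \<partial>lborel)"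
    unfolding cellD scaleR_left_distrib using s
    by (subst Bochner_Integration.integral_add) (auto intro!: int[unfolded scaleR_conv_of_real, simplified] int)
  finally show ?thesis by (simp add: integral_torus)
qed

text \<open>The integral of \<open>f (x + s e\<^sub>j)\<close> does not depend on \<open>s\<close>, and its difference quotients converge
  uniformly to the partial derivative.\<close>

lemma integral_torus_pd:
  fixes f :: "real^'n \<Rightarrow> real"
  assumes "Ck_torus 1 f"
  shows "(\<integral>x. pd j f x \<partial>torus) = 0"
proof -
  have f: "periodic f" "\<And>x. f differentiable (at x)" "Ck_torus 0 (pd j f)"
    using assms Ck_torus_pd[of 0 f j] by (auto simp: Ck_torus_def)
  have cf: "continuous_on UNIV f" using f(2)
    by (simp add: continuous_on_eq_continuous_at differentiable_imp_continuous_within)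
  have cp: "continuous_on UNIV (pd j f)" using f(3) by (simp add: Ck_torus_def)
  define g' where "g' t x = pd j f (x + t *\<^sub>R axis j 1)" for t x
  have g': "joint_Ck 0 g'"
  proof -
    have "periodic (g' t)" for t
      using f(3) unfolding periodic_def Ck_torus_def g'_def
      by (simp add: add.assoc add.commute[of "axis _ 1" "t *\<^sub>R axis j 1"]) (simp add: add.assoc[symmetric])
    moreover have "continuous_on UNIV (\<lambda>(t,x). g' t x)"
      unfolding g'_def case_prod_unfold by (intro continuous_on_compose2[OF cp] continuous_intros) auto
    ultimately show ?thesis by simp
  qed
  have deriv: "((\<lambda>t. f (x + t *\<^sub>R axis j 1)) has_vector_derivative g' t x) (at t)" for t x
    unfolding g'_def by (rule pd_vector_derivative_shift[OF f(2)])
  have int: "integrable torus (\<lambda>x. g (x + c))" if "periodic g" "continuous_on UNIV g" for g :: "real^'n \<Rightarrow> real" and c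
  proof -
    have "(\<lambda>x. g (x + c)) \<in> borel_measurable borel"
      by (intro borel_measurable_continuous_onI continuous_on_compose2[OF that(2)] continuous_intros) auto
    then show ?thesis using periodic_bounded[OF that]
      by (metis integrable_torus_bounded borel_measurable_torus)
  qed
  define m where "m = measure torus (space (torus :: (real^'n) measure))"
  have "\<bar>\<integral>x. pd j f x \<partial>torus\<bar> \<le> e" if e: "e > 0" for e
  proof -
    define e1 where "e1 = e / (m + 1)"
    have e1: "e1 > 0" "e1 * m \<le> e" using e measure_nonneg[of torus] by (auto simp: e1_def m_def field_simps add_pos_nonneg)
    obtain \<delta> where \<delta>: "\<delta> > 0" "\<forall>s\<in>{0..1}. \<forall>t\<in>{0..1}. \<bar>s - t\<bar> < \<delta> \<longrightarrow> (\<forall>x. norm (g' s x - g' t x) < e1)"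
      using joint_Ck_uniformly_continuous[OF g' e1(1)] by blast
    define s where "s = min 1 (\<delta> / 2)"
    have s: "0 < s" "s \<le> 1" "s < \<delta>" using \<delta>(1) by (auto simp: s_def)
    have "norm (f (x + s *\<^sub>R axis j 1) - f (x + 0 *\<^sub>R axis j 1) - (s - 0) *\<^sub>R g' 0 x) \<le> e1 * s" for x
    proof -
      have "norm (f (x + s *\<^sub>R axis j 1) - f (x + 0 *\<^sub>R axis j 1) - (s - 0) *\<^sub>R g' 0 x) \<le> norm (s - 0) * e1"
      proof (rule vector_differentiable_bound_linearization[of "{0..s}" "\<lambda>t. f (x + t *\<^sub>R axis j 1)" "\<lambda>t. g' t x"])
        show "norm (g' t x - g' 0 x) \<le> e1" if "t \<in> {0..s}" for t
          using \<delta>(2) s that by (intro less_imp_le) auto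
      qed (use s in \<open>auto intro: has_vector_derivative_at_within deriv simp: closed_segment_eq_real_ivl\<close>)
      then show ?thesis using s by (simp add: mult.commute)
    qed
    then have b: "norm (f (x + s *\<^sub>R axis j 1) - f x - s * pd j f x) \<le> e1 * s" for x
      by (simp add: g'_def)
    have "norm (\<integral>x. f (x + s *\<^sub>R axis j 1) - f x - s * pd j f x \<partial>torus) \<le> (\<integral>x. e1 * s \<partial>(torus :: (real^'n) measure))"
      using int[OF f(1) cf] int[OF f(1) cf, of 0] int[OF _ cp, of 0] f(3)
      by (intro Bochner_Integration.integral_norm_bound_integral b) (auto simp: Ck_torus_def)
    moreover have "(\<integral>x. f (x + s *\<^sub>R axis j 1) - f x - s * pd j f x \<partial>torus) = - s * (\<integral>x. pd j f x \<partial>torus)"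
      using int[OF f(1) cf] int[OF f(1) cf, of 0] int[OF _ cp, of 0] f(3) integral_torus_shift[OF f(1) cf, of s j] s
      by (simp add: Ck_torus_def)
    ultimately have "s * \<bar>\<integral>x. pd j f x \<partial>torus\<bar> \<le> s * (e1 * m)"
      using s by (simp add: abs_mult m_def mult_ac)
    then show ?thesis using s e1 by (meson mult_left_le_imp_le order_trans)
  qed
  then show ?thesis by (metis abs_le_zero_iff field_le_epsilon add_0)
qed


section \<open>The fundamental lemma on the torus\<close>

definition sq_ramp :: "real \<Rightarrow> real" where
  "sq_ramp s = (max 0 s)\<^sup>2"

lemma DERIV_sq_ramp: "(sq_ramp has_real_derivative 2 * max 0 t) (at t)"
proof -
  consider "t < 0" | "t > 0" | "t = 0" by linarith
  then show ?thesis
  proof cases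
    case 1
    then show ?thesis
      using has_field_derivative_transform_within_open[OF DERIV_const[of 0], of "{..<0}" t sq_ramp]
      by (auto simp: sq_ramp_def)
  next
    case 2
    have "((\<lambda>s. s\<^sup>2) has_real_derivative 2 * t) (at t)" by (auto intro!: derivative_eq_intros)
    then show ?thesis
      using has_field_derivative_transform_within_open[of "\<lambda>s. s\<^sup>2" "2 * t" t "{0<..}" sq_ramp] 2
      by (auto simp: sq_ramp_def)
  next
    case 3
    have "((\<lambda>h. sq_ramp h / h) \<longlongrightarrow> 0) (at 0)"
      by (rule Lim_null_comparison[where g = "\<lambda>h. \<bar>h\<bar>"])
        (auto simp: sq_ramp_def power2_eq_square max_def intro!: always_eventually tendsto_rabs_zero)
    then show ?thesis using 3 by (simp add: DERIV_def sq_ramp_def)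
  qed
qed

text \<open>The integral of a tent: the quadratic spline that rises from 0 to 1 on the unit interval.\<close>

definition step :: "real \<Rightarrow> real" where
  "step s = 2 * sq_ramp s - 4 * sq_ramp (s - 1/2) + 2 * sq_ramp (s - 1)"

definition step' :: "real \<Rightarrow> real" where
  "step' s = 4 * max 0 s - 8 * max 0 (s - 1/2) + 4 * max 0 (s - 1)"

lemma DERIV_step: "(step has_real_derivative step' s) (at s)"
proof -
  have shift: "((\<lambda>s. sq_ramp (s - c)) has_real_derivative 2 * max 0 (s - c)) (at s)" for c
  proof -
    have "((\<lambda>s. s - c) has_real_derivative 1) (at s)" by (auto intro!: derivative_eq_intros)
    from DERIV_chain2[OF DERIV_sq_ramp this] show ?thesis by simp
  qed
  have "((\<lambda>s. 2 * sq_ramp s - 4 * sq_ramp (s - 1/2) + 2 * sq_ramp (s - 1)) has_real_derivative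
      2 * (2 * max 0 s) - 4 * (2 * max 0 (s - 1/2)) + 2 * (2 * max 0 (s - 1))) (at s)"
    by (intro DERIV_add DERIV_diff DERIV_cmult shift DERIV_sq_ramp)
  moreover have "step = (\<lambda>s. 2 * sq_ramp s - 4 * sq_ramp (s - 1/2) + 2 * sq_ramp (s - 1))"
    by (simp add: fun_eq_iff step_def)
  ultimately show ?thesis by (simp add: step'_def)
qed

lemma continuous_step': "continuous_on S step'"
  unfolding step'_def by (intro continuous_intros)

lemma step_0: "s \<le> 0 \<Longrightarrow> step s = 0"
  by (simp add: step_def sq_ramp_def)

lemma step_1: "s \<ge> 1 \<Longrightarrow> step s = 1"
  by (simp add: step_def sq_ramp_def power2_eq_square algebra_simps)

lemma step'_nonneg: "0 \<le> step' s"
  by (simp add: step'_def max_def)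

lemma step'_0: "s \<notin> {0..1} \<Longrightarrow> step' s = 0"
  by (auto simp: step'_def max_def)

lemma step_mono: "s \<le> t \<Longrightarrow> step s \<le> step t"
  using DERIV_nonneg_imp_nondecreasing[of s t step] DERIV_step step'_nonneg by blast

lemma step_bounds: "0 \<le> step s" "step s \<le> 1"
  using step_mono[of "min s 0" s] step_mono[of s "max s 1"] step_0[of "min s 0"] step_1[of "max s 1"] by auto

lemma Ck_torus_1_compose:
  fixes g :: "real^'n \<Rightarrow> real"
  assumes g: "Ck_torus 1 g" and \<phi>: "\<And>s. (\<phi> has_real_derivative \<phi>' s) (at s)" "continuous_on UNIV \<phi>'"
  shows "Ck_torus 1 (\<lambda>x. \<phi> (g x))"
proof -
  have dg: "g differentiable (at x)" for x using g by (simp add: Ck_torus_def)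
  then have cg: "continuous_on UNIV g"
    by (simp add: continuous_on_eq_continuous_at differentiable_imp_continuous_within)
  have "pd j (\<lambda>x. \<phi> (g x)) = (\<lambda>x. \<phi>' (g x) * pd j g x)" for j
    using pd_real_compose(2)[OF dg \<phi>(1)] by auto
  moreover have "continuous_on UNIV (\<lambda>x. \<phi>' (g x) * pd j g x)" for j
    using g cg by (intro continuous_intros continuous_on_compose2[OF \<phi>(2)]) (auto simp: Ck_torus_def)
  ultimately show ?thesis
    using g pd_real_compose(1)[OF dg \<phi>(1)] by (auto simp: Ck_torus_def periodic_def)
qed

lemma Ck_torus_mult:
  fixes f g :: "real^'n \<Rightarrow> real"
  shows "Ck_torus k f \<Longrightarrow> Ck_torus k g \<Longrightarrow> Ck_torus k (\<lambda>x. f x * g x)"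
  unfolding Ck_torus_iff_joint_Ck by (rule joint_Ck_mult)

lemma Ck_torus_const_fun: "Ck_torus k (\<lambda>x. c)"
  unfolding Ck_torus_iff_joint_Ck by (rule joint_Ck_time) simp

lemma Ck_torus_continuous: "Ck_torus k f \<Longrightarrow> continuous_on UNIV f"
  using Ck_torus_imp_0 by (auto simp: Ck_torus_def)

lemma Ck_torus_cos: "Ck_torus 1 (\<lambda>x :: real^'n. cos (2 * pi * (x $ j - c)) - b)"
proof -
  have d: "((\<lambda>x :: real^'n. cos (2 * pi * (x $ j - c)) - b) has_derivative
      (\<lambda>h. - sin (2 * pi * (x $ j - c)) * (2 * pi * h $ j))) (at x)" for x
    by (auto intro!: derivative_eq_intros bounded_linear.has_derivative[OF bounded_linear_vec_nth])
  then have "pd i (\<lambda>x :: real^'n. cos (2 * pi * (x $ j - c)) - b)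
      = (\<lambda>x. - sin (2 * pi * (x $ j - c)) * (2 * pi * axis i 1 $ j))" for i
    using pd_eq[OF d] by auto
  moreover have "cos (2 * pi * ((x + axis i 1) $ j - c)) = cos (2 * pi * (x $ j - c))" for x :: "real^'n" and i
  proof (cases "i = j")
    case True
    have "2 * pi * ((x + axis i 1) $ j - c) = 2 * pi * (x $ j - c) + 2 * pi"
      using True by (simp add: algebra_simps)
    then show ?thesis by (simp only: cos_periodic)
  next
    case False
    then show ?thesis by (simp add: axis_def)
  qed
  moreover have "(\<lambda>x :: real^'n. cos (2 * pi * (x $ j - c)) - b) differentiable (at x)" for x
    using d differentiable_def by blast
  ultimately show ?thesis
    by (auto simp: Ck_torus_def periodic_def intro!: continuous_intros)
qed

lemma cos_gt_iff_interval:
  assumes "0 \<le> y" "y < 1" "0 < a" "a \<le> 1"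
  shows "cos (2 * pi * (y - a / 2)) > cos (pi * a) \<longleftrightarrow> 0 < y \<and> y < a"
proof -
  have "cos (2 * pi * (y - a / 2)) > cos (pi * a)" if "0 < y" "y < a"
  proof -
    have "cos (2 * pi * \<bar>y - a / 2\<bar>) > cos (pi * a)"
    proof (rule cos_monotone_0_pi)
      have "2 * \<bar>y - a / 2\<bar> < a" using that by (auto simp: abs_if)
      then show "2 * pi * \<bar>y - a / 2\<bar> < pi * a" by (simp add: mult.assoc mult.left_commute[of 2])
    qed (use assms in auto)
    moreover have "cos (2 * pi * \<bar>y - a / 2\<bar>) = cos (2 * pi * (y - a / 2))"
      using cos_abs_real[of "2 * pi * (y - a / 2)"] by (simp add: abs_mult)
    ultimately show ?thesis by simp
  qed
  moreover have "cos (2 * pi * (y - a / 2)) \<le> cos (pi * a)" if "a \<le> y"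
  proof (cases "2 * y - a \<le> 1")
    case True
    have "pi * a \<le> pi * (2 * y - a)" "pi * (2 * y - a) \<le> pi * 1" using that True by (auto intro!: mult_left_mono)
    then have "cos (pi * (2 * y - a)) \<le> cos (pi * a)"
      using assms by (intro cos_monotone_0_pi_le) auto
    moreover have "pi * (2 * y - a) = 2 * pi * (y - a / 2)" by (simp add: algebra_simps)
    ultimately show ?thesis by simp
  next
    case False
    have "pi * a \<le> pi * (2 - (2 * y - a))" "pi * (2 - (2 * y - a)) \<le> pi * 1" using that False assms by (auto intro!: mult_left_mono)
    then have "cos (pi * (2 - (2 * y - a))) \<le> cos (pi * a)"
      using assms by (intro cos_monotone_0_pi_le) auto
    moreover have "pi * (2 - (2 * y - a)) = 2 * pi - 2 * pi * (y - a / 2)" by (simp add: algebra_simps)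
    ultimately show ?thesis by (simp add: cos_diff)
  qed
  moreover have "cos (2 * pi * (0 - a / 2)) = cos (pi * a)" by simp
  ultimately show ?thesis using assms by (metis less_eq_real_def less_irrefl not_le)
qed

text \<open>Superlevel sets of shifted cosines are the slabs \<open>{0 < x\<^sub>j < a}\<close>. The slab with \<open>a = 1\<close> misses only the
  face \<open>{x\<^sub>j = 0}\<close>, so complements supply the faces and hence all half-spaces within the cell.\<close>

lemma sets_torus_generated:
  "sets (torus :: (real^'n) measure) = sigma_sets cell {{x \<in> cell. g x > 0} |g :: real^'n \<Rightarrow> real. Ck_torus 1 g}" (is "_ = sigma_sets cell ?G")
proof
  have "{x \<in> cell. g x > 0} \<in> sets torus" if "Ck_torus 1 g" for g :: "real^'n \<Rightarrow> real"
  proof -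
    have [measurable]: "g \<in> borel_measurable torus"
      using borel_measurable_continuous_onI[OF Ck_torus_continuous[OF that]] by (rule borel_measurable_torus)
    have "{x \<in> space torus. g x > 0} \<in> sets torus" by measurable
    then show ?thesis by (simp add: space_torus)
  qed
  then have "?G \<subseteq> sets torus" by blast
  from sets.sigma_sets_subset[OF this] show "sigma_sets cell ?G \<subseteq> sets torus"
    by (simp only: space_torus)
next
  define N where "N = sigma (cell :: (real^'n) set) ?G"
  have G: "?G \<subseteq> Pow cell" by auto
  have space_N: "space N = cell" and sets_N: "sets N = sigma_sets cell ?G"
    using G by (simp_all add: N_def)
  have comp: "{x \<in> space N. x $ j < a} \<in> sets N" for j and a :: real
  proof -
    have basic: "{x \<in> cell. 0 < x $ j \<and> x $ j < a} \<in> sets N" if "0 < a" "a \<le> 1" for a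
    proof -
      have "{x \<in> cell. 0 < x $ j \<and> x $ j < a} = {x :: real^'n \<in> cell. cos (2 * pi * (x $ j - a / 2)) - cos (pi * a) > 0}"
        using cos_gt_iff_interval[OF _ _ that] by auto
      then show ?thesis
        unfolding sets_N using Ck_torus_cos[of j "a / 2" "cos (pi * a)"]
        by (intro sigma_sets.Basic CollectI exI conjI)
    qed
    consider "a \<le> 0" | "0 < a" "a \<le> 1" | "1 < a" by linarith
    then show ?thesis
    proof cases
      case 1
      have "\<not> x $ j < a" if "x \<in> space N" for x
        using that 1 unfolding space_N by (simp add: not_less) (meson order_trans)
      then have "{x \<in> space N. x $ j < a} = {}" by blast
      then show ?thesis by (simp only: sets.empty_sets)
    next
      case 2
      have "{x \<in> space N. x $ j < a} = (space N - {x \<in> cell. 0 < x $ j \<and> x $ j < 1}) \<union> {x \<in> cell. 0 < x $ j \<and> x $ j < a}"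
      proof -
        have "x $ j < a \<longleftrightarrow> \<not> 0 < x $ j \<or> 0 < x $ j \<and> x $ j < a" "x $ j < 1" if "x \<in> space N" for x
          using that 2 unfolding space_N by auto
        then show ?thesis unfolding space_N by blast
      qed
      also have "\<dots> \<in> sets N" using basic[of 1] basic[OF 2] by auto
      finally show ?thesis .
    next
      case 3
      have "x $ j < a" if "x \<in> space N" for x
        using that 3 unfolding space_N by simp (meson less_trans)
      then have "{x \<in> space N. x $ j < a} = space N" by blast
      then show ?thesis by (simp only: sets.top)
    qed
  qed
  have "(\<lambda>x. x \<bullet> b) \<in> borel_measurable N" if b: "b \<in> Basis" for b :: "real^'n"
  proof -
    obtain j where "b = axis j 1" using b by (auto simp: Basis_vec_def)
    then show ?thesis using comp by (simp add: borel_measurable_iff_less inner_axis)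
  qed
  then have id: "(\<lambda>x. x) \<in> borel_measurable N" by (subst borel_measurable_euclidean_space) blast
  show "sets torus \<subseteq> sigma_sets cell ?G"
  proof
    fix A :: "(real^'n) set" assume "A \<in> sets torus"
    then obtain B where "B \<in> sets borel" "A = cell \<inter> B" by (auto simp: torus_def sets_restrict_space)
    then show "A \<in> sigma_sets cell ?G"
      using measurable_sets[OF id, of B] by (simp add: space_N sets_N Int_commute)
  qed
qed

text \<open>The fundamental lemma of the calculus of variations on the torus. Smoothed indicators of the
  sets \<open>{g > 0}\<close> are test functions, and these sets form a generator that is closed under
  intersection.\<close>

lemma torus_AE_zero:
  fixes w :: "real^'n \<Rightarrow> real"
  assumes w: "integrable torus w" and zero: "\<And>\<phi>. Ck_torus 1 \<phi> \<Longrightarrow> (\<integral>x. w x * \<phi> x \<partial>torus) = 0"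
  shows "AE x in torus. w x = 0"
proof (rule torus.density_zero[OF w])
  let ?G = "{{x \<in> cell. g x > 0} |g :: real^'n \<Rightarrow> real. Ck_torus 1 g}"
  have [measurable]: "w \<in> borel_measurable torus" using w by auto
  have positive_set: "(LINT x:{x \<in> cell. g x > 0}|torus. w x) = 0" if g: "Ck_torus 1 g" for g :: "real^'n \<Rightarrow> real"
  proof -
    have [measurable]: "g \<in> borel_measurable torus"
      using borel_measurable_continuous_onI[OF Ck_torus_continuous[OF g]] by (rule borel_measurable_torus)
    have [measurable]: "step \<in> borel_measurable borel"
      using DERIV_step by (intro borel_measurable_continuous_onI) (meson DERIV_isCont continuous_at_imp_continuous_on)
    have \<phi>: "Ck_torus 1 (\<lambda>x. step (real n * g x))" for n
    proof -
      have "((\<lambda>s. step (real n * s)) has_real_derivative step' (real n * s) * real n) (at s)" for s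
      proof -
        have "((\<lambda>s. real n * s) has_real_derivative real n) (at s)" by (auto intro!: derivative_eq_intros)
        from DERIV_chain2[OF DERIV_step this] show ?thesis .
      qed
      then show ?thesis by (intro Ck_torus_1_compose[OF g, of "\<lambda>s. step (real n * s)" "\<lambda>s. step' (real n * s) * real n"])
        (auto intro!: continuous_intros continuous_on_compose2[OF continuous_step'[of UNIV]])
    qed
    have "(\<lambda>n. \<integral>x. w x * step (real n * g x) \<partial>torus) \<longlonglongrightarrow> (\<integral>x. w x * indicator {x. g x > 0} x \<partial>torus)"
    proof (rule integral_dominated_convergence[where w = "\<lambda>x. \<bar>w x\<bar>"])
      show "AE x in torus. (\<lambda>n. w x * step (real n * g x)) \<longlonglongrightarrow> w x * indicator {x. g x > 0} x"
      proof (intro AE_I2 tendsto_intros)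
        fix x
        show "(\<lambda>n. step (real n * g x)) \<longlonglongrightarrow> indicator {x. g x > 0} x"
        proof (cases "g x > 0")
          case True
          obtain N where N: "1 / g x < real N" using reals_Archimedean2 by blast
          have "step (real n * g x) = 1" if "n \<ge> N" for n
          proof (rule step_1)
            have "1 / g x \<le> real n" using N that by linarith
            then show "1 \<le> real n * g x" using True by (simp add: pos_divide_le_eq)
          qed
          then have "eventually (\<lambda>n. step (real n * g x) = 1) sequentially"
            by (auto simp: eventually_sequentially)
          then show ?thesis using True by (simp add: tendsto_eventually)
        next
          case False
          then have "step (real n * g x) = 0" for n
            by (intro step_0) (simp add: mult_nonneg_nonpos)
          then show ?thesis using False by simp
        qed
      qed
      show "AE x in torus. norm (w x * step (real n * g x)) \<le> \<bar>w x\<bar>" for n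
        using step_bounds by (auto simp: abs_mult intro!: mult_left_le)
    qed (use w in \<open>auto intro!: borel_measurable_indicator\<close>)
    then have "(\<integral>x. w x * indicator {x. g x > 0} x \<partial>torus) = 0"
      using zero[OF \<phi>] by (simp add: LIMSEQ_const_iff)
    then show ?thesis
      unfolding set_lebesgue_integral_def
      by (subst Bochner_Integration.integral_cong[OF refl, of torus _ "\<lambda>x. w x * indicator {x. g x > 0} x"])
        (auto simp: space_torus indicator_def)
  qed
  have stable: "Int_stable ?G"
  proof (rule Int_stableI, clarify)
    fix g h :: "real^'n \<Rightarrow> real" assume gh: "Ck_torus 1 g" "Ck_torus 1 h"
    have "Ck_torus 1 (\<lambda>x. sq_ramp (g x))" "Ck_torus 1 (\<lambda>x. sq_ramp (h x))"
      by (intro Ck_torus_1_compose[OF _ DERIV_sq_ramp] gh continuous_intros)+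
    then have "Ck_torus 1 (\<lambda>x. sq_ramp (g x) * sq_ramp (h x))" by (rule Ck_torus_mult)
    moreover have "{x \<in> cell. g x > 0} \<inter> {x \<in> cell. h x > 0} = {x \<in> cell. sq_ramp (g x) * sq_ramp (h x) > 0}"
      by (auto simp: sq_ramp_def zero_less_mult_iff max_def split: if_splits)
    ultimately show "\<exists>f :: real^'n \<Rightarrow> real. {x \<in> cell. g x > 0} \<inter> {x \<in> cell. h x > 0} = {x \<in> cell. f x > 0} \<and> Ck_torus 1 f"
      by (intro exI conjI)
  qed
  have G: "?G \<subseteq> Pow cell" by auto
  have total: "integral\<^sup>L torus w = 0" using zero[OF Ck_torus_const_fun[of 1 1]] by simp
  have sint: "set_integrable torus A w" if "A \<in> sets torus" for A
    unfolding set_integrable_def using integrable_mult_indicator[OF that w] .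
  fix A :: "(real^'n) set" assume "A \<in> sets torus"
  then have "A \<in> sigma_sets cell ?G" by (simp only: sets_torus_generated)
  then show "(LINT x:A|torus. w x) = 0"
  proof (induction rule: sigma_sets_induct_disjoint[OF stable G, consumes 1, case_names basic empty compl union])
    case (basic A)
    then obtain g :: "real^'n \<Rightarrow> real" where "A = {x \<in> cell. g x > 0}" "Ck_torus 1 g" by blast
    then show ?case using positive_set by simp
  next
    case (compl A)
    have A: "A \<in> sets torus" using compl by (simp only: sets_torus_generated)
    have "(LINT x:A|torus. w x) + (LINT x:cell - A|torus. w x) = (LINT x:cell|torus. w x)"
      using A sets.top[of torus] sets.sets_into_space[OF A]
      by (subst set_integral_Un[symmetric]) (auto intro!: sint simp: space_torus Un_absorb1)
    moreover have "(LINT x:cell|torus. w x) = integral\<^sup>L torus w"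
      unfolding set_lebesgue_integral_def by (intro Bochner_Integration.integral_cong) (auto simp: space_torus)
    ultimately show ?case using compl total by simp
  next
    case (union A)
    have A: "A i \<in> sets torus" for i using union by (auto simp: sets_torus_generated)
    have "(LINT x:(\<Union>i. A i)|torus. w x) = (\<Sum>i. (LINT x:A i|torus. w x))"
      using union(1) A by (intro lebesgue_integral_countable_add sint) (auto simp: disjoint_family_on_def)
    then show ?case using union by simp
  next
    case empty
    then show ?case by (simp add: set_lebesgue_integral_def)
  qed
qed

lemma torus_weak_gradient_unique:
  fixes f :: "real^'n \<Rightarrow> real"
  assumes f: "Ck_torus 1 f" and g: "slice_weak_gradient f' g" and eq: "AE x in torus. f' x = f x"
  shows "AE x in torus. \<forall>j. g x $ j = pd j f x"
proof -
  have "AE x in torus. g x $ j - pd j f x = 0" for j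
  proof (rule torus_AE_zero)
    have bdd: "integrable torus h" if "Ck_torus 0 h" for h :: "real^'n \<Rightarrow> real"
    proof -
      have h: "periodic h" "continuous_on UNIV h" using that by (auto simp: Ck_torus_def)
      obtain B where "\<And>x. norm (h x) \<le> B" using periodic_bounded[OF h] by blast
      then show ?thesis
        by (rule integrable_torus_bounded[OF borel_measurable_torus[OF borel_measurable_continuous_onI[OF h(2)]]])
    qed
    have gj: "integrable torus (\<lambda>x. g x $ j)"
      using g unfolding slice_weak_gradient_def by (intro integrable_bounded_linear[OF bounded_linear_vec_nth]) auto
    show "integrable torus (\<lambda>x. g x $ j - pd j f x)"
      using gj bdd Ck_torus_pd[of 0 f j] f by (intro Bochner_Integration.integrable_diff) auto
    fix \<phi> :: "real^'n \<Rightarrow> real" assume \<phi>: "Ck_torus 1 \<phi>"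
    have d: "f differentiable (at x)" "\<phi> differentiable (at x)" for x using f \<phi> by (auto simp: Ck_torus_def)
    have T: "Ck_torus 0 f" "Ck_torus 0 \<phi>" "Ck_torus 0 (pd j f)" "Ck_torus 0 (pd j \<phi>)"
      using f \<phi> Ck_torus_pd[of 0] Ck_torus_imp_0 by auto
    have "(\<integral>x. pd j (\<lambda>x. f x * \<phi> x) x \<partial>torus) = 0"
      by (rule integral_torus_pd[OF Ck_torus_mult[OF f \<phi>]])
    then have "(\<integral>x. f x * pd j \<phi> x + pd j f x * \<phi> x \<partial>torus) = 0"
      by (simp add: bounded_bilinear.pd_product[OF bounded_bilinear_mult d])
    then have parts: "(\<integral>x. f x * pd j \<phi> x \<partial>torus) + (\<integral>x. pd j f x * \<phi> x \<partial>torus) = 0"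
      by (subst (asm) Bochner_Integration.integral_add) (intro bdd Ck_torus_mult T)+
    have "(\<integral>x. f' x * pd j \<phi> x \<partial>torus) = - (\<integral>x. g x $ j * \<phi> x \<partial>torus)"
      using g \<phi> by (simp add: slice_weak_gradient_def)
    moreover have "(\<integral>x. f' x * pd j \<phi> x \<partial>torus) = (\<integral>x. f x * pd j \<phi> x \<partial>torus)"
      using g bdd[OF T(1)] bdd[OF T(4)] eq unfolding slice_weak_gradient_def
      by (intro integral_cong_AE borel_measurable_times) auto
    moreover have "integrable torus (\<lambda>x. g x $ j * \<phi> x)"
    proof -
      obtain B where B: "\<And>x. norm (\<phi> x) \<le> B"
        using periodic_bounded[of \<phi>] T(2) by (auto simp: Ck_torus_def)
      have "\<phi> \<in> borel_measurable torus" using bdd[OF T(2)] by auto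
      moreover have "integrable torus (\<lambda>x. B * (g x $ j))"
        by (intro integrable_mult_right gj)
      moreover have "norm (g x $ j * \<phi> x) \<le> norm (B * (g x $ j))" for x
        using mult_right_mono[OF order_trans[OF B abs_ge_self], of "\<bar>g x $ j\<bar>" x] by (simp add: abs_mult mult.commute)
      moreover have "(\<lambda>x. g x $ j) \<in> borel_measurable torus"
        by (rule borel_measurable_integrable[OF gj])
      moreover have "(\<lambda>x. g x $ j * \<phi> x) \<in> borel_measurable torus"
        using calculation by (intro borel_measurable_times)
      ultimately show ?thesis
        using Bochner_Integration.integrable_bound[of torus "\<lambda>x. B * (g x $ j)" "\<lambda>x. g x $ j * \<phi> x"] by blast
    qed
    ultimately show "(\<integral>x. (g x $ j - pd j f x) * \<phi> x \<partial>torus) = 0"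
      using parts bdd[OF Ck_torus_mult[OF T(3,2)]] by (simp add: left_diff_distrib)
  qed
  then show ?thesis using AE_finite_allI[where S = UNIV and M = torus and Q = "\<lambda>j x. g x $ j = pd j f x"] by simp
qed


section \<open>Space-time integrals\<close>

lemma sigma_finite_halfline: "sigma_finite_measure halfline"
  unfolding halfline_def by (intro sigma_finite_measure_restrict_space) (auto intro: lborel.sigma_finite_measure_axioms)

interpretation halfline: sigma_finite_measure halfline
  by (rule sigma_finite_halfline)

interpretation spacetime: pair_sigma_finite halfline "torus :: (real^'n) measure" ..

lemma borel_measurable_halfline: "f \<in> borel_measurable borel \<Longrightarrow> f \<in> borel_measurable halfline"
  unfolding halfline_def by (intro measurable_restrict_space1) simp

lemma space_halfline: "space halfline = {0<..}"
  by (simp add: halfline_def space_restrict_space)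

lemma measurable_spacetime_fst: "fst \<in> borel_measurable (spacetime :: (real \<times> (real^'n)) measure)"
  unfolding spacetime_def
  by (intro measurable_compose[OF measurable_fst]) (auto intro: borel_measurable_halfline)

lemma measurable_spacetime_snd: "snd \<in> borel_measurable (spacetime :: (real \<times> (real^'n)) measure)"
  unfolding spacetime_def
  by (intro measurable_compose[OF measurable_snd]) (auto intro: borel_measurable_torus)

lemma borel_measurable_spacetime:
  fixes g :: "real \<Rightarrow> real^'n \<Rightarrow> 'b::topological_space"
  assumes "(\<lambda>(t,x). g t x) \<in> borel_measurable borel"
  shows "(\<lambda>(t,x). g t x) \<in> borel_measurable spacetime"
proof -
  have "(\<lambda>p. (fst p, snd p)) \<in> borel_measurable (spacetime :: (real \<times> (real^'n)) measure)"
    using measurable_spacetime_fst measurable_spacetime_snd by (subst borel_prod[symmetric]) (rule measurable_Pair)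
  from measurable_compose[OF this assms] show ?thesis by simp
qed

lemma joint_Ck_measurable_spacetime:
  "joint_Ck k g \<Longrightarrow> (\<lambda>(t,x). g t x) \<in> borel_measurable spacetime"
  by (intro borel_measurable_spacetime borel_measurable_continuous_onI joint_Ck_continuous)

lemma joint_Ck_integrable_torus:
  fixes g :: "real \<Rightarrow> real^'n \<Rightarrow> 'b::{real_normed_vector,banach,second_countable_topology}"
  assumes "joint_Ck k g"
  shows "integrable torus (g t)"
proof -
  have "Ck_torus 0 (g t)" using joint_Ck_imp_Ck_torus[OF joint_Ck_imp_0[OF assms]] .
  then have c: "periodic (g t)" "continuous_on UNIV (g t)" by (auto simp: Ck_torus_def)
  show ?thesis
    using periodic_bounded[OF c] borel_measurable_torus[OF borel_measurable_continuous_onI[OF c(2)]]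
    by (auto intro: integrable_torus_bounded)
qed

lemma integrable_bounded_inner:
  fixes f g :: "'a \<Rightarrow> 'b::euclidean_space"
  assumes "integrable M f" "g \<in> borel_measurable M" "\<And>x. x \<in> space M \<Longrightarrow> norm (g x) \<le> B"
  shows "integrable M (\<lambda>x. f x \<bullet> g x)" "x \<in> space M \<Longrightarrow> norm (f x \<bullet> g x) \<le> B * norm (f x)"
proof -
  show *: "norm (f x \<bullet> g x) \<le> B * norm (f x)" if "x \<in> space M" for x
    using order_trans[OF Cauchy_Schwarz_ineq2[of "f x" "g x"] mult_left_mono[OF assms(3)[OF that] norm_ge_zero[of "f x"]]]
    by (simp add: mult.commute)
  show "integrable M (\<lambda>x. f x \<bullet> g x)"
  proof (rule Bochner_Integration.integrable_bound[of M "\<lambda>x. B * norm (f x)"])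
    show "AE x in M. norm (f x \<bullet> g x) \<le> norm (B * norm (f x))"
      using order_trans[OF * abs_ge_self] by (intro AE_I2) simp
  qed (use assms in auto)
qed

lemma CL1_integrable: "CL1 f \<Longrightarrow> 0 \<le> t \<Longrightarrow> integrable torus (f t)"
  by (simp add: CL1_def)

lemma CL1_inner_integrable:
  fixes f g :: "real \<Rightarrow> real^'n \<Rightarrow> 'b::euclidean_space"
  assumes "CL1 f" "joint_Ck k g" "0 \<le> t"
  shows "integrable torus (\<lambda>x. f t x \<bullet> g t x)"
proof -
  obtain B where "\<forall>s\<in>{t..t}. \<forall>x. norm (g s x) \<le> B" using joint_Ck_bounded[OF assms(2), of t t] by auto
  then show ?thesis
    using integrable_bounded_inner(1)[OF CL1_integrable[OF assms(1,3)], of "g t" B]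
      joint_Ck_integrable_torus[OF assms(2), of t] by auto
qed

text \<open>One factor converges in \<open>L\<^sup>1\<close> and the other one uniformly.\<close>

lemma CL1_inner_continuous:
  fixes f g :: "real \<Rightarrow> real^'n \<Rightarrow> 'b::euclidean_space"
  assumes f: "CL1 f" and g: "joint_Ck k g"
  shows "continuous_on {0..} (\<lambda>t. \<integral>x. f t x \<bullet> g t x \<partial>torus)"
  unfolding continuous_on_def
proof
  fix t :: real assume t: "t \<in> {0..}"
  obtain B where B: "B > 0" "\<forall>s\<in>{t-1..t+1}. \<forall>x. norm (g s x) \<le> B" using joint_Ck_bounded[OF g] by blast
  define F where "F s = (\<integral>x. norm (f s x - f t x) \<partial>torus)" for s
  define N where "N s = Ck_norm 0 (\<lambda>x. g s x - g t x)" for s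
  define A where "A = (\<integral>x. norm (f t x) \<partial>torus)"
  have lim: "((\<lambda>s. B * F s + N s * A) \<longlongrightarrow> B * 0 + 0 * A) (at t within {0..})"
    unfolding F_def N_def using f t tendsto_within_subset[OF joint_Ck_tendsto_Ck_norm_0[OF g] subset_UNIV]
    by (intro tendsto_intros) (auto simp: CL1_def)
  have near: "eventually (\<lambda>s. s \<in> {0..} \<and> \<bar>s - t\<bar> < 1) (at t within {0..})"
    by (auto simp: eventually_at dist_real_def intro!: exI[of _ 1])
  then have "eventually (\<lambda>s. norm ((\<integral>x. f s x \<bullet> g s x \<partial>torus) - (\<integral>x. f t x \<bullet> g t x \<partial>torus)) \<le> B * F s + N s * A)
      (at t within {0..})"
  proof eventually_elim
    case (elim s)
    have fi: "integrable torus (f s)" "integrable torus (f t)" using f t elim by (auto simp: CL1_def)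
    have "s \<in> {t-1..t+1}" using elim by (auto simp: abs_less_iff)
    then have gs: "norm (g s x) \<le> B" for x using B by blast
    have gN: "norm (g s x - g t x) \<le> N s" for x
    proof -
      have "Ck_torus 0 (\<lambda>x. g s x - g t x)"
        by (intro Ck_torus_diff joint_Ck_imp_Ck_torus joint_Ck_imp_0[OF g])
      then show ?thesis
        using norm_le_Ck_norm_0[of "\<lambda>x. g s x - g t x" x] unfolding N_def Ck_torus_def by auto
    qed
    have gm: "g s \<in> borel_measurable torus" "(\<lambda>x. g s x - g t x) \<in> borel_measurable torus"
      using joint_Ck_integrable_torus[OF g] by auto
    have i1: "integrable torus (\<lambda>x. (f s x - f t x) \<bullet> g s x)"
      and b1: "\<And>x. x \<in> space torus \<Longrightarrow> norm ((f s x - f t x) \<bullet> g s x) \<le> B * norm (f s x - f t x)"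
      using integrable_bounded_inner[OF Bochner_Integration.integrable_diff[OF fi] gm(1) gs] by auto
    have i2: "integrable torus (\<lambda>x. f t x \<bullet> (g s x - g t x))"
      and b2: "\<And>x. x \<in> space torus \<Longrightarrow> norm (f t x \<bullet> (g s x - g t x)) \<le> N s * norm (f t x)"
      using integrable_bounded_inner[OF fi(2) gm(2) gN] by auto
    have "(\<integral>x. f s x \<bullet> g s x \<partial>torus) - (\<integral>x. f t x \<bullet> g t x \<partial>torus)
        = (\<integral>x. f s x \<bullet> g s x - f t x \<bullet> g t x \<partial>torus)"
      using CL1_inner_integrable[OF f g] elim t by (intro Bochner_Integration.integral_diff[symmetric]) auto
    also have "\<dots> = (\<integral>x. (f s x - f t x) \<bullet> g s x + f t x \<bullet> (g s x - g t x) \<partial>torus)"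
      by (simp add: inner_diff_left inner_diff_right)
    also have "\<dots> = (\<integral>x. (f s x - f t x) \<bullet> g s x \<partial>torus) + (\<integral>x. f t x \<bullet> (g s x - g t x) \<partial>torus)"
      by (rule Bochner_Integration.integral_add[OF i1 i2])
    also have "norm \<dots> \<le> norm (\<integral>x. (f s x - f t x) \<bullet> g s x \<partial>torus) + norm (\<integral>x. f t x \<bullet> (g s x - g t x) \<partial>torus)"
      by (rule norm_triangle_ineq)
    also have "\<dots> \<le> (\<integral>x. B * norm (f s x - f t x) \<partial>torus) + (\<integral>x. N s * norm (f t x) \<partial>torus)"
      using fi i1 i2 b1 b2 by (intro add_mono Bochner_Integration.integral_norm_bound_integral) auto
    also have "\<dots> = B * F s + N s * A" by (simp add: F_def A_def)
    finally show ?case .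
  qed
  from Lim_null_comparison[OF this] lim
  show "((\<lambda>t. \<integral>x. f t x \<bullet> g t x \<partial>torus) \<longlongrightarrow> (\<integral>x. f t x \<bullet> g t x \<partial>torus)) (at t within {0..})"
    by (simp add: LIM_zero_iff)
qed

lemma joint_Ck_imp_CL1:
  fixes g :: "real \<Rightarrow> real^'n \<Rightarrow> 'b::euclidean_space"
  assumes g: "joint_Ck k g"
  shows "CL1 g"
  unfolding CL1_def
proof (intro conjI allI impI)
  show "(\<lambda>(t,x). g t x) \<in> borel_measurable spacetime" by (rule joint_Ck_measurable_spacetime[OF g])
  show "integrable torus (g t)" for t by (rule joint_Ck_integrable_torus[OF g])
  show "((\<lambda>s. \<integral>x. norm (g s x - g t x) \<partial>torus) \<longlongrightarrow> 0) (at t within {0..})" for t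
  proof (rule tendsto_within_subset[OF _ subset_UNIV], rule Lim_null_comparison)
    let ?m = "measure torus (space (torus :: (real^'n) measure))"
    have "((\<lambda>s. ?m * Ck_norm 0 (\<lambda>x. g s x - g t x)) \<longlongrightarrow> ?m * 0) (at t)"
      by (intro tendsto_intros joint_Ck_tendsto_Ck_norm_0[OF g])
    then show "((\<lambda>s. ?m * Ck_norm 0 (\<lambda>x. g s x - g t x)) \<longlongrightarrow> 0) (at t)" by simp
    have "norm (\<integral>x. norm (g s x - g t x) \<partial>torus) \<le> ?m * Ck_norm 0 (\<lambda>x. g s x - g t x)" for s
    proof -
      have T: "Ck_torus 0 (\<lambda>x. g s x - g t x)"
        by (intro Ck_torus_diff joint_Ck_imp_Ck_torus joint_Ck_imp_0[OF g])
      have "norm (\<integral>x. norm (g s x - g t x) \<partial>torus) \<le> (\<integral>x. Ck_norm 0 (\<lambda>x. g s x - g t x) \<partial>(torus :: (real^'n) measure))"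
        using joint_Ck_integrable_torus[OF g] norm_le_Ck_norm_0[of "\<lambda>x. g s x - g t x"] T
        by (intro Bochner_Integration.integral_norm_bound_integral) (auto simp: Ck_torus_def)
      then show ?thesis by simp
    qed
    then show "eventually (\<lambda>s. norm (\<integral>x. norm (g s x - g t x) \<partial>torus) \<le> ?m * Ck_norm 0 (\<lambda>x. g s x - g t x)) (at t)"
      by (intro always_eventually) blast
  qed
qed

text \<open>The \<open>L\<^sup>1\<close> norm is a continuous function of time, hence integrable over compact time intervals, and
  Tonelli's theorem applies.\<close>

lemma CL1_imp_L1loc:
  fixes f :: "real \<Rightarrow> real^'n \<Rightarrow> 'b::euclidean_space"
  assumes f: "CL1 f"
  shows "L1loc f"
  unfolding L1loc_def set_integrable_def
proof (intro allI impI)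
  fix a b :: real assume ab: "0 < a" "a < b"
  define h where "h = (\<lambda>p. indicator ({a..b} \<times> UNIV) p *\<^sub>R (case p of (t,x) \<Rightarrow> f t x))"
  have fm: "(\<lambda>(t,x). f t x) \<in> borel_measurable spacetime" using f by (simp add: CL1_def)
  have "indicator ({a..b} \<times> (UNIV :: (real^'n) set)) \<in> (borel_measurable borel :: (real \<times> (real^'n) \<Rightarrow> real) set)"
    by (intro borel_measurable_indicator borel_closed closed_Times) auto
  then have ind: "indicator ({a..b} \<times> UNIV) \<in> (borel_measurable spacetime :: (real \<times> (real^'n) \<Rightarrow> real) set)"
    using borel_measurable_spacetime[of "\<lambda>t x. indicator ({a..b} \<times> UNIV) (t, x)"]
    by (simp only: case_prod_eta)
  have hm: "h \<in> borel_measurable spacetime" unfolding h_def by (intro borel_measurable_scaleR ind fm)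
  have "continuous_on {0..} (\<lambda>t. \<integral>x. norm (f t x) \<partial>torus)"
    unfolding continuous_on_def
  proof
    fix t :: real assume t: "t \<in> {0..}"
    have "eventually (\<lambda>s. s \<in> {0..}) (at t within {0..})" by (simp add: eventually_at_filter)
    then have "eventually (\<lambda>s. norm ((\<integral>x. norm (f s x) \<partial>torus) - (\<integral>x. norm (f t x) \<partial>torus))
        \<le> (\<integral>x. norm (f s x - f t x) \<partial>torus)) (at t within {0..})"
    proof eventually_elim
      case (elim s)
      have fi: "integrable torus (f s)" "integrable torus (f t)" using f t elim by (auto simp: CL1_def)
      have "(\<integral>x. norm (f s x) \<partial>torus) - (\<integral>x. norm (f t x) \<partial>torus) = (\<integral>x. norm (f s x) - norm (f t x) \<partial>torus)"
        using fi by simp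
      also have "norm \<dots> \<le> (\<integral>x. norm (f s x - f t x) \<partial>torus)"
        using fi by (intro Bochner_Integration.integral_norm_bound_integral) (auto intro: norm_triangle_ineq3)
      finally show ?case .
    qed
    from Lim_null_comparison[OF this] f t
    show "((\<lambda>t. \<integral>x. norm (f t x) \<partial>torus) \<longlongrightarrow> (\<integral>x. norm (f t x) \<partial>torus)) (at t within {0..})"
      by (simp add: LIM_zero_iff CL1_def)
  qed
  then have "continuous_on {a..b} (\<lambda>t. \<integral>x. norm (f t x) \<partial>torus)"
    using ab by (auto elim: continuous_on_subset)
  from borel_integrable_compact[OF compact_Icc this]
  have "integrable lborel (\<lambda>t. indicator {a..b} t *\<^sub>R (\<integral>x. norm (f t x) \<partial>torus))"
    by simp
  then have "integrable halfline (\<lambda>t. indicator {a..b} t *\<^sub>R (\<integral>x. norm (f t x) \<partial>torus))"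
    unfolding halfline_def
    using integrable_mult_indicator[of "{0<..}" lborel "\<lambda>t. indicator {a..b} t *\<^sub>R (\<integral>x. norm (f t x) \<partial>torus)"]
    by (subst integrable_restrict_space) auto
  moreover have "(\<lambda>t. indicator {a..b} t *\<^sub>R (\<integral>x. norm (f t x) \<partial>torus)) = (\<lambda>t. \<integral>x. norm (h (t,x)) \<partial>torus)"
    by (auto simp: h_def fun_eq_iff indicator_def)
  ultimately have "integrable halfline (\<lambda>t. \<integral>x. norm (h (t,x)) \<partial>torus)" by simp
  then have "integrable (halfline \<Otimes>\<^sub>M torus) h"
    using hm ab CL1_integrable[OF f]
    by (intro spacetime.Fubini_integrable) (auto simp: spacetime_def h_def space_halfline indicator_def intro!: AE_I2)
  then show "integrable spacetime (\<lambda>p. indicator ({a..b} \<times> UNIV) p *\<^sub>R (case p of (t,x) \<Rightarrow> f t x))"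
    by (simp add: h_def spacetime_def)
qed

lemma L1loc_cutoff_integrable:
  fixes f g :: "real \<Rightarrow> real^'n \<Rightarrow> 'b::euclidean_space"
  assumes f: "L1loc f" and g: "joint_Ck k g" and \<theta>: "continuous_on UNIV \<theta>" "\<And>t. t \<notin> {a..b} \<Longrightarrow> \<theta> t = 0" and a: "0 < a"
  shows "integrable spacetime (\<lambda>(t,x). \<theta> t * (f t x \<bullet> g t x))"
proof -
  have \<theta>g: "joint_Ck 0 (\<lambda>t x. \<theta> t *\<^sub>R g t x)"
    using joint_Ck_scaleR[OF joint_Ck_time[OF \<theta>(1)] joint_Ck_imp_0[OF g]] .
  define c where "c = max b a + 1"
  have c: "a < c" "b \<le> c" by (auto simp: c_def)
  obtain B where B: "B > 0" "\<forall>t\<in>{a..c}. \<forall>x. norm (\<theta> t *\<^sub>R g t x) \<le> B" using joint_Ck_bounded[OF \<theta>g] by blast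
  have "norm (\<theta> t *\<^sub>R g t x) \<le> B" for t x
    using B c \<theta>(2)[of t] by (cases "t \<in> {a..c}") auto
  moreover have "integrable spacetime (\<lambda>p. indicator ({a..c} \<times> UNIV) p *\<^sub>R (case p of (t,x) \<Rightarrow> f t x))"
    using f a c by (auto simp: L1loc_def set_integrable_def)
  ultimately have "integrable spacetime (\<lambda>p. (indicator ({a..c} \<times> UNIV) p *\<^sub>R (case p of (t,x) \<Rightarrow> f t x)) \<bullet> (case p of (t,x) \<Rightarrow> \<theta> t *\<^sub>R g t x))"
    by (intro integrable_bounded_inner(1)[where B = B] joint_Ck_measurable_spacetime[OF \<theta>g]) auto
  moreover have "(\<lambda>p. (indicator ({a..c} \<times> UNIV) p *\<^sub>R (case p of (t,x) \<Rightarrow> f t x)) \<bullet> (case p of (t,x) \<Rightarrow> \<theta> t *\<^sub>R g t x))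
      = (\<lambda>(t,x). \<theta> t * (f t x \<bullet> g t x))"
  proof -
    have "t \<in> {a..c}" if "\<theta> t \<noteq> 0" for t using \<theta>(2)[of t] that c by force
    then show ?thesis by (force simp: fun_eq_iff indicator_def)
  qed
  ultimately show ?thesis by simp
qed

lemma integral_spacetime_iterated:
  fixes F :: "real \<times> (real^'n) \<Rightarrow> real"
  assumes "integrable spacetime F"
  shows "integral\<^sup>L spacetime F = (\<integral>t. (\<integral>x. F (t,x) \<partial>torus) \<partial>halfline)"
  using spacetime.integral_fst'[of F] assms by (simp add: spacetime_def)

lemma CL1_cutoff_integral:
  fixes f g :: "real \<Rightarrow> real^'n \<Rightarrow> 'b::euclidean_space"
  assumes f: "CL1 f" and g: "joint_Ck k g" and \<theta>: "continuous_on UNIV \<theta>" "\<And>t. t \<notin> {a..b} \<Longrightarrow> \<theta> t = 0" and a: "0 < a"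
  shows "(\<integral>(t,x). \<theta> t * (f t x \<bullet> g t x) \<partial>spacetime) = (\<integral>t. \<theta> t * (\<integral>x. f t x \<bullet> g t x \<partial>torus) \<partial>halfline)"
  by (subst integral_spacetime_iterated[OF L1loc_cutoff_integrable[OF CL1_imp_L1loc[OF f] g \<theta> a]]) simp_all

lemma halfline_integral:
  fixes F :: "real \<Rightarrow> real"
  assumes "\<And>t. t \<notin> {a..b} \<Longrightarrow> F t = 0" "0 < a"
  shows "integral\<^sup>L halfline F = integral\<^sup>L lborel F"
proof -
  have "integral\<^sup>L halfline F = (\<integral>t. indicator {0<..} t *\<^sub>R F t \<partial>lborel)"
    unfolding halfline_def by (rule integral_restrict_space) simp
  also have "(\<lambda>t. indicator {0<..} t *\<^sub>R F t) = F"
    using assms by (auto simp: fun_eq_iff indicator_def not_less)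
  finally show ?thesis .
qed


section \<open>Cutoffs in time and Gronwall's inequality\<close>

lemma integrable_continuous_support:
  fixes F :: "real \<Rightarrow> real"
  assumes "continuous_on {a..b} F" "\<And>t. t \<notin> {a..b} \<Longrightarrow> F t = 0"
  shows "integrable lborel F"
proof -
  have "integrable lborel (\<lambda>t. indicator {a..b} t *\<^sub>R F t)"
    by (rule borel_integrable_compact[OF compact_Icc assms(1)])
  moreover have "(\<lambda>t. indicator {a..b} t *\<^sub>R F t) = F"
    using assms(2) by (auto simp: fun_eq_iff indicator_def)
  ultimately show ?thesis by simp
qed

lemma cutoff_integral_deriv:
  assumes "cutoff F f a b"
  shows "integral\<^sup>L lborel f = 0"
proof -
  define c where "c = max a b + 1"
  have "integral\<^sup>L lborel (\<lambda>x. f x * indicator {a-1..c} x) = F c - F (a - 1)"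
  proof (rule integral_FTC_Icc_real)
    show "isCont f x" for x
      using cutoff_continuous'[OF assms] by (simp add: continuous_on_eq_continuous_at)
  qed (use cutoff_deriv[OF assms] in \<open>auto simp: c_def\<close>)
  moreover have "F c = 0" "F (a - 1) = 0"
    using cutoff_zero[OF assms, of c] cutoff_zero[OF assms, of "a - 1"] by (auto simp: c_def max_def)
  moreover have "(\<lambda>x. f x * indicator {a-1..c} x) = f"
  proof
    fix x show "f x * indicator {a-1..c} x = f x"
      using cutoff_zero'[OF assms, of x] by (cases "x \<in> {a..b}") (auto simp: indicator_def c_def)
  qed
  ultimately show ?thesis by simp
qed

lemma cutoff_mult:
  assumes "cutoff \<theta> \<theta>' a b" "\<And>t. (\<zeta> has_real_derivative \<zeta>' t) (at t)" "continuous_on UNIV \<zeta>'"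
  shows "cutoff (\<lambda>t. \<theta> t * \<zeta> t) (\<lambda>t. \<theta>' t * \<zeta> t + \<zeta>' t * \<theta> t) a b"
proof -
  have "continuous_on UNIV \<zeta>" using assms(2) by (meson DERIV_isCont continuous_at_imp_continuous_on)
  then show ?thesis
    using assms cutoff_continuous[OF assms(1)] unfolding cutoff_def
    by (auto intro!: DERIV_mult continuous_intros)
qed

lemma cutoff_energy_test_fun:
  assumes \<theta>: "cutoff \<theta> \<theta>' a b" "0 < a" "\<And>t. 0 \<le> \<theta> t"
  shows "energy_test_fun \<theta> \<theta>'"
proof -
  have bdd: "\<exists>B. \<forall>t. \<bar>F t\<bar> \<le> B" if "continuous_on UNIV F" "\<And>t. t \<notin> {a..b} \<Longrightarrow> F t = 0" for F :: "real \<Rightarrow> real"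
  proof -
    have "compact (F ` {a..b})" using that(1) by (intro compact_continuous_image) (auto elim: continuous_on_subset)
    then obtain B where B: "B > 0" "\<forall>y\<in>F ` {a..b}. norm y \<le> B" using compact_imp_bounded bounded_pos by metis
    then have "\<bar>F t\<bar> \<le> B" for t using that(2)[of t] by (cases "t \<in> {a..b}") auto
    then show ?thesis by blast
  qed
  have parts: "(\<integral>t. \<theta> t * deriv \<phi> t \<partial>halfline) = - (\<integral>t. \<theta>' t * \<phi> t \<partial>halfline)"
    if \<phi>: "\<phi> C1_differentiable_on UNIV" for \<phi> :: "real \<Rightarrow> real"
  proof -
    obtain D where D: "\<And>t. (\<phi> has_vector_derivative D t) (at t)" "continuous_on UNIV D"
      using \<phi> unfolding C1_differentiable_on_def by auto
    have D': "(\<phi> has_real_derivative D t) (at t)" for t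
      using D(1) by (simp add: has_real_derivative_iff_has_vector_derivative)
    have deriv: "deriv \<phi> = D" using DERIV_imp_deriv[OF D'] by blast
    have c\<phi>: "continuous_on UNIV \<phi>" using D' by (meson DERIV_isCont continuous_at_imp_continuous_on)
    have i1: "integrable lborel (\<lambda>t. \<theta>' t * \<phi> t)"
      by (rule integrable_continuous_support[OF continuous_on_subset[OF _ subset_UNIV], of _ a b])
        (auto intro!: continuous_intros cutoff_continuous'[OF \<theta>(1)] c\<phi> simp: cutoff_zero'[OF \<theta>(1)])
    have i2: "integrable lborel (\<lambda>t. \<theta> t * D t)"
      by (rule integrable_continuous_support[OF continuous_on_subset[OF _ subset_UNIV], of _ a b])
        (auto intro!: continuous_intros cutoff_continuous[OF \<theta>(1)] D(2) simp: cutoff_zero[OF \<theta>(1)])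
    have "(\<integral>t. \<theta>' t * \<phi> t + \<theta> t * D t \<partial>lborel) = 0"
      using cutoff_integral_deriv[OF cutoff_mult[OF \<theta>(1) D' D(2)]] by (simp add: mult.commute)
    then have "(\<integral>t. \<theta>' t * \<phi> t \<partial>lborel) + (\<integral>t. \<theta> t * D t \<partial>lborel) = 0"
      using i1 i2 by simp
    moreover have "(\<integral>t. \<theta>' t * \<phi> t \<partial>halfline) = (\<integral>t. \<theta>' t * \<phi> t \<partial>lborel)"
      by (rule halfline_integral[of a b]) (use cutoff_zero'[OF \<theta>(1)] \<theta>(2) in auto)
    moreover have "(\<integral>t. \<theta> t * D t \<partial>halfline) = (\<integral>t. \<theta> t * D t \<partial>lborel)"
      by (rule halfline_integral[of a b]) (use cutoff_zero[OF \<theta>(1)] \<theta>(2) in auto)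
    ultimately show ?thesis by (simp add: deriv)
  qed
  obtain B where B: "\<And>t. \<bar>\<theta>' t\<bar> \<le> B" using bdd[OF cutoff_continuous'[OF \<theta>(1)] cutoff_zero'[OF \<theta>(1)]] by blast
  obtain B' where B': "\<And>t. \<bar>\<theta> t\<bar> \<le> B'" using bdd[OF cutoff_continuous[OF \<theta>(1)] cutoff_zero[OF \<theta>(1)]] by blast
  have "W1inf \<theta> \<theta>'"
    unfolding W1inf_def
  proof (intro conjI allI impI)
    show "continuous_on {0..} \<theta>" using cutoff_continuous[OF \<theta>(1)] by (rule continuous_on_subset) auto
    show "bounded (\<theta> ` {0..})" unfolding bounded_iff using B' by auto
    show "\<theta>' \<in> borel_measurable halfline"
      by (intro borel_measurable_halfline borel_measurable_continuous_onI cutoff_continuous'[OF \<theta>(1)])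
    show "\<exists>B. AE t in halfline. \<bar>\<theta>' t\<bar> \<le> B" using B by auto
  qed (use parts in blast)
  moreover have "\<theta> t = 0" if "b + 1 \<le> t" for t using cutoff_zero[OF \<theta>(1), of t] that by simp
  ultimately show ?thesis unfolding energy_test_fun_def using \<theta>(3) by blast
qed

text \<open>Gronwall's inequality in distributional form. The test function is a smooth plateau times the
  integrating factor \<open>e\<^sup>-\<^sup>K\<^sup>t\<close>, so that the linear term drops out and the flanks of the plateau
  give averages of \<open>e\<^sup>-\<^sup>K\<^sup>t W\<close> near its two ends.\<close>

lemma distributional_gronwall:
  fixes W :: "real \<Rightarrow> real"
  assumes W: "continuous_on {0..<T} W" and K: "K \<ge> 0" and c: "c \<ge> 0"
    and ineq: "\<And>\<theta> \<theta>' a b. cutoff \<theta> \<theta>' a b \<Longrightarrow> 0 < a \<Longrightarrow> b < T \<Longrightarrow> (\<And>t. 0 \<le> \<theta> t) \<Longrightarrow>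
      - (\<integral>t. \<theta>' t * W t \<partial>lborel) \<le> (\<integral>t. \<theta> t * (K * W t + c) \<partial>lborel)"
    and t0: "0 < t0" "t0 < T"
  shows "W t0 \<le> exp (K * t0) * (W 0 + c * T)"
proof (rule ccontr)
  define V where "V t = exp (- K * t) * W t" for t
  assume "\<not> W t0 \<le> exp (K * t0) * (W 0 + c * T)"
  then have "exp (- K * t0) * (exp (K * t0) * (W 0 + c * T)) < V t0"
    unfolding V_def by (intro mult_strict_left_mono) auto
  then have "W 0 + c * T < V t0" by (simp add: mult.assoc[symmetric] exp_add[symmetric])
  then have "V 0 + c * T < V t0" by (simp add: V_def)
  define \<mu> where "\<mu> = (V t0 - (V 0 + c * T)) / 3"
  have \<mu>: "\<mu> > 0" "V t0 - V 0 - c * T = 3 * \<mu>" using \<open>V 0 + c * T < V t0\<close> by (auto simp: \<mu>_def)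
  have V: "continuous_on {0..<T} V" unfolding V_def by (intro continuous_intros W)
  obtain d0 where d0: "d0 > 0" "\<And>t. t \<in> {0..<T} \<Longrightarrow> \<bar>t\<bar> < d0 \<Longrightarrow> V t < V 0 + \<mu>"
  proof -
    have "0 \<in> {0..<T}" using t0 by simp
    then obtain d where d: "d > 0" "\<And>t. t \<in> {0..<T} \<Longrightarrow> dist t 0 < d \<Longrightarrow> dist (V t) (V 0) < \<mu>"
      using V \<mu>(1) unfolding continuous_on_iff by blast
    show ?thesis
    proof (rule that[OF d(1)])
      show "V t < V 0 + \<mu>" if "t \<in> {0..<T}" "\<bar>t\<bar> < d" for t
        using d(2)[OF that(1)] that(2) by (simp add: dist_real_def abs_less_iff)
    qed
  qed
  obtain d1 where d1: "d1 > 0" "\<And>t. t \<in> {0..<T} \<Longrightarrow> \<bar>t - t0\<bar> < d1 \<Longrightarrow> V t0 - \<mu> < V t"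
  proof -
    have "t0 \<in> {0..<T}" using t0 by simp
    then obtain d where d: "d > 0" "\<And>t. t \<in> {0..<T} \<Longrightarrow> dist t t0 < d \<Longrightarrow> dist (V t) (V t0) < \<mu>"
      using V \<mu>(1) unfolding continuous_on_iff by blast
    show ?thesis
    proof (rule that[OF d(1)])
      show "V t0 - \<mu> < V t" if "t \<in> {0..<T}" "\<bar>t - t0\<bar> < d" for t
        using d(2)[OF that(1)] that(2) by (simp add: dist_real_def abs_less_iff)
    qed
  qed
  define \<delta> where "\<delta> = Min {d0 / 3, d1 / 2, t0 / 3, (T - t0) / 2}"
  have \<delta>: "\<delta> > 0" "2 * \<delta> < d0" "\<delta> < d1" "2 * \<delta> < t0" "t0 + \<delta> < T"
  proof -
    have le: "\<delta> \<le> d0 / 3" "\<delta> \<le> d1 / 2" "\<delta> \<le> t0 / 3" "\<delta> \<le> (T - t0) / 2" unfolding \<delta>_def by (intro Min_le; simp)+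
    show "\<delta> > 0" unfolding \<delta>_def using d0(1) d1(1) t0 by simp
    show "2 * \<delta> < d0" using le(1) d0(1) by linarith
    show "\<delta> < d1" using le(2) d1(1) by linarith
    show "2 * \<delta> < t0" using le(3) t0 by linarith
    have "2 * \<delta> \<le> T - t0" using le(4) by simp
    then show "t0 + \<delta> < T" using t0 by linarith
  qed
  \<comment> \<open>The kernel \<open>k \<tau>\<close> has unit mass on \<open>{\<tau>..\<tau> + \<delta>}\<close>; \<open>k \<delta>\<close> averages near \<open>0\<close> and \<open>k t0\<close> near \<open>t0\<close>.\<close>
  define k where "k \<tau> t = step' ((t - \<tau>) / \<delta>) / \<delta>" for \<tau> t
  have k_deriv: "((\<lambda>t. step ((t - \<tau>) / \<delta>)) has_real_derivative k \<tau> t) (at t)" for \<tau> t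
  proof -
    have "((\<lambda>t. (t - \<tau>) / \<delta>) has_real_derivative 1 / \<delta>) (at t)" using \<delta>(1) by (auto intro!: derivative_eq_intros)
    from DERIV_chain2[OF DERIV_step this] show ?thesis by (simp add: k_def)
  qed
  have k_cont: "continuous_on UNIV (k \<tau>)" for \<tau>
    unfolding k_def using \<delta>(1) by (intro continuous_intros continuous_on_compose2[OF continuous_step'[of UNIV]]) auto
  have k_zero: "k \<tau> t = 0" if "t \<notin> {\<tau>..\<tau> + \<delta>}" for \<tau> t
  proof -
    have "(t - \<tau>) / \<delta> \<notin> {0..1}" using that \<delta>(1) by (auto simp: field_simps)
    then show ?thesis by (simp add: k_def step'_0)
  qed
  have k_nonneg: "0 \<le> k \<tau> t" for \<tau> t using step'_nonneg \<delta>(1) by (simp add: k_def)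
  have k_int: "integrable lborel (k \<tau>)" for \<tau>
    by (rule integrable_continuous_support[OF continuous_on_subset[OF k_cont subset_UNIV] k_zero])
  have k_one: "integral\<^sup>L lborel (k \<tau>) = 1" for \<tau>
  proof -
    have "integral\<^sup>L lborel (\<lambda>x. k \<tau> x * indicator {\<tau>..\<tau>+\<delta>} x) = step ((\<tau> + \<delta> - \<tau>) / \<delta>) - step ((\<tau> - \<tau>) / \<delta>)"
    proof (rule integral_FTC_Icc_real)
      show "isCont (k \<tau>) x" for x using k_cont by (simp add: continuous_on_eq_continuous_at)
    qed (use \<delta>(1) k_deriv in auto)
    moreover have "(\<lambda>x. k \<tau> x * indicator {\<tau>..\<tau>+\<delta>} x) = k \<tau>"
      using k_zero by (auto simp: fun_eq_iff indicator_def)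
    ultimately show ?thesis using \<delta>(1) by (simp add: step_0 step_1)
  qed
  have kV_int: "integrable lborel (\<lambda>t. k \<tau> t * V t)" if "0 \<le> \<tau>" "\<tau> + \<delta> < T" for \<tau>
  proof (rule integrable_continuous_support)
    show "continuous_on {\<tau>..\<tau> + \<delta>} (\<lambda>t. k \<tau> t * V t)"
      using that by (intro continuous_intros continuous_on_subset[OF V] continuous_on_subset[OF k_cont]) auto
  qed (simp add: k_zero)
  \<comment> \<open>The plateau has the derivative \<open>k \<delta> - k t0\<close>.\<close>
  define \<eta> where "\<eta> t = step ((t - \<delta>) / \<delta>) - step ((t - t0) / \<delta>)" for t
  define \<theta> where "\<theta> t = exp (- K * t) * \<eta> t" for t
  define \<theta>' where "\<theta>' t = exp (- K * t) * (k \<delta> t - k t0 t) - K * \<theta> t" for t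
  have \<eta>: "0 \<le> \<eta> t" "\<eta> t \<le> 1" for t
  proof -
    have "(t - t0) / \<delta> \<le> (t - \<delta>) / \<delta>" using \<delta> by (intro divide_right_mono) auto
    then show "0 \<le> \<eta> t" unfolding \<eta>_def using step_mono by fastforce
    show "\<eta> t \<le> 1" unfolding \<eta>_def using step_bounds[of "(t - \<delta>) / \<delta>"] step_bounds[of "(t - t0) / \<delta>"] by linarith
  qed
  have \<theta>_bounds: "0 \<le> \<theta> t" "0 \<le> t \<Longrightarrow> \<theta> t \<le> 1" for t
    using \<eta>[of t] K unfolding \<theta>_def by (auto intro!: mult_le_one)
  have cut: "cutoff \<theta> \<theta>' \<delta> (t0 + \<delta>)"
    unfolding cutoff_def
  proof (intro conjI allI impI)
    show "(\<theta> has_real_derivative \<theta>' t) (at t)" for t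
      unfolding \<theta>_def \<theta>'_def \<eta>_def
      by (auto intro!: derivative_eq_intros k_deriv simp: algebra_simps)
    have "continuous_on UNIV \<eta>"
      unfolding \<eta>_def using k_deriv by (intro continuous_on_diff) (meson DERIV_isCont continuous_at_imp_continuous_on)+
    then show "continuous_on UNIV \<theta>'" unfolding \<theta>'_def \<theta>_def by (intro continuous_intros k_cont)
    show "\<theta> t = 0" if "t \<notin> {\<delta>..t0 + \<delta>}" for t
    proof (cases "t < \<delta>")
      case True
      then have "(t - \<delta>) / \<delta> \<le> 0" "(t - t0) / \<delta> \<le> 0" using \<delta> by (auto simp: divide_le_0_iff)
      then show ?thesis by (simp add: \<theta>_def \<eta>_def step_0)
    next
      case False
      then have "1 \<le> (t - \<delta>) / \<delta>" "1 \<le> (t - t0) / \<delta>" using that \<delta> by (auto simp: le_divide_eq)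
      then show ?thesis by (simp add: \<theta>_def \<eta>_def step_1)
    qed
  qed
  have sub: "{\<delta>..t0 + \<delta>} \<subseteq> {0..<T}" using \<delta> by auto
  have WI: "integrable lborel (\<lambda>t. \<theta> t * W t)" "integrable lborel \<theta>"
    using cutoff_zero[OF cut]
    by (intro integrable_continuous_support[of \<delta> "t0 + \<delta>"] continuous_intros continuous_on_subset[OF W sub]
        continuous_on_subset[OF cutoff_continuous[OF cut] subset_UNIV]; simp)+
  have "- (\<integral>t. \<theta>' t * W t \<partial>lborel) \<le> (\<integral>t. \<theta> t * (K * W t + c) \<partial>lborel)"
    by (rule ineq[OF cut]) (use \<delta> \<theta>_bounds in auto)
  moreover have "(\<integral>t. \<theta>' t * W t \<partial>lborel) = (\<integral>t. k \<delta> t * V t - k t0 t * V t - K * (\<theta> t * W t) \<partial>lborel)"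
    by (intro Bochner_Integration.integral_cong) (auto simp: \<theta>'_def V_def algebra_simps)
  moreover have "\<dots> = (\<integral>t. k \<delta> t * V t \<partial>lborel) - (\<integral>t. k t0 t * V t \<partial>lborel) - K * (\<integral>t. \<theta> t * W t \<partial>lborel)"
    using kV_int[of \<delta>] kV_int[of t0] WI \<delta> t0 by simp
  moreover have "(\<integral>t. \<theta> t * (K * W t + c) \<partial>lborel) = K * (\<integral>t. \<theta> t * W t \<partial>lborel) + c * (\<integral>t. \<theta> t \<partial>lborel)"
    using WI by (simp add: algebra_simps)
  ultimately have main: "(\<integral>t. k t0 t * V t \<partial>lborel) - (\<integral>t. k \<delta> t * V t \<partial>lborel) \<le> c * (\<integral>t. \<theta> t \<partial>lborel)"
    by linarith
  have "(\<integral>t. \<theta> t \<partial>lborel) \<le> (\<integral>t. indicator {0..T} t \<partial>lborel)"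
  proof (intro integral_mono WI)
    show "\<theta> t \<le> indicator {0..T} t" for t
      using \<theta>_bounds[of t] cutoff_zero[OF cut, of t] sub by (cases "t \<in> {\<delta>..t0 + \<delta>}") (auto simp: indicator_def)
  qed (auto intro!: integrable_real_indicator simp: emeasure_lborel_Icc_eq)
  also have "\<dots> = T" using t0 by simp
  finally have "c * (\<integral>t. \<theta> t \<partial>lborel) \<le> c * T" using c by (rule mult_left_mono)
  moreover have "(\<integral>t. k t0 t * (V t0 - \<mu>) \<partial>lborel) \<le> (\<integral>t. k t0 t * V t \<partial>lborel)"
  proof (intro integral_mono kV_int integrable_mult_left k_int)
    show "k t0 t * (V t0 - \<mu>) \<le> k t0 t * V t" for t
      using d1(2)[of t] k_zero[of t t0] k_nonneg[of t0 t] \<delta> t0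
      by (cases "t \<in> {t0..t0 + \<delta>}") (auto intro: mult_left_mono[OF less_imp_le])
  qed (use t0 \<delta> in auto)
  moreover have "(\<integral>t. k \<delta> t * V t \<partial>lborel) \<le> (\<integral>t. k \<delta> t * (V 0 + \<mu>) \<partial>lborel)"
  proof (intro integral_mono kV_int integrable_mult_left k_int)
    show "k \<delta> t * V t \<le> k \<delta> t * (V 0 + \<mu>)" for t
      using d0(2)[of t] k_zero[of t \<delta>] k_nonneg[of \<delta> t] \<delta> t0
      by (cases "t \<in> {\<delta>..\<delta> + \<delta>}") (auto intro: mult_left_mono[OF less_imp_le])
  qed (use t0 \<delta> in auto)
  ultimately have "V t0 - \<mu> - (V 0 + \<mu>) \<le> c * T" using main by (simp add: k_one)
  then show False using \<mu> by linarith
qed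

text \<open>A field that is localized in time contributes no net change over space-time.\<close>

lemma spacetime_integral_time_derivative:
  fixes f f' :: "real \<Rightarrow> real^'n \<Rightarrow> real"
  assumes \<theta>: "cutoff \<theta> \<theta>' a b" "0 < a" and f: "joint_Ck k f" "joint_Ck k f'"
    and deriv: "\<And>t x. t \<in> {a..b} \<Longrightarrow> ((\<lambda>s. f s x) has_real_derivative f' t x) (at t)"
  shows "(\<integral>(t,x). \<theta>' t * f t x + \<theta> t * f' t x \<partial>spacetime) = 0"
proof -
  have one: "joint_Ck 0 (\<lambda>t (x :: real^'n). 1 :: real)" by (intro joint_Ck_time continuous_intros)
  have "integrable spacetime (\<lambda>(t,x). \<theta>' t * (f t x \<bullet> 1))"
    by (rule L1loc_cutoff_integrable[OF CL1_imp_L1loc[OF joint_Ck_imp_CL1[OF f(1)]] one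
          cutoff_continuous'[OF \<theta>(1)] cutoff_zero'[OF \<theta>(1)] \<theta>(2)])
  moreover have "integrable spacetime (\<lambda>(t,x). \<theta> t * (f' t x \<bullet> 1))"
    by (rule L1loc_cutoff_integrable[OF CL1_imp_L1loc[OF joint_Ck_imp_CL1[OF f(2)]] one
          cutoff_continuous[OF \<theta>(1)] cutoff_zero[OF \<theta>(1)] \<theta>(2)])
  ultimately have int: "integrable (halfline \<Otimes>\<^sub>M torus) (\<lambda>(t,x). \<theta>' t * f t x + \<theta> t * f' t x)"
    using Bochner_Integration.integrable_add by (fastforce simp: case_prod_unfold spacetime_def)
  have zero: "(\<integral>t. \<theta>' t * f t x + \<theta> t * f' t x \<partial>halfline) = 0" for x
  proof -
    have cx: "continuous_on UNIV (\<lambda>t. f t x)" "continuous_on UNIV (\<lambda>t. f' t x)"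
      by (intro joint_Ck_continuous_compose[OF f(1)] joint_Ck_continuous_compose[OF f(2)] continuous_intros)+
    have cut: "cutoff (\<lambda>t. \<theta> t * f t x) (\<lambda>t. \<theta>' t * f t x + \<theta> t * f' t x) a b"
      unfolding cutoff_def
    proof (intro conjI allI impI)
      show "((\<lambda>t. \<theta> t * f t x) has_real_derivative \<theta>' t * f t x + \<theta> t * f' t x) (at t)" for t
        using cutoff_time_derivative[OF \<theta>(1), of f f' x t] deriv
        by (simp add: has_real_derivative_iff_has_vector_derivative)
    qed (auto intro!: continuous_intros cx cutoff_continuous[OF \<theta>(1)] cutoff_continuous'[OF \<theta>(1)] simp: cutoff_zero[OF \<theta>(1)])
    then show ?thesis
      using halfline_integral[OF cutoff_zero'[OF cut] \<theta>(2)] cutoff_integral_deriv[OF cut] by simp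
  qed
  have "(\<integral>(t,x). \<theta>' t * f t x + \<theta> t * f' t x \<partial>spacetime)
      = (\<integral>x. (\<integral>t. \<theta>' t * f t x + \<theta> t * f' t x \<partial>halfline) \<partial>torus)"
    using spacetime.integral_snd[OF int] by (simp add: spacetime_def)
  then show ?thesis by (simp add: zero)
qed


section \<open>Weak divergences tested by fields continuous in time\<close>

lemma grad_eq_sum: "grad f x = (\<Sum>j\<in>UNIV. pd j f x *\<^sub>R axis j 1)"
  by (simp add: grad_def vec_eq_iff axis_def if_distrib sum.delta cong: if_cong)

lemma joint_Ck_grad: 
  fixes d :: "real \<Rightarrow> real^'n \<Rightarrow> real"
  shows "joint_Ck (Suc k) d \<Longrightarrow> joint_Ck k (\<lambda>t. grad (d t))"
  unfolding grad_eq_sum[abs_def]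
  by (intro joint_Ck_sum joint_Ck_scaleR joint_Ck_pd joint_Ck_time continuous_intros) auto

lemma grad_scaleR:
  assumes "\<And>x. f differentiable (at x)"
  shows "grad (\<lambda>x. c *\<^sub>R f x) x = c *\<^sub>R grad f x"
  using bounded_linear.pd_commute[OF bounded_linear_scaleR_right assms] by (simp add: grad_def vec_eq_iff)

lemma L1loc_norm_cutoff_integrable:
  fixes f :: "real \<Rightarrow> real^'n \<Rightarrow> 'b::euclidean_space"
  assumes f: "L1loc f" and \<theta>: "continuous_on UNIV \<theta>" "\<And>t. t \<notin> {a..b} \<Longrightarrow> \<theta> t = 0" and a: "0 < a"
  shows "integrable spacetime (\<lambda>(t,x). \<theta> t * norm (f t x))"
proof -
  have "L1loc (\<lambda>t x. norm (f t x))"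
    unfolding L1loc_def set_integrable_def
  proof (intro allI impI)
    fix a b :: real assume "0 < a" "a < b"
    then have "integrable spacetime (\<lambda>p. norm (indicator ({a..b} \<times> UNIV) p *\<^sub>R (case p of (t,x) \<Rightarrow> f t x)))"
      using f unfolding L1loc_def set_integrable_def by (intro integrable_norm) auto
    moreover have "(\<lambda>p. norm (indicator ({a..b} \<times> UNIV) p *\<^sub>R (case p of (t,x) \<Rightarrow> f t x)))
        = (\<lambda>p. indicator ({a..b} \<times> UNIV) p *\<^sub>R (case p of (t,x) \<Rightarrow> norm (f t x)))"
      by (auto simp: fun_eq_iff)
    ultimately show "integrable spacetime (\<lambda>p. indicator ({a..b} \<times> UNIV) p *\<^sub>R (case p of (t,x) \<Rightarrow> norm (f t x)))"
      by simp
  qed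
  moreover have "joint_Ck 0 (\<lambda>t (x :: real^'n). 1 :: real)" by (intro joint_Ck_time continuous_intros)
  ultimately have "integrable spacetime (\<lambda>(t,x). \<theta> t * (norm (f t x) \<bullet> 1))"
    by (rule L1loc_cutoff_integrable[OF _ _ \<theta> a])
  then show ?thesis by simp
qed

text \<open>The defining identity of a weak divergence involves no time derivative, so it extends to fields
  that are merely continuous in time: a fine partition of unity in time, built from shifted steps,
  replaces the field by its values at finitely many times.\<close>

lemma weak_divergence_cutoff:
  fixes F :: "real \<Rightarrow> real^'n \<Rightarrow> real^'n" and d :: "real \<Rightarrow> real^'n \<Rightarrow> real"
  assumes wd: "weak_divergence F D" and d: "joint_Ck 1 d" and \<theta>: "cutoff \<theta> \<theta>' a b" "0 < a"
  shows "(\<integral>(t,x). \<theta> t * (F t x \<bullet> grad (d t) x) + \<theta> t * (D t x * d t x) \<partial>spacetime) = 0"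
proof -
  have F: "L1loc F" and D: "L1loc D" using wd by (auto simp: weak_divergence_def)
  define I where "I \<xi> h = (\<lambda>(t,x). \<xi> t * (F t x \<bullet> grad (h t) x) + \<xi> t * (D t x * h t x))"
    for \<xi> :: "real \<Rightarrow> real" and h
  have I_int: "integrable spacetime (I \<xi> h)" if "joint_Ck 1 h" "cutoff \<xi> \<xi>' a b" for \<xi> \<xi>' h
  proof -
    have "joint_Ck 0 (\<lambda>t. grad (h t))" by (rule joint_Ck_grad) (use that in simp)
    from L1loc_cutoff_integrable[OF F this cutoff_continuous[OF that(2)] cutoff_zero[OF that(2)] \<theta>(2)]
    have 1: "integrable spacetime (\<lambda>(t,x). \<xi> t * (F t x \<bullet> grad (h t) x))" .
    have 2: "integrable spacetime (\<lambda>(t,x). \<xi> t * (D t x \<bullet> h t x))"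
      by (rule L1loc_cutoff_integrable[OF D that(1) cutoff_continuous[OF that(2)] cutoff_zero[OF that(2)] \<theta>(2)])
    show ?thesis
      using Bochner_Integration.integrable_add[OF 1 2] by (simp add: I_def case_prod_unfold)
  qed
  have frozen: "integral\<^sup>L spacetime (I \<xi> (\<lambda>t. d \<tau>)) = 0" if \<xi>: "cutoff \<xi> \<xi>' a b" for \<xi> \<xi>' \<tau>
  proof -
    have h: "joint_Ck 1 (\<lambda>t. d \<tau>)" "joint_Ck 1 (\<lambda>t (x :: real^'n). 0 :: real)"
      using joint_Ck_imp_Ck_torus[OF d] unfolding Ck_torus_iff_joint_Ck
      by (auto intro!: joint_Ck_time simp del: One_nat_def)
    have "interior_test_fun (\<lambda>t x. \<xi> t *\<^sub>R d \<tau> x)"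
      by (rule cutoff_test_fun(1)[OF \<xi> \<theta>(2) h]) simp
    then have eq: "(\<integral>(t,x). F t x \<bullet> grad (\<lambda>x. \<xi> t *\<^sub>R d \<tau> x) x \<partial>spacetime) = - (\<integral>(t,x). D t x * (\<xi> t *\<^sub>R d \<tau> x) \<partial>spacetime)"
      using wd unfolding weak_divergence_def by blast
    have dd: "d \<tau> differentiable (at x)" for x using d by simp
    have "joint_Ck 0 (\<lambda>t. grad (d \<tau>))" by (rule joint_Ck_grad) (use h in simp)
    from L1loc_cutoff_integrable[OF F this cutoff_continuous[OF \<xi>] cutoff_zero[OF \<xi>] \<theta>(2)]
    have 1: "integrable spacetime (\<lambda>(t,x). \<xi> t * (F t x \<bullet> grad (d \<tau>) x))" .
    have 2: "integrable spacetime (\<lambda>(t,x). \<xi> t * (D t x \<bullet> d \<tau> x))"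
      by (rule L1loc_cutoff_integrable[OF D h(1) cutoff_continuous[OF \<xi>] cutoff_zero[OF \<xi>] \<theta>(2)])
    show ?thesis
      using Bochner_Integration.integral_add[OF 1 2] eq
      by (simp add: I_def case_prod_unfold grad_scaleR[OF dd, unfolded real_scaleR_def] mult.left_commute)
  qed
  define H where "H = (\<lambda>(t,x). \<bar>\<theta> t\<bar> * norm (F t x) + \<bar>\<theta> t\<bar> * norm (D t x))"
  have abs\<theta>: "continuous_on UNIV (\<lambda>t. \<bar>\<theta> t\<bar>)" "\<And>t. t \<notin> {a..b} \<Longrightarrow> \<bar>\<theta> t\<bar> = 0"
    using cutoff_continuous[OF \<theta>(1)] cutoff_zero[OF \<theta>(1)] by (auto intro: continuous_intros)
  have H_int: "integrable spacetime H"
    using Bochner_Integration.integrable_add[OF L1loc_norm_cutoff_integrable[OF F abs\<theta> \<theta>(2)] L1loc_norm_cutoff_integrable[OF D abs\<theta> \<theta>(2)]]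
    by (simp add: H_def case_prod_unfold)
  have bound: "\<bar>integral\<^sup>L spacetime (I \<theta> d)\<bar> \<le> e * integral\<^sup>L spacetime H" if e: "e > 0" for e
  proof -
    have "joint_Ck 0 (\<lambda>t. grad (d t))" by (rule joint_Ck_grad) (use d in simp)
    from joint_Ck_uniformly_continuous[OF this e] obtain r1 where r1: "r1 > 0"
      "\<forall>s\<in>{a-1..b+1}. \<forall>t\<in>{a-1..b+1}. \<bar>s - t\<bar> < r1 \<longrightarrow> (\<forall>x. norm (grad (d s) x - grad (d t) x) < e)" by blast
    from joint_Ck_uniformly_continuous[OF d e] obtain r2 where r2: "r2 > 0"
      "\<forall>s\<in>{a-1..b+1}. \<forall>t\<in>{a-1..b+1}. \<bar>s - t\<bar> < r2 \<longrightarrow> (\<forall>x. norm (d s x - d t x) < e)" by blast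
    define \<delta> where "\<delta> = min 1 (min r1 r2)"
    have \<delta>: "0 < \<delta>" "\<delta> \<le> 1" "\<delta> \<le> r1" "\<delta> \<le> r2" using r1(1) r2(1) by (auto simp: \<delta>_def)
    obtain N :: nat where N: "b / \<delta> + 1 \<le> real N" using real_arch_simple by blast
    \<comment> \<open>The sum over \<open>k\<close> telescopes, and \<open>p k\<close> is supported within distance \<open>\<delta>\<close> of \<open>k \<delta>\<close>.\<close>
    define p where "p k t = step (t / \<delta> - real k + 1) - step (t / \<delta> - real k)" for k t
    have p_nonneg: "0 \<le> p k t" for k t unfolding p_def using step_mono by fastforce
    have p_local: "\<bar>t - real k * \<delta>\<bar> < \<delta>" if "p k t \<noteq> 0" for k t
    proof -
      have "\<not> (t / \<delta> - real k \<ge> 1)" "\<not> (t / \<delta> - real k + 1 \<le> 0)"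
        using that step_1[of "t / \<delta> - real k"] step_1[of "t / \<delta> - real k + 1"]
          step_0[of "t / \<delta> - real k"] step_0[of "t / \<delta> - real k + 1"] by (auto simp: p_def)
      then have "\<bar>t / \<delta> - real k\<bar> < 1" by linarith
      then have "\<bar>(t / \<delta> - real k) * \<delta>\<bar> < 1 * \<delta>" using \<delta>(1) by (simp add: abs_mult)
      then show ?thesis using \<delta>(1) by (simp add: left_diff_distrib)
    qed
    have p_sum: "(\<Sum>k<N. p k t) = 1" if "t \<in> {a..b}" for t
    proof -
      have "(\<Sum>k<N. p k t) = (\<Sum>k<N. (- step (t / \<delta> - real (Suc k) + 1)) - (- step (t / \<delta> - real k + 1)))"
        by (intro sum.cong) (auto simp: p_def)
      also have "\<dots> = step (t / \<delta> + 1) - step (t / \<delta> - real N + 1)"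
        by (subst sum_lessThan_telescope) simp
      also have "step (t / \<delta> - real N + 1) = 0"
      proof (rule step_0)
        have "t / \<delta> \<le> b / \<delta>" using that \<delta>(1) by (intro divide_right_mono) auto
        then show "t / \<delta> - real N + 1 \<le> 0" using N by linarith
      qed
      also have "step (t / \<delta> + 1) = 1" using that \<theta>(2) \<delta>(1) by (intro step_1) auto
      finally show ?thesis by simp
    qed
    have p_deriv: "(p k has_real_derivative (step' (t / \<delta> - real k + 1) - step' (t / \<delta> - real k)) / \<delta>) (at t)" for k t
    proof -
      have "((\<lambda>t. t / \<delta> - real k + 1) has_real_derivative 1 / \<delta>) (at t)" "((\<lambda>t. t / \<delta> - real k) has_real_derivative 1 / \<delta>) (at t)"
        using \<delta>(1) by (auto intro!: derivative_eq_intros)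
      from DERIV_diff[OF this[THEN DERIV_chain2[OF DERIV_step]]] show ?thesis
        by (simp add: p_def[abs_def] diff_divide_distrib)
    qed
    have p_cont: "continuous_on UNIV (\<lambda>t. (step' (t / \<delta> - real k + 1) - step' (t / \<delta> - real k)) / \<delta>)" for k
      using \<delta>(1) by (intro continuous_intros continuous_on_compose2[OF continuous_step'[of UNIV]]) auto
    note cut = cutoff_mult[OF \<theta>(1) p_deriv p_cont]
    have frozen_int: "integrable spacetime (I (\<lambda>t. \<theta> t * p k t) (\<lambda>t. d (real k * \<delta>)))" for k
      using joint_Ck_imp_Ck_torus[OF d] by (intro I_int[OF _ cut]) (simp add: Ck_torus_iff_joint_Ck)
    have "integral\<^sup>L spacetime (I \<theta> d)
        = integral\<^sup>L spacetime (I \<theta> d) - (\<Sum>k<N. integral\<^sup>L spacetime (I (\<lambda>t. \<theta> t * p k t) (\<lambda>t. d (real k * \<delta>))))"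
      using frozen[OF cut] by simp
    also have "\<dots> = (\<integral>z. I \<theta> d z - (\<Sum>k<N. I (\<lambda>t. \<theta> t * p k t) (\<lambda>t. d (real k * \<delta>)) z) \<partial>spacetime)"
      using frozen_int I_int[OF d \<theta>(1)] by simp
    also have "norm \<dots> \<le> (\<integral>z. e * H z \<partial>spacetime)"
    proof (rule Bochner_Integration.integral_norm_bound_integral)
      fix z :: "real \<times> (real^'n)" assume "z \<in> space spacetime"
      obtain t x where z: "z = (t, x)" by (cases z)
      show "norm (I \<theta> d z - (\<Sum>k<N. I (\<lambda>t. \<theta> t * p k t) (\<lambda>t. d (real k * \<delta>)) z)) \<le> e * H z"
      proof (cases "t \<in> {a..b}")
        case False
        then have "\<theta> t = 0" by (rule cutoff_zero[OF \<theta>(1)])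
        then show ?thesis by (simp add: z I_def H_def)
      next
        case True
        define w where "w k = F t x \<bullet> (grad (d t) x - grad (d (real k * \<delta>)) x) + D t x * (d t x - d (real k * \<delta>) x)" for k
        have "I \<theta> d z = (\<Sum>k<N. p k t) * (\<theta> t * (F t x \<bullet> grad (d t) x) + \<theta> t * (D t x * d t x))"
          by (simp add: z I_def p_sum[OF True])
        then have "I \<theta> d z - (\<Sum>k<N. I (\<lambda>t. \<theta> t * p k t) (\<lambda>t. d (real k * \<delta>)) z)
            = (\<Sum>k<N. p k t * (\<theta> t * (F t x \<bullet> grad (d t) x) + \<theta> t * (D t x * d t x)) - I (\<lambda>t. \<theta> t * p k t) (\<lambda>t. d (real k * \<delta>)) z)"
          by (simp add: sum_distrib_right sum_subtractf)
        also have "\<dots> = (\<Sum>k<N. p k t * (\<theta> t * w k))"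
          by (intro sum.cong refl) (simp add: z I_def w_def inner_diff_right algebra_simps)
        also have "norm \<dots> \<le> (\<Sum>k<N. p k t * (e * H z))"
        proof (rule sum_norm_le)
          fix k
          show "norm (p k t * (\<theta> t * w k)) \<le> p k t * (e * H z)"
          proof (cases "p k t = 0")
            case False
            then have close: "\<bar>t - real k * \<delta>\<bar> < \<delta>" by (rule p_local)
            then have "t \<in> {a-1..b+1}" "real k * \<delta> \<in> {a-1..b+1}" using True \<delta>(2) by (auto simp: abs_less_iff)
            then have g: "norm (grad (d t) x - grad (d (real k * \<delta>)) x) \<le> e" "norm (d t x - d (real k * \<delta>) x) \<le> e"
              using r1(2) r2(2) close \<delta>(3,4) by (meson less_imp_le less_le_trans)+
            have "\<bar>w k\<bar> \<le> \<bar>F t x \<bullet> (grad (d t) x - grad (d (real k * \<delta>)) x)\<bar> + \<bar>D t x * (d t x - d (real k * \<delta>) x)\<bar>"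
              unfolding w_def by (rule abs_triangle_ineq)
            also have "\<dots> \<le> norm (F t x) * e + norm (D t x) * e"
              unfolding abs_mult
              using order_trans[OF Cauchy_Schwarz_ineq2 mult_left_mono[OF g(1) norm_ge_zero]] mult_left_mono[OF g(2) abs_ge_zero[of "D t x"]]
              by (intro add_mono) auto
            finally have "\<bar>w k\<bar> \<le> norm (F t x) * e + norm (D t x) * e" .
            then have "\<bar>\<theta> t\<bar> * \<bar>w k\<bar> \<le> \<bar>\<theta> t\<bar> * (norm (F t x) * e + norm (D t x) * e)" by (rule mult_left_mono) simp
            also have "\<dots> = e * H z" by (simp add: z H_def algebra_simps)
            finally show ?thesis using p_nonneg[of k t] by (simp add: abs_mult mult_left_mono)
          qed simp
        qed
        also have "\<dots> = e * H z" by (simp add: sum_distrib_right[symmetric] p_sum[OF True])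
        finally show ?thesis .
      qed
    qed (use frozen_int I_int[OF d \<theta>(1)] H_int in auto)
    finally show ?thesis using H_int by simp
  qed
  have "\<bar>integral\<^sup>L spacetime (I \<theta> d)\<bar> \<le> e" if e: "e > 0" for e
  proof -
    have Hn: "0 \<le> integral\<^sup>L spacetime H" by (intro Bochner_Integration.integral_nonneg) (auto simp: H_def)
    have "\<bar>integral\<^sup>L spacetime (I \<theta> d)\<bar> \<le> e / (integral\<^sup>L spacetime H + 1) * integral\<^sup>L spacetime H"
      by (rule bound) (use e Hn in auto)
    also have "\<dots> \<le> e" using e Hn by (simp add: field_simps)
    finally show ?thesis .
  qed
  then have "integral\<^sup>L spacetime (I \<theta> d) = 0" by (metis abs_le_zero_iff field_le_epsilon add_0)
  then show ?thesis by (simp add: I_def)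
qed


section \<open>Smooth Euler flows\<close>

lemma jacobian_nth: "F differentiable (at x) \<Longrightarrow> jacobian F x $ i $ j = pd j F x $ i"
  using bounded_linear.pd_commute[OF bounded_linear_vec_nth] by (simp add: jacobian_def grad_def)

lemma joint_Ck_jacobian:
  fixes U :: "real \<Rightarrow> real^'n \<Rightarrow> real^'n"
  assumes "joint_Ck (Suc k) U"
  shows "joint_Ck k (\<lambda>t. jacobian (U t))"
proof -
  have "jacobian F x = (\<Sum>i\<in>UNIV. \<Sum>j\<in>UNIV. pd j (\<lambda>y. F y $ i) x *\<^sub>R axis i (axis j 1))" for F :: "real^'n \<Rightarrow> real^'n" and x
  proof -
    have "(\<Sum>i\<in>UNIV. \<Sum>j\<in>UNIV. pd j (\<lambda>y. F y $ i) x *\<^sub>R axis i (axis j 1)) $ a $ b = jacobian F x $ a $ b" for a b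
    proof -
      have "(c *\<^sub>R axis i (axis j 1)) $ a $ b = (if j = b then if i = a then c else 0 else 0)" for c i j
        by (simp add: axis_def)
      then show ?thesis by (simp only: sum_component) (simp add: jacobian_def grad_def)
    qed
    then show ?thesis unfolding vec_eq_iff by metis
  qed
  then have "(\<lambda>t. jacobian (U t)) = (\<lambda>t x. \<Sum>i\<in>UNIV. \<Sum>j\<in>UNIV. pd j (\<lambda>y. U t y $ i) x *\<^sub>R axis i (axis j 1))"
    by auto
  then show ?thesis
    using joint_Ck_pd[OF joint_Ck_nth[OF assms]]
    by (auto intro!: joint_Ck_sum joint_Ck_scaleR joint_Ck_time)
qed

lemma joint_Ck_dvg:
  fixes U :: "real \<Rightarrow> real^'n \<Rightarrow> real^'n"
  assumes "joint_Ck (Suc k) U"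
  shows "joint_Ck k (\<lambda>t. dvg (U t))"
  unfolding dvg_def[abs_def] by (intro joint_Ck_sum joint_Ck_pd joint_Ck_nth assms) simp

lemma dvg_scaleR:
  assumes f: "f differentiable (at x)" and V: "V differentiable (at x)"
  shows "dvg (\<lambda>y. f y *\<^sub>R V y) x = V x \<bullet> grad f x + f x * dvg V x"
proof -
  have "(\<lambda>y. V y $ j) differentiable (at x)" for j
    using bounded_linear.has_derivative[OF bounded_linear_vec_nth pd_has_derivative[OF V]] differentiableI by blast
  then have "pd j (\<lambda>y. f y * V y $ j) x = f x * pd j (\<lambda>y. V y $ j) x + pd j f x * V x $ j" for j
    by (rule bounded_bilinear.pd_product[OF bounded_bilinear_mult f])
  then show ?thesis
    by (simp add: dvg_def sum.distrib sum_distrib_left inner_vec_def grad_def mult_ac)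
qed

lemma inner_outer: "outer v w \<bullet> A = (\<Sum>i\<in>UNIV. \<Sum>j\<in>UNIV. v $ i * w $ j * A $ i $ j)"
  by (simp add: outer_def inner_vec_def)

lemma inner_mat_1_jacobian: "mat 1 \<bullet> jacobian F x = dvg F x"
proof -
  have "mat 1 \<bullet> jacobian F x = (\<Sum>i\<in>UNIV. \<Sum>j\<in>UNIV. if j = i then jacobian F x $ i $ j else 0)"
    unfolding inner_vec_def[of "mat 1"] inner_vec_def[of "mat 1 $ _"]
    by (intro sum.cong refl) (auto simp: mat_def)
  then show ?thesis by (simp add: dvg_def jacobian_def grad_def)
qed

lemma outer_diff_scaled:
  "outer (m - r *\<^sub>R U) (m - r *\<^sub>R U) \<bullet> A
     = outer m m \<bullet> A - r * (outer m U \<bullet> A) - r * (outer U m \<bullet> A) + r\<^sup>2 * (outer U U \<bullet> A)"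
  unfolding inner_outer
  by (simp add: sum_distrib_left sum_subtractf[symmetric] sum.distrib[symmetric] algebra_simps power2_eq_square)

lemma norm_outer: "norm (outer v w) = norm v * norm w"
proof -
  have "(norm (outer v w))\<^sup>2 = (norm v * norm w)\<^sup>2"
    by (simp add: power2_norm_eq_inner power_mult_distrib inner_vec_def outer_def sum_product algebra_simps)
  then show ?thesis by simp
qed

lemma abs_outer_inner_le: "\<bar>outer v v \<bullet> A\<bar> \<le> (norm v)\<^sup>2 * norm A"
  using Cauchy_Schwarz_ineq2[of "outer v v" A] by (simp add: norm_outer power2_eq_square)

text \<open>The time derivatives of density and velocity in terms of spatial derivatives. Since
  \<open>h(r) = r\<^sup>\<gamma>\<close>, the gradient of \<open>h'(R)\<close> is \<open>\<gamma> (\<gamma> - 1) R\<^sup>\<gamma>\<^sup>-\<^sup>2 \<nabla>R\<close>.\<close>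

definition density_rate :: "(real \<Rightarrow> real^'n \<Rightarrow> real) \<Rightarrow> (real \<Rightarrow> real^'n \<Rightarrow> real^'n) \<Rightarrow> real \<Rightarrow> real^'n \<Rightarrow> real" where
  "density_rate R U t x = - (U t x \<bullet> grad (R t) x) - R t x * dvg (U t) x"

definition velocity_rate :: "real \<Rightarrow> (real \<Rightarrow> real^'n \<Rightarrow> real) \<Rightarrow> (real \<Rightarrow> real^'n \<Rightarrow> real^'n) \<Rightarrow> real \<Rightarrow> real^'n \<Rightarrow> real^'n" where
  "velocity_rate \<gamma> R U t x =
     - (\<Sum>j\<in>UNIV. U t x $ j *\<^sub>R pd j (U t) x) - (\<gamma> * (\<gamma> - 1) * R t x powr (\<gamma> - 2)) *\<^sub>R grad (R t) x"

text \<open>The fields are defined for all times, but the equations hold on \<open>(0,T)\<close> only: a solution on \<open>[0,T]\<close>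
  is frozen at the end points.\<close>

locale euler_flow =
  fixes T \<gamma> :: real and R :: "real \<Rightarrow> real^'n \<Rightarrow> real" and U :: "real \<Rightarrow> real^'n \<Rightarrow> real^'n"
  assumes T: "T > 0" and \<gamma>: "\<gamma> > 1" and R_pos: "\<And>t x. R t x > 0"
    and R_reg: "joint_Ck 2 R" and U_reg: "joint_Ck 2 U"
    and R_deriv: "\<And>t x. t \<in> {0<..<T} \<Longrightarrow> ((\<lambda>s. R s x) has_real_derivative density_rate R U t x) (at t)"
    and U_deriv: "\<And>t x. t \<in> {0<..<T} \<Longrightarrow> ((\<lambda>s. U s x) has_vector_derivative velocity_rate \<gamma> R U t x) (at t)"
begin

text \<open>The test function for the mass equation, \<open>|U|\<^sup>2/2 - h'(R)\<close>, is the coefficient of \<open>r\<close> in the relative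
  energy.\<close>

definition multiplier :: "real \<Rightarrow> real^'n \<Rightarrow> real" where
  "multiplier t x = (U t x \<bullet> U t x) / 2 - \<gamma> * R t x powr (\<gamma> - 1)"

definition multiplier_rate :: "real \<Rightarrow> real^'n \<Rightarrow> real" where
  "multiplier_rate t x =
     U t x \<bullet> velocity_rate \<gamma> R U t x - \<gamma> * (\<gamma> - 1) * R t x powr (\<gamma> - 2) * density_rate R U t x"

definition bg_pressure :: "real \<Rightarrow> real^'n \<Rightarrow> real" where
  "bg_pressure t x = (\<gamma> - 1) * R t x powr \<gamma>"

definition bg_pressure_rate :: "real \<Rightarrow> real^'n \<Rightarrow> real" where
  "bg_pressure_rate t x = \<gamma> * (\<gamma> - 1) * R t x powr (\<gamma> - 1) * density_rate R U t x"

lemma R_diff: "R t differentiable (at x)" and U_diff: "U t differentiable (at x)"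
  using R_reg U_reg by (auto simp: numeral_2_eq_2)

lemma R_reg1: "joint_Ck 1 R" and U_reg1: "joint_Ck 1 U"
  using joint_Ck_mono[OF _ R_reg, of 1] joint_Ck_mono[OF _ U_reg, of 1] by auto

lemma grad_R_reg: "joint_Ck 1 (\<lambda>t. grad (R t))"
  using joint_Ck_grad[of 1 R] R_reg by (simp del: joint_Ck.simps add: numeral_2_eq_2)

lemma dvg_U_reg: "joint_Ck 1 (\<lambda>t. dvg (U t))"
  using joint_Ck_dvg[of 1 U] U_reg by (simp del: joint_Ck.simps add: numeral_2_eq_2)

lemma jacobian_U_reg: "joint_Ck 1 (\<lambda>t. jacobian (U t))"
  using joint_Ck_jacobian[of 1 U] U_reg by (simp del: joint_Ck.simps add: numeral_2_eq_2)

lemma pd_U_reg: "joint_Ck 1 (\<lambda>t. pd j (U t))"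
  using joint_Ck_pd[of 1 U j] U_reg by (simp del: joint_Ck.simps add: numeral_2_eq_2)

lemma density_rate_reg: "joint_Ck 1 (density_rate R U)"
  unfolding density_rate_def[abs_def]
  by (intro joint_Ck_diff joint_Ck_uminus joint_Ck_inner joint_Ck_mult R_reg1 U_reg1 grad_R_reg dvg_U_reg)

lemma R_powr_reg: "joint_Ck 1 (\<lambda>t x. c * R t x powr a)"
  using joint_Ck_cmult[OF joint_Ck_powr[OF R_pos R_reg1]] by simp

lemma R_powr_reg2: "joint_Ck 2 (\<lambda>t x. c * R t x powr a)"
  using joint_Ck_cmult[OF joint_Ck_powr[OF R_pos R_reg]] by simp

lemma velocity_rate_reg: "joint_Ck 1 (velocity_rate \<gamma> R U)"
  unfolding velocity_rate_def[abs_def]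
  by (intro joint_Ck_diff joint_Ck_uminus joint_Ck_sum joint_Ck_scaleR joint_Ck_nth R_powr_reg U_reg1 grad_R_reg pd_U_reg) simp

lemma multiplier_reg: "joint_Ck 2 multiplier"
  using joint_Ck_diff[OF joint_Ck_cmult[OF joint_Ck_inner[OF U_reg U_reg], of "1/2"] R_powr_reg2[of \<gamma> "\<gamma> - 1"]]
  by (simp add: multiplier_def[abs_def])

lemma multiplier_reg1: "joint_Ck 1 multiplier"
  by (rule joint_Ck_mono[OF _ multiplier_reg]) simp

lemma multiplier_rate_reg: "joint_Ck 1 multiplier_rate"
  unfolding multiplier_rate_def[abs_def]
  by (intro joint_Ck_diff joint_Ck_inner joint_Ck_mult[OF R_powr_reg] U_reg1 velocity_rate_reg density_rate_reg)

lemma bg_pressure_reg: "joint_Ck 1 bg_pressure"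
  unfolding bg_pressure_def[abs_def] by (rule R_powr_reg)

lemma bg_pressure_rate_reg: "joint_Ck 1 bg_pressure_rate"
  unfolding bg_pressure_rate_def[abs_def] by (intro joint_Ck_mult[OF R_powr_reg] density_rate_reg)

lemma R_powr_deriv:
  assumes "t \<in> {0<..<T}"
  shows "((\<lambda>s. c * R s x powr a) has_real_derivative c * a * R t x powr (a - 1) * density_rate R U t x) (at t)"
proof -
  have "((\<lambda>r. r powr a) has_real_derivative a * R t x powr (a - 1)) (at (R t x))"
    using R_pos[of t x] by (auto intro!: derivative_eq_intros)
  from DERIV_cmult[OF DERIV_chain2[OF this R_deriv[OF assms]], of c] show ?thesis by (simp add: mult_ac)
qed

lemma bg_pressure_deriv:
  "t \<in> {0<..<T} \<Longrightarrow> ((\<lambda>s. bg_pressure s x) has_real_derivative bg_pressure_rate t x) (at t)"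
  using R_powr_deriv[of t "\<gamma> - 1" x \<gamma>] by (simp add: bg_pressure_def[abs_def] bg_pressure_rate_def mult_ac)

lemma multiplier_deriv:
  assumes t: "t \<in> {0<..<T}"
  shows "((\<lambda>s. multiplier s x) has_real_derivative multiplier_rate t x) (at t)"
proof -
  have "((\<lambda>s. U s x \<bullet> U s x) has_vector_derivative U t x \<bullet> velocity_rate \<gamma> R U t x + velocity_rate \<gamma> R U t x \<bullet> U t x) (at t)"
    by (rule bounded_bilinear.has_vector_derivative[OF bounded_bilinear_inner U_deriv[OF t] U_deriv[OF t]])
  then have "((\<lambda>s. U s x \<bullet> U s x) has_real_derivative 2 * (U t x \<bullet> velocity_rate \<gamma> R U t x)) (at t)"
    by (simp add: has_real_derivative_iff_has_vector_derivative inner_commute)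
  from DERIV_diff[OF DERIV_cdivide[OF this, of 2] R_powr_deriv[OF t, of \<gamma> x "\<gamma> - 1"]]
  show ?thesis by (simp add: multiplier_def[abs_def] multiplier_rate_def)
qed

lemma grad_R_powr:
  "pd j (\<lambda>y. c * R t y powr a) x = c * a * R t x powr (a - 1) * pd j (R t) x"
proof -
  have "((\<lambda>r. c * r powr a) has_real_derivative c * a * R t x powr (a - 1)) (at (R t x))"
    using R_pos[of t x] by (auto intro!: derivative_eq_intros)
  from pd_real_compose(2)[OF R_diff this] show ?thesis .
qed

lemma inner_grad_multiplier:
  "m \<bullet> grad (multiplier t) x = outer (U t x) m \<bullet> jacobian (U t) x
     - \<gamma> * (\<gamma> - 1) * R t x powr (\<gamma> - 2) * (m \<bullet> grad (R t) x)"
proof -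
  have d1: "(\<lambda>y. (1/2) *\<^sub>R (U t y \<bullet> U t y)) differentiable (at x)"
    using joint_Ck_differentiable[of 0, OF joint_Ck_cmult[OF joint_Ck_inner[OF U_reg1[unfolded One_nat_def] U_reg1[unfolded One_nat_def]], of "1/2"]] .
  have d2: "(\<lambda>y. \<gamma> * R t y powr (\<gamma> - 1)) differentiable (at x)"
    using joint_Ck_differentiable[of 0, OF R_powr_reg[unfolded One_nat_def]] .
  have d3: "(\<lambda>y. U t y \<bullet> U t y) differentiable (at x)"
    using joint_Ck_differentiable[of 0, OF joint_Ck_inner[OF U_reg1[unfolded One_nat_def] U_reg1[unfolded One_nat_def]]] .
  have "pd j (multiplier t) x = U t x \<bullet> pd j (U t) x - \<gamma> * (\<gamma> - 1) * R t x powr (\<gamma> - 2) * pd j (R t) x" for j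
  proof -
    have "pd j (multiplier t) x = pd j (\<lambda>y. (1/2) *\<^sub>R (U t y \<bullet> U t y) - \<gamma> * R t y powr (\<gamma> - 1)) x"
      by (simp add: multiplier_def[abs_def])
    also have "\<dots> = (1/2) *\<^sub>R (U t x \<bullet> pd j (U t) x + pd j (U t) x \<bullet> U t x) - \<gamma> * (\<gamma> - 1) * R t x powr (\<gamma> - 2) * pd j (R t) x"
      unfolding pd_diff[OF d1 d2] grad_R_powr bounded_linear.pd_commute[OF bounded_linear_scaleR_right d3]
        bounded_bilinear.pd_product[OF bounded_bilinear_inner U_diff U_diff] by simp
    finally show ?thesis by (simp add: inner_commute)
  qed
  then have "m \<bullet> grad (multiplier t) x
      = (\<Sum>j\<in>UNIV. m $ j * (\<Sum>i\<in>UNIV. U t x $ i * pd j (U t) x $ i))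
        - \<gamma> * (\<gamma> - 1) * R t x powr (\<gamma> - 2) * (m \<bullet> grad (R t) x)"
    by (simp add: inner_vec_def[of m] grad_def right_diff_distrib sum_subtractf sum_distrib_left mult_ac inner_vec_def[of "U t x"])
  also have "(\<Sum>j\<in>UNIV. m $ j * (\<Sum>i\<in>UNIV. U t x $ i * pd j (U t) x $ i)) = outer (U t x) m \<bullet> jacobian (U t) x"
    unfolding inner_outer sum_distrib_left
    by (subst sum.swap) (simp add: jacobian_nth[OF U_diff] mult_ac)
  finally show ?thesis .
qed

lemma inner_velocity_rate:
  "m \<bullet> velocity_rate \<gamma> R U t x = - (outer m (U t x) \<bullet> jacobian (U t) x)
     - \<gamma> * (\<gamma> - 1) * R t x powr (\<gamma> - 2) * (m \<bullet> grad (R t) x)"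
proof -
  have "m \<bullet> (\<Sum>j\<in>UNIV. U t x $ j *\<^sub>R pd j (U t) x) = outer m (U t x) \<bullet> jacobian (U t) x"
    unfolding inner_outer inner_sum_right inner_scaleR_right inner_vec_def[of m] sum_distrib_left
    by (subst sum.swap) (simp add: jacobian_nth[OF U_diff] mult_ac)
  then show ?thesis by (simp add: velocity_rate_def inner_diff_right)
qed

lemma dvg_bg_pressure_flux:
  "dvg (\<lambda>y. bg_pressure t y *\<^sub>R U t y) x
     = \<gamma> * (\<gamma> - 1) * R t x powr (\<gamma> - 1) * (U t x \<bullet> grad (R t) x) + bg_pressure t x * dvg (U t) x"
proof -
  have "grad (bg_pressure t) x = (\<gamma> * (\<gamma> - 1) * R t x powr (\<gamma> - 1)) *\<^sub>R grad (R t) x"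
    by (simp add: grad_def vec_eq_iff bg_pressure_def[abs_def] grad_R_powr)
  then show ?thesis
    using dvg_scaleR[OF joint_Ck_differentiable[of 0, OF bg_pressure_reg[unfolded One_nat_def]] U_diff]
    by simp
qed

lemma integral_dvg_bg_pressure_flux: "(\<integral>x. dvg (\<lambda>y. bg_pressure t y *\<^sub>R U t y) x \<partial>torus) = 0"
proof -
  have j: "joint_Ck 1 (\<lambda>t y. bg_pressure t y * U t y $ j)" for j
    by (intro joint_Ck_mult bg_pressure_reg joint_Ck_nth U_reg1)
  have "(\<integral>x. (\<Sum>j\<in>UNIV. pd j (\<lambda>y. bg_pressure t y * U t y $ j) x) \<partial>torus)
      = (\<Sum>j\<in>UNIV. \<integral>x. pd j (\<lambda>y. bg_pressure t y * U t y $ j) x \<partial>torus)"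
    using joint_Ck_integrable_torus[OF joint_Ck_pd[OF j[unfolded One_nat_def]]]
    by (intro Bochner_Integration.integral_sum) auto
  also have "\<dots> = 0" using integral_torus_pd[OF joint_Ck_imp_Ck_torus[OF j]] by simp
  finally show ?thesis by (simp add: dvg_def)
qed

end


section \<open>The relative energy inequality\<close>

definition localized :: "(real \<Rightarrow> real) \<Rightarrow> (real \<Rightarrow> real^'n \<Rightarrow> 'b::euclidean_space) \<Rightarrow> (real \<Rightarrow> real^'n \<Rightarrow> 'b) \<Rightarrow> real \<times> (real^'n) \<Rightarrow> real" where
  "localized \<xi> f g = (\<lambda>(t,x). \<xi> t * (f t x \<bullet> g t x))"

definition st_pair :: "(real \<Rightarrow> real) \<Rightarrow> (real \<Rightarrow> real^'n \<Rightarrow> 'b::euclidean_space) \<Rightarrow> (real \<Rightarrow> real^'n \<Rightarrow> 'b) \<Rightarrow> real" where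
  "st_pair \<xi> f g = integral\<^sup>L spacetime (localized \<xi> f g)"

lemma st_pair_has_integral:
  fixes f g :: "real \<Rightarrow> real^'n \<Rightarrow> 'b::euclidean_space"
  assumes "L1loc f" "joint_Ck k g" "continuous_on UNIV \<xi>" "\<And>t. t \<notin> {a..b} \<Longrightarrow> \<xi> t = 0" "0 < a"
  shows "has_bochner_integral spacetime (localized \<xi> f g) (st_pair \<xi> f g)"
  unfolding st_pair_def localized_def
  by (rule has_bochner_integral_integrable[OF L1loc_cutoff_integrable[OF assms]])

lemma jacobian_scaleR:
  assumes "\<And>x. F differentiable (at x)"
  shows "jacobian (\<lambda>x. c *\<^sub>R F x) x = c *\<^sub>R jacobian F x"
proof -
  have "(\<lambda>y. F y $ i) differentiable (at x)" for i x
    using bounded_linear.has_derivative[OF bounded_linear_vec_nth pd_has_derivative[OF assms]] differentiableI by blast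
  from grad_scaleR[OF this] show ?thesis
    by (simp add: jacobian_def vec_eq_iff)
qed

context euler_flow begin

text \<open>The relative energy density, capillary energy included, in a form that is affine in \<open>E\<close>, \<open>m\<close> and \<open>r\<close>,
  the quantities whose evolution the weak formulation controls.\<close>

definition rel_density :: "(real \<Rightarrow> real^'n \<Rightarrow> real) \<Rightarrow> (real \<Rightarrow> real^'n \<Rightarrow> real) \<Rightarrow> (real \<Rightarrow> real^'n \<Rightarrow> real^'n) \<Rightarrow> real \<Rightarrow> real^'n \<Rightarrow> real" where
  "rel_density E r m t x = E t x - m t x \<bullet> U t x + r t x * multiplier t x + bg_pressure t x"

text \<open>\<open>MM\<close> and \<open>S\<close> stand for the convective flux and the stress, and \<open>D\<close> for the divergence of \<open>F\<close>. The last
  two lines vanish when integrated over space-time against a cutoff; they complete the other terms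
  to quadratic expressions.\<close>

definition production where
  "production \<epsilon> r m MM S F D t x =
     - (m t x \<bullet> velocity_rate \<gamma> R U t x) - MM t x \<bullet> jacobian (U t) x + S t x \<bullet> jacobian (U t) x
     + r t x * multiplier_rate t x + m t x \<bullet> grad (multiplier t) x + bg_pressure_rate t x
     + dvg (\<lambda>y. bg_pressure t y *\<^sub>R U t y) x
     - \<epsilon> * (F t x \<bullet> grad (dvg (U t)) x + D t x * dvg (U t) x)"

lemma rel_density_integrable:
  assumes "CL1 E" "CL1 r" "CL1 m" "0 \<le> t"
  shows "integrable torus (rel_density E r m t)"
    and "(\<integral>x. rel_density E r m t x \<partial>torus) = (\<integral>x. E t x \<bullet> 1 \<partial>torus) - (\<integral>x. m t x \<bullet> U t x \<partial>torus)
      + (\<integral>x. r t x \<bullet> multiplier t x \<partial>torus) + (\<integral>x. bg_pressure t x \<bullet> 1 \<partial>torus)"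
proof -
  have i: "integrable torus (\<lambda>x. m t x \<bullet> U t x)" "integrable torus (\<lambda>x. r t x * multiplier t x)"
    "integrable torus (E t)" "integrable torus (bg_pressure t)"
    using CL1_inner_integrable[OF assms(3) U_reg assms(4)] CL1_inner_integrable[OF assms(2) multiplier_reg assms(4)]
      CL1_integrable[OF assms(1,4)] joint_Ck_integrable_torus[OF bg_pressure_reg] by auto
  show "integrable torus (rel_density E r m t)"
    unfolding rel_density_def[abs_def] by (intro Bochner_Integration.integrable_add Bochner_Integration.integrable_diff i)
  show "(\<integral>x. rel_density E r m t x \<partial>torus) = (\<integral>x. E t x \<bullet> 1 \<partial>torus) - (\<integral>x. m t x \<bullet> U t x \<partial>torus)
      + (\<integral>x. r t x \<bullet> multiplier t x \<partial>torus) + (\<integral>x. bg_pressure t x \<bullet> 1 \<partial>torus)"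
    unfolding rel_density_def using i by simp
qed

lemma rel_density_continuous:
  assumes "CL1 E" "CL1 r" "CL1 m"
  shows "continuous_on {0..} (\<lambda>t. \<integral>x. rel_density E r m t x \<partial>torus)"
proof -
  have one: "joint_Ck 0 (\<lambda>t (x :: real^'n). 1 :: real)" by (intro joint_Ck_time continuous_intros)
  have "continuous_on {0..} (\<lambda>t. (\<integral>x. E t x \<bullet> 1 \<partial>torus) - (\<integral>x. m t x \<bullet> U t x \<partial>torus)
      + (\<integral>x. r t x \<bullet> multiplier t x \<partial>torus) + (\<integral>x. bg_pressure t x \<bullet> 1 \<partial>torus))"
    by (intro continuous_on_add continuous_on_diff CL1_inner_continuous[OF assms(1) one]
        CL1_inner_continuous[OF assms(3) U_reg] CL1_inner_continuous[OF assms(2) multiplier_reg]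
        CL1_inner_continuous[OF joint_Ck_imp_CL1[OF bg_pressure_reg] one])
  then show ?thesis
    by (rule continuous_on_eq) (use rel_density_integrable(2)[OF assms] in simp)
qed

lemma rel_density_st_pair:
  assumes "CL1 E" "CL1 r" "CL1 m" and \<xi>: "continuous_on UNIV \<xi>" "\<And>t. t \<notin> {a..b} \<Longrightarrow> \<xi> t = 0" "0 < a"
  shows "has_bochner_integral spacetime (\<lambda>p. \<xi> (fst p) * rel_density E r m (fst p) (snd p))
     (st_pair \<xi> E (\<lambda>t x. 1) - st_pair \<xi> m U + st_pair \<xi> r multiplier + st_pair \<xi> bg_pressure (\<lambda>t x. 1))" (is "has_bochner_integral _ _ ?total")
proof (rule has_bochner_integral_cong[OF refl _ refl, THEN iffD1])
  have one: "joint_Ck 0 (\<lambda>t (x :: real^'n). 1 :: real)" by (intro joint_Ck_time continuous_intros)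
  note I = st_pair_has_integral[OF _ _ \<xi>]
  show "has_bochner_integral spacetime (\<lambda>p.
      localized \<xi> E (\<lambda>t x. 1) p - localized \<xi> m U p
      + localized \<xi> r multiplier p
      + localized \<xi> bg_pressure (\<lambda>t x. 1) p)
    ?total"
    by (intro has_bochner_integral_add has_bochner_integral_diff I[OF CL1_imp_L1loc[OF assms(1)] one]
        I[OF CL1_imp_L1loc[OF assms(3)] U_reg] I[OF CL1_imp_L1loc[OF assms(2)] multiplier_reg]
        I[OF CL1_imp_L1loc[OF joint_Ck_imp_CL1[OF bg_pressure_reg]] one])
qed (simp add: localized_def case_prod_unfold rel_density_def algebra_simps)

lemma rel_density_cutoff_integral:
  assumes "CL1 E" "CL1 r" "CL1 m" and \<xi>: "continuous_on UNIV \<xi>" "\<And>t. t \<notin> {a..b} \<Longrightarrow> \<xi> t = 0" "0 < a"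
  shows "(\<integral>t. \<xi> t * (\<integral>x. rel_density E r m t x \<partial>torus) \<partial>lborel)
    = (\<integral>p. \<xi> (fst p) * rel_density E r m (fst p) (snd p) \<partial>spacetime)"
proof -
  have "(\<integral>t. \<xi> t * (\<integral>x. rel_density E r m t x \<partial>torus) \<partial>lborel)
      = (\<integral>t. \<xi> t * (\<integral>x. rel_density E r m t x \<partial>torus) \<partial>halfline)"
    by (rule halfline_integral[symmetric, of a b]) (use \<xi> in auto)
  also have "\<dots> = (\<integral>p. \<xi> (fst p) * rel_density E r m (fst p) (snd p) \<partial>spacetime)"
    using rel_density_st_pair[OF assms] by (subst integral_spacetime_iterated) (auto simp: has_bochner_integral_iff)
  finally show ?thesis .
qed

text \<open>The relative energy inequality in distributional form. The energy inequality is combined with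
  the weak mass and momentum equations tested by \<open>|U|\<^sup>2/2 - h'(R)\<close> and by the velocity \<open>U\<close>, each
  localized in time; the identities for the background pressure and for the capillary divergence are
  added to put the production terms into quadratic form.\<close>

lemma relative_energy_distributional:
  fixes r E D :: "real \<Rightarrow> real^'n \<Rightarrow> real" and m F :: "real \<Rightarrow> real^'n \<Rightarrow> real^'n" and MM S :: "real \<Rightarrow> real^'n \<Rightarrow> real^'n^'n"
  assumes r: "CL1 r" and m: "CL1 m" and E: "CL1 E" and MM: "L1loc MM" and S: "L1loc S" and wd: "weak_divergence F D"
    and mass: "\<And>\<psi>. test_fun \<psi> \<Longrightarrow> has_bochner_integral spacetime
        (\<lambda>(t,x). r t x * ddt \<psi> t x + m t x \<bullet> grad (\<psi> t) x) (- (\<integral>x. r 0 x * \<psi> 0 x \<partial>torus))"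
    and momentum: "\<And>\<phi>. test_fun \<phi> \<Longrightarrow> has_bochner_integral spacetime
        (\<lambda>(t,x). m t x \<bullet> ddt \<phi> t x + MM t x \<bullet> jacobian (\<phi> t) x - S t x \<bullet> jacobian (\<phi> t) x)
        (- (\<integral>x. m 0 x \<bullet> \<phi> 0 x \<partial>torus))"
    and diss: "\<And>\<theta> \<theta>'. energy_test_fun \<theta> \<theta>' \<Longrightarrow>
        - (\<integral>(t,x). E t x * \<theta>' t \<partial>spacetime) \<le> (\<integral>x. E 0 x * \<theta> 0 \<partial>torus)"
    and \<theta>: "cutoff \<theta> \<theta>' a b" "0 < a" "b < T" "\<And>t. 0 \<le> \<theta> t"
  shows "integrable spacetime (\<lambda>(t,x). \<theta> t * production \<epsilon> r m MM S F D t x)"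
    and "- (\<integral>t. \<theta>' t * (\<integral>x. rel_density E r m t x \<partial>torus) \<partial>lborel)
      \<le> (\<integral>(t,x). \<theta> t * production \<epsilon> r m MM S F D t x \<partial>spacetime)"
proof -
  define one :: "real \<Rightarrow> real^'n \<Rightarrow> real" where "one = (\<lambda>t x. 1)"
  define flux where "flux t x = dvg (\<lambda>y. bg_pressure t y *\<^sub>R U t y) x" for t x
  have one: "joint_Ck 0 one" unfolding one_def by (intro joint_Ck_time continuous_intros)
  have flux: "joint_Ck 0 flux"
    unfolding flux_def[abs_def]
    using joint_Ck_dvg[of 0, OF joint_Ck_scaleR[OF bg_pressure_reg[unfolded One_nat_def] U_reg1[unfolded One_nat_def]]] .
  have grad_mult: "joint_Ck 1 (\<lambda>t. grad (multiplier t))"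
    using joint_Ck_grad[of 1 multiplier] multiplier_reg by (simp del: joint_Ck.simps add: numeral_2_eq_2)
  have grad_dvg: "joint_Ck 0 (\<lambda>t. grad (dvg (U t)))"
    using joint_Ck_grad[of 0] dvg_U_reg by (simp del: joint_Ck.simps)
  have F: "L1loc F" and D: "L1loc D" using wd by (auto simp: weak_divergence_def)
  have in_T: "t \<in> {0<..<T}" if "t \<in> {a..b}" for t using that \<theta> by auto
  have \<theta>0: "\<theta> 0 = 0" using cutoff_zero[OF \<theta>(1), of 0] \<theta>(2) by simp
  note I = st_pair_has_integral[OF _ _ cutoff_continuous[OF \<theta>(1)] cutoff_zero[OF \<theta>(1)] \<theta>(2)]
  note I' = st_pair_has_integral[OF _ _ cutoff_continuous'[OF \<theta>(1)] cutoff_zero'[OF \<theta>(1)] \<theta>(2)]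
  note rL = CL1_imp_L1loc[OF r] and mL = CL1_imp_L1loc[OF m]
  note pL = CL1_imp_L1loc[OF joint_Ck_imp_CL1[OF bg_pressure_reg]]
  note pL' = CL1_imp_L1loc[OF joint_Ck_imp_CL1[OF bg_pressure_rate_reg]]
  note fL = CL1_imp_L1loc[OF joint_Ck_imp_CL1[OF flux]]

  have mult_deriv: "((\<lambda>s. multiplier s x) has_vector_derivative multiplier_rate t x) (at t)" if "t \<in> {a..b}" for t x
    using multiplier_deriv[OF in_T[OF that]] by (simp add: has_real_derivative_iff_has_vector_derivative)
  have tf: "interior_test_fun (\<lambda>t x. \<theta> t *\<^sub>R multiplier t x)"
    by (rule cutoff_test_fun(1)[OF \<theta>(1,2) multiplier_reg1 multiplier_rate_reg mult_deriv])
  have tf': "ddt (\<lambda>t x. \<theta> t *\<^sub>R multiplier t x) t x = \<theta>' t *\<^sub>R multiplier t x + \<theta> t *\<^sub>R multiplier_rate t x" for t x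
    by (rule cutoff_test_fun(2)[OF \<theta>(1,2) multiplier_reg1 multiplier_rate_reg mult_deriv])
  have mult_diff: "multiplier t differentiable (at x)" for t x
    using joint_Ck_differentiable[of 0, OF multiplier_reg1[unfolded One_nat_def]] .
  have "has_bochner_integral spacetime
      (\<lambda>(t,x). r t x * ddt (\<lambda>t x. \<theta> t *\<^sub>R multiplier t x) t x + m t x \<bullet> grad (\<lambda>x. \<theta> t *\<^sub>R multiplier t x) x) 0"
    using mass[of "\<lambda>t x. \<theta> t *\<^sub>R multiplier t x"] tf \<theta>0 by (simp add: interior_test_fun_def)
  then have "has_bochner_integral spacetime
      (\<lambda>p. localized \<theta>' r multiplier p
        + localized \<theta> r multiplier_rate p
        + localized \<theta> m (\<lambda>t. grad (multiplier t)) p) 0"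
    unfolding tf' grad_scaleR[OF mult_diff] by (simp add: localized_def case_prod_unfold algebra_simps)
  from has_bochner_integral_eq[OF this has_bochner_integral_add[OF has_bochner_integral_add[OF
      I'[OF rL multiplier_reg] I[OF rL multiplier_rate_reg]] I[OF mL grad_mult]]]
  have J1: "st_pair \<theta>' r multiplier + st_pair \<theta> r multiplier_rate + st_pair \<theta> m (\<lambda>t. grad (multiplier t)) = 0" by simp

  have U_deriv': "((\<lambda>s. U s x) has_vector_derivative velocity_rate \<gamma> R U t x) (at t)" if "t \<in> {a..b}" for t x
    using U_deriv[OF in_T[OF that]] .
  have tfU: "interior_test_fun (\<lambda>t x. \<theta> t *\<^sub>R U t x)"
    by (rule cutoff_test_fun(1)[OF \<theta>(1,2) U_reg1 velocity_rate_reg U_deriv'])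
  have tfU': "ddt (\<lambda>t x. \<theta> t *\<^sub>R U t x) t x = \<theta>' t *\<^sub>R U t x + \<theta> t *\<^sub>R velocity_rate \<gamma> R U t x" for t x
    by (rule cutoff_test_fun(2)[OF \<theta>(1,2) U_reg1 velocity_rate_reg U_deriv'])
  have "has_bochner_integral spacetime
      (\<lambda>(t,x). m t x \<bullet> ddt (\<lambda>t x. \<theta> t *\<^sub>R U t x) t x + MM t x \<bullet> jacobian (\<lambda>x. \<theta> t *\<^sub>R U t x) x
         - S t x \<bullet> jacobian (\<lambda>x. \<theta> t *\<^sub>R U t x) x) 0"
    using momentum[of "\<lambda>t x. \<theta> t *\<^sub>R U t x"] tfU \<theta>0 by (simp add: interior_test_fun_def)
  then have "has_bochner_integral spacetime
      (\<lambda>p. localized \<theta>' m U p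
        + localized \<theta> m (velocity_rate \<gamma> R U) p
        + localized \<theta> MM (\<lambda>t. jacobian (U t)) p
        - localized \<theta> S (\<lambda>t. jacobian (U t)) p) 0"
    unfolding tfU' jacobian_scaleR[OF U_diff] by (simp add: localized_def case_prod_unfold inner_add_right algebra_simps)
  from has_bochner_integral_eq[OF this has_bochner_integral_diff[OF has_bochner_integral_add[OF has_bochner_integral_add[OF
      I'[OF mL U_reg] I[OF mL velocity_rate_reg]] I[OF MM jacobian_U_reg]] I[OF S jacobian_U_reg]]]
  have J2: "st_pair \<theta>' m U + st_pair \<theta> m (velocity_rate \<gamma> R U) + st_pair \<theta> MM (\<lambda>t. jacobian (U t))
      - st_pair \<theta> S (\<lambda>t. jacobian (U t)) = 0" by simp

  have J3: "- st_pair \<theta>' E one \<le> 0"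
    using diss[OF cutoff_energy_test_fun[OF \<theta>(1,2,4)]] \<theta>0
    by (simp add: st_pair_def localized_def one_def case_prod_unfold mult.commute)

  have "(\<integral>(t,x). \<theta>' t * bg_pressure t x + \<theta> t * bg_pressure_rate t x \<partial>spacetime) = 0"
    by (rule spacetime_integral_time_derivative[OF \<theta>(1,2) bg_pressure_reg bg_pressure_rate_reg])
      (use bg_pressure_deriv in_T in blast)
  with has_bochner_integral_integral_eq[OF has_bochner_integral_add[OF I'[OF pL one] I[OF pL' one]]]
  have J4: "st_pair \<theta>' bg_pressure one + st_pair \<theta> bg_pressure_rate one = 0"
    by (simp add: localized_def one_def case_prod_unfold)

  have J5: "st_pair \<theta> flux one = 0"
    using CL1_cutoff_integral[OF joint_Ck_imp_CL1[OF flux] one cutoff_continuous[OF \<theta>(1)] cutoff_zero[OF \<theta>(1)] \<theta>(2)]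
      integral_dvg_bg_pressure_flux
    by (simp add: st_pair_def localized_def case_prod_unfold one_def flux_def)

  from has_bochner_integral_integral_eq[OF has_bochner_integral_add[OF I[OF F grad_dvg] I[OF D dvg_U_reg]]]
    weak_divergence_cutoff[OF wd dvg_U_reg \<theta>(1,2)]
  have J6: "st_pair \<theta> F (\<lambda>t. grad (dvg (U t))) + st_pair \<theta> D (\<lambda>t. dvg (U t)) = 0"
    by (simp add: localized_def case_prod_unfold)

  have "has_bochner_integral spacetime (\<lambda>p. \<theta> (fst p) * production \<epsilon> r m MM S F D (fst p) (snd p))
    (- st_pair \<theta> m (velocity_rate \<gamma> R U) - st_pair \<theta> MM (\<lambda>t. jacobian (U t)) + st_pair \<theta> S (\<lambda>t. jacobian (U t))
      + st_pair \<theta> r multiplier_rate + st_pair \<theta> m (\<lambda>t. grad (multiplier t)) + st_pair \<theta> bg_pressure_rate one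
      + st_pair \<theta> flux one - \<epsilon> * (st_pair \<theta> F (\<lambda>t. grad (dvg (U t))) + st_pair \<theta> D (\<lambda>t. dvg (U t))))" (is "has_bochner_integral _ _ ?total")
  proof (rule has_bochner_integral_cong[OF refl _ refl, THEN iffD1])
    show "has_bochner_integral spacetime (\<lambda>p.
        - localized \<theta> m (velocity_rate \<gamma> R U) p
        - localized \<theta> MM (\<lambda>t. jacobian (U t)) p
        + localized \<theta> S (\<lambda>t. jacobian (U t)) p
        + localized \<theta> r multiplier_rate p
        + localized \<theta> m (\<lambda>t. grad (multiplier t)) p
        + localized \<theta> bg_pressure_rate one p
        + localized \<theta> flux one p
        - \<epsilon> * (localized \<theta> F (\<lambda>t. grad (dvg (U t))) p
               + localized \<theta> D (\<lambda>t. dvg (U t)) p))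
      ?total"
      by (intro has_bochner_integral_add has_bochner_integral_diff has_bochner_integral_minus
          has_bochner_integral_mult_right I[OF mL velocity_rate_reg] I[OF MM jacobian_U_reg] I[OF S jacobian_U_reg]
          I[OF rL multiplier_rate_reg] I[OF mL grad_mult] I[OF pL' one] I[OF fL one] I[OF F grad_dvg] I[OF D dvg_U_reg])
  qed (simp add: localized_def case_prod_unfold production_def one_def flux_def algebra_simps)
  note prod = this
  then show "integrable spacetime (\<lambda>(t,x). \<theta> t * production \<epsilon> r m MM S F D t x)"
    by (auto simp: case_prod_unfold has_bochner_integral_iff)
  have e: "has_bochner_integral spacetime (\<lambda>p. \<theta>' (fst p) * rel_density E r m (fst p) (snd p))
     (st_pair \<theta>' E one - st_pair \<theta>' m U + st_pair \<theta>' r multiplier + st_pair \<theta>' bg_pressure one)"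
    unfolding one_def
    by (rule rel_density_st_pair[OF E r m cutoff_continuous'[OF \<theta>(1)] cutoff_zero'[OF \<theta>(1)] \<theta>(2)])
  have "(\<integral>t. \<theta>' t * (\<integral>x. rel_density E r m t x \<partial>torus) \<partial>lborel)
      = (\<integral>p. \<theta>' (fst p) * rel_density E r m (fst p) (snd p) \<partial>spacetime)"
    by (rule rel_density_cutoff_integral[OF E r m cutoff_continuous'[OF \<theta>(1)] cutoff_zero'[OF \<theta>(1)] \<theta>(2)])
  also have "\<dots> = st_pair \<theta>' E one - st_pair \<theta>' m U + st_pair \<theta>' r multiplier + st_pair \<theta>' bg_pressure one"
    using e by (rule has_bochner_integral_integral_eq)
  finally show "- (\<integral>t. \<theta>' t * (\<integral>x. rel_density E r m t x \<partial>torus) \<partial>lborel)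
      \<le> (\<integral>(t,x). \<theta> t * production \<epsilon> r m MM S F D t x \<partial>spacetime)"
    using J1 J2 J3 J4 J5 J6 has_bochner_integral_integral_eq[OF prod] by (simp add: case_prod_unfold)
qed

end


section \<open>Pointwise bounds on the production of relative energy\<close>

lemma relative_powr:
  assumes "R > 0"
  shows "relative (\<lambda>r. r powr \<gamma>) r R = r powr \<gamma> - R powr \<gamma> - \<gamma> * R powr (\<gamma> - 1) * (r - R)"
proof -
  have "deriv (\<lambda>r. r powr \<gamma>) R = \<gamma> * R powr (\<gamma> - 1)"
    using assms by (intro DERIV_imp_deriv) (auto intro!: derivative_eq_intros)
  then show ?thesis by (simp add: relative_def)
qed

lemma relative_powr_nonneg:
  assumes "\<gamma> > 1" "R > 0" "r \<ge> 0"
  shows "0 \<le> relative (\<lambda>r. r powr \<gamma>) r R"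
proof (cases "r = 0")
  case True
  have "R powr (\<gamma> - 1) * R = R powr \<gamma>" using assms(2) powr_mult_base[of R "\<gamma> - 1"] by (simp add: mult.commute)
  then have "relative (\<lambda>r. r powr \<gamma>) r R = (\<gamma> - 1) * R powr \<gamma>"
    using True by (simp add: relative_powr[OF assms(2)] algebra_simps)
  then show ?thesis using assms by simp
next
  case False
  have "\<gamma> * R powr (\<gamma> - 1) * (r - R) \<le> r powr \<gamma> - R powr \<gamma>"
  proof (rule convex_on_imp_above_tangent[of "{0<..}" "\<lambda>x. x powr \<gamma>"])
    show "convex_on {0<..} (\<lambda>x. x powr \<gamma>)" using assms by (intro powr_convex) auto
    show "((\<lambda>x. x powr \<gamma>) has_real_derivative \<gamma> * R powr (\<gamma> - 1)) (at R within {0<..})"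
      using assms by (auto intro!: derivative_eq_intros)
  qed (use assms False in \<open>auto simp: interior_open\<close>)
  then show ?thesis by (simp add: relative_powr[OF assms(2)])
qed

text \<open>The relative internal energy controls the internal energy up to a constant, uniformly as long as
  the background density stays below \<open>H\<close>: for large \<open>r\<close> the linear part of the relative energy is
  absorbed in half of \<open>r\<^sup>\<gamma>\<close>.\<close>

lemma powr_le_relative:
  assumes \<gamma>: "\<gamma> > 1" and H: "H > 0"
  shows "\<exists>A>0. \<forall>R r. 0 < R \<longrightarrow> R \<le> H \<longrightarrow> 0 \<le> r \<longrightarrow> r powr \<gamma> + r \<le> A * (relative (\<lambda>r. r powr \<gamma>) r R + 1)"
proof -
  \<comment> \<open>Above \<open>s\<close> the linear term \<open>h'(R) r\<close> is at most \<open>r\<^sup>\<gamma>/2\<close> for every \<open>R \<le> H\<close>.\<close>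
  define s where "s = (2 * \<gamma> * H powr (\<gamma> - 1)) powr (1 / (\<gamma> - 1))"
  define A where "A = 4 + 2 * s powr \<gamma> + 1"
  have s: "s > 0" "s powr (\<gamma> - 1) = 2 * \<gamma> * H powr (\<gamma> - 1)"
    using \<gamma> H by (auto simp: s_def powr_powr)
  have "r powr \<gamma> + r \<le> A * (relative (\<lambda>r. r powr \<gamma>) r R + 1)" if R: "0 < R" "R \<le> H" and r: "0 \<le> r" for R r
  proof -
    let ?rel = "relative (\<lambda>r. r powr \<gamma>) r R"
    have rel: "0 \<le> ?rel" by (rule relative_powr_nonneg[OF \<gamma> R(1) r])
    have "r powr \<gamma> \<le> 2 * ?rel + s powr \<gamma>"
    proof (cases "r \<le> s")
      case True
      then have "r powr \<gamma> \<le> s powr \<gamma>" using r \<gamma> by (intro powr_mono2) auto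
      then show ?thesis using rel by linarith
    next
      case False
      then have r0: "r > 0" "s < r" using s by auto
      have "R powr (\<gamma> - 1) \<le> H powr (\<gamma> - 1)" using R \<gamma> by (intro powr_mono2) auto
      then have "2 * \<gamma> * R powr (\<gamma> - 1) \<le> 2 * \<gamma> * H powr (\<gamma> - 1)" using \<gamma> by (intro mult_left_mono) auto
      also have "\<dots> \<le> r powr (\<gamma> - 1)"
        unfolding s(2)[symmetric] using s r0 \<gamma> by (intro powr_mono2) auto
      finally have "2 * \<gamma> * R powr (\<gamma> - 1) * r \<le> r powr (\<gamma> - 1) * r" using r0 by (intro mult_right_mono) auto
      moreover have "r powr (\<gamma> - 1) * r = r powr \<gamma>" using r0 powr_mult_base[of r "\<gamma> - 1"] by (simp add: mult.commute)
      moreover have "R powr (\<gamma> - 1) * R = R powr \<gamma>" using R powr_mult_base[of R "\<gamma> - 1"] by (simp add: mult.commute)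
      then have "?rel = r powr \<gamma> - \<gamma> * R powr (\<gamma> - 1) * r + (\<gamma> - 1) * R powr \<gamma>"
        by (simp add: relative_powr[OF R(1)] algebra_simps)
      moreover have "0 \<le> (\<gamma> - 1) * R powr \<gamma>" using \<gamma> by simp
      moreover have "0 \<le> s powr \<gamma>" by simp
      ultimately show ?thesis by linarith
    qed
    moreover have "r \<le> 1 + r powr \<gamma>"
    proof (cases "r \<le> 1")
      case False
      then have "r powr 1 \<le> r powr \<gamma>" using \<gamma> by (intro powr_mono) auto
      then show ?thesis using False by simp
    qed (use powr_ge_zero[of r \<gamma>] in linarith)
    ultimately have "r powr \<gamma> + r \<le> 4 * ?rel + 2 * s powr \<gamma> + 1" by linarith
    also have "\<dots> \<le> A * (?rel + 1)"
    proof -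
      have "0 \<le> (2 * s powr \<gamma> + 1) * ?rel" using rel by simp
      then show ?thesis by (simp add: A_def algebra_simps)
    qed
    finally show ?thesis .
  qed
  moreover have "A > 0" unfolding A_def using powr_ge_zero[of s \<gamma>] by linarith
  ultimately show ?thesis by blast
qed

lemma pressure_powr:
  assumes "\<gamma> > 1" "r \<ge> 0"
  shows "pressure (\<lambda>r. r powr \<gamma>) r = (\<gamma> - 1) * r powr \<gamma>"
proof (cases "r = 0")
  case False
  then have r: "r > 0" using assms by simp
  have "deriv (\<lambda>r. r powr \<gamma>) r = \<gamma> * r powr (\<gamma> - 1)"
    using r by (intro DERIV_imp_deriv) (auto intro!: derivative_eq_intros)
  moreover have "r powr (\<gamma> - 1) * r = r powr \<gamma>" using r powr_mult_base[of r "\<gamma> - 1"] by (simp add: mult.commute)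
  ultimately show ?thesis by (simp add: pressure_def algebra_simps)
qed (simp add: pressure_def)

context euler_flow begin

abbreviation pot :: "real \<Rightarrow> real" where "pot \<equiv> (\<lambda>r. r powr \<gamma>)"

abbreviation korteweg_production where
  "korteweg_production \<kappa> \<epsilon> r m G D \<equiv> production \<epsilon> r m (\<lambda>t x. (1 / r t x) *\<^sub>R outer (m t x) (m t x))
     (\<lambda>t x. stress pot \<kappa> \<epsilon> (r t x) (G t x) (D t x)) (\<lambda>t x. (r t x * off_vacuum \<kappa> (r t x)) *\<^sub>R G t x) D"

lemma R_powr_base:
  "R t x powr (\<gamma> - 1) = R t x powr (\<gamma> - 2) * R t x" "R t x powr \<gamma> = R t x powr (\<gamma> - 2) * (R t x)\<^sup>2"
  using powr_mult_base[of "R t x" "\<gamma> - 2"] powr_mult_base[of "R t x" "\<gamma> - 1"] R_pos[of t x]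
  by (auto simp: mult_ac power2_eq_square)

text \<open>Completing the square in \<open>m\<close> and using \<open>p(R) = R h'(R) - h(R)\<close>. On the vacuum set the kinetic terms
  vanish together with \<open>m\<close>.\<close>

lemma rel_density_eq:
  assumes r: "r t x \<ge> 0" "r t x = 0 \<Longrightarrow> m t x = 0" and E: "E t x = energy pot \<kappa> \<epsilon> (r t x) (m t x) g"
  shows "rel_density E r m t x = relative pot (r t x) (R t x)
     + (1/2) * ((norm (m t x - r t x *\<^sub>R U t x))\<^sup>2 / r t x) + \<epsilon> * off_vacuum \<kappa> (r t x) / 2 * (norm g)\<^sup>2"
proof -
  have kin: "(norm (m t x - r t x *\<^sub>R U t x))\<^sup>2 / r t x = (norm (m t x))\<^sup>2 / r t x - 2 * (m t x \<bullet> U t x) + r t x * (U t x \<bullet> U t x)"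
  proof (cases "r t x = 0")
    case False
    have "(norm (m t x - r t x *\<^sub>R U t x))\<^sup>2 = (norm (m t x))\<^sup>2 - 2 * r t x * (m t x \<bullet> U t x) + (r t x)\<^sup>2 * (U t x \<bullet> U t x)"
      unfolding power2_norm_eq_inner by (simp add: inner_diff_left inner_diff_right inner_commute power2_eq_square algebra_simps)
    then show ?thesis using False by (simp add: field_simps power2_eq_square)
  qed (use r(2) in simp)
  show ?thesis
    unfolding rel_density_def E energy_def multiplier_def bg_pressure_def relative_powr[OF R_pos] R_powr_base kin
    by (simp add: algebra_simps power2_eq_square)
qed

text \<open>All terms that are linear in the differences cancel by the Euler equations; what remains is
  quadratic in \<open>m - rU\<close>, a multiple of the relative internal energy, and capillary terms.\<close>

lemma production_eq:
  assumes r: "r t x \<ge> 0" "r t x = 0 \<Longrightarrow> m t x = 0"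
  shows "korteweg_production \<kappa> \<epsilon> r m G D t x
    = - (1 / r t x) * (outer (m t x - r t x *\<^sub>R U t x) (m t x - r t x *\<^sub>R U t x) \<bullet> jacobian (U t) x)
      - (\<gamma> - 1) * relative pot (r t x) (R t x) * dvg (U t) x
      - \<epsilon> * ((r t x * off_vacuum (deriv \<kappa>) (r t x) + off_vacuum \<kappa> (r t x)) / 2) * (norm (G t x))\<^sup>2 * dvg (U t) x
      - \<epsilon> * off_vacuum \<kappa> (r t x) * (outer (G t x) (G t x) \<bullet> jacobian (U t) x)
      - \<epsilon> * (r t x * off_vacuum \<kappa> (r t x)) * (G t x \<bullet> grad (dvg (U t)) x)"
proof -
  define X where "X = R t x powr (\<gamma> - 2)"
  have fluct: "(1 / r t x) * (outer (m t x - r t x *\<^sub>R U t x) (m t x - r t x *\<^sub>R U t x) \<bullet> jacobian (U t) x)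
    = (1 / r t x) * (outer (m t x) (m t x) \<bullet> jacobian (U t) x) - outer (m t x) (U t x) \<bullet> jacobian (U t) x
      - outer (U t x) (m t x) \<bullet> jacobian (U t) x + r t x * (outer (U t x) (U t x) \<bullet> jacobian (U t) x)"
  proof (cases "r t x = 0")
    case True
    then show ?thesis using r(2) by (simp add: outer_def inner_vec_def)
  next
    case False
    then show ?thesis unfolding outer_diff_scaled by (simp add: field_simps power2_eq_square)
  qed
  have stress: "stress pot \<kappa> \<epsilon> (r t x) (G t x) (D t x) \<bullet> jacobian (U t) x
    = (- ((\<gamma> - 1) * r t x powr \<gamma>) - \<epsilon> * ((r t x * off_vacuum (deriv \<kappa>) (r t x) + off_vacuum \<kappa> (r t x)) / 2) * (norm (G t x))\<^sup>2 + \<epsilon> * D t x) * dvg (U t) x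
      - (\<epsilon> * off_vacuum \<kappa> (r t x)) * (outer (G t x) (G t x) \<bullet> jacobian (U t) x)"
    unfolding stress_def pressure_powr[OF \<gamma> r(1)] inner_diff_left inner_scaleR_left inner_mat_1_jacobian ..
  show ?thesis
    unfolding production_def stress inner_scaleR_left inner_velocity_rate inner_grad_multiplier multiplier_rate_def
      bg_pressure_rate_def dvg_bg_pressure_flux density_rate_def
    unfolding bg_pressure_def relative_powr[OF R_pos] R_powr_base X_def[symmetric] minus_mult_left[symmetric] fluct
    by (simp add: algebra_simps power2_eq_square)
qed

lemma relative_density_parts_nonneg:
  assumes "r \<ge> 0" "\<And>r. r > 0 \<Longrightarrow> \<kappa> r > 0" "\<epsilon> > 0"
  shows "0 \<le> relative pot r (R t x)" "0 \<le> (1/2) * ((norm w)\<^sup>2 / r)" "0 \<le> \<epsilon> * off_vacuum \<kappa> r / 2 * (norm g)\<^sup>2"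
  using relative_powr_nonneg[OF \<gamma> R_pos assms(1)] assms(1,3) assms(2)[of r] by (auto simp: off_vacuum_def less_imp_le)

text \<open>The capillary term with \<open>\<nabla> div U\<close> is the only one that is not controlled by the relative energy
  itself; Young's inequality and \<open>r\<^sup>2 \<kappa>(r) \<lesssim> h(r) + r\<close> leave the remainder of order \<open>\<epsilon>\<close>.\<close>

lemma production_bound:
  assumes "\<forall>r>0. \<kappa> r > 0" and "C1 > 0" "\<forall>r>0. r\<^sup>2 * \<kappa> r \<le> C1 * (r powr \<gamma> + r)"
    and "C2 > 0" "\<forall>r>0. \<bar>r * deriv \<kappa> r\<bar> \<le> C2 * \<kappa> r"
  shows "\<exists>K>0. \<forall>\<epsilon> r m G D E t x. 0 < \<epsilon> \<longrightarrow> \<epsilon> \<le> 1 \<longrightarrow> t \<in> {0..T} \<longrightarrow> r t x \<ge> 0 \<longrightarrow> (r t x = 0 \<longrightarrow> m t x = 0) \<longrightarrow>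
      E t x = energy pot \<kappa> \<epsilon> (r t x) (m t x) (G t x) \<longrightarrow>
      korteweg_production \<kappa> \<epsilon> r m G D t x
      \<le> K * rel_density E r m t x + K * \<epsilon>"
proof -
  note \<kappa> = assms(1)[rule_format] and C1 = assms(2) assms(3)[rule_format] and C2 = assms(4) assms(5)[rule_format]
  have grad_dvg: "joint_Ck 0 (\<lambda>t. grad (dvg (U t)))"
    using joint_Ck_grad[of 0] dvg_U_reg by (simp del: joint_Ck.simps)
  obtain L1 where L1: "L1 > 0" "\<forall>t\<in>{0..T}. \<forall>x. norm (jacobian (U t) x) \<le> L1" using joint_Ck_bounded[OF jacobian_U_reg] by blast
  obtain L2 where L2: "L2 > 0" "\<forall>t\<in>{0..T}. \<forall>x. norm (dvg (U t) x) \<le> L2" using joint_Ck_bounded[OF dvg_U_reg] by blast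
  obtain L3 where L3: "L3 > 0" "\<forall>t\<in>{0..T}. \<forall>x. norm (grad (dvg (U t)) x) \<le> L3" using joint_Ck_bounded[OF grad_dvg] by blast
  obtain H where H: "H > 0" "\<forall>t\<in>{0..T}. \<forall>x. norm (R t x) \<le> H" using joint_Ck_bounded[OF R_reg] by blast
  obtain A where A: "A > 0" "\<And>R r. 0 < R \<Longrightarrow> R \<le> H \<Longrightarrow> 0 \<le> r \<Longrightarrow> r powr \<gamma> + r \<le> A * (relative pot r R + 1)"
    using powr_le_relative[OF \<gamma> H(1)] by blast
  define K where "K = 2 * L1 + (\<gamma> - 1) * L2 + (C2 + 1) * L2 + L3 + L3 * C1 * A"
  have K: "K > 0" using L1 L2 L3 \<gamma> C1 C2 A by (auto simp: K_def intro!: add_pos_pos)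
  have "korteweg_production \<kappa> \<epsilon> r m G D t x
      \<le> K * rel_density E r m t x + K * \<epsilon>"
    if \<epsilon>: "0 < \<epsilon>" "\<epsilon> \<le> 1" and t: "t \<in> {0..T}" and r: "r t x \<ge> 0" "r t x = 0 \<longrightarrow> m t x = 0"
      and E: "E t x = energy pot \<kappa> \<epsilon> (r t x) (m t x) (G t x)" for \<epsilon> r m G D E t x
  proof -
    define \<kappa>r where "\<kappa>r = off_vacuum \<kappa> (r t x)"
    define \<kappa>r' where "\<kappa>r' = off_vacuum (deriv \<kappa>) (r t x)"
    define rel where "rel = relative pot (r t x) (R t x)"
    define w where "w = m t x - r t x *\<^sub>R U t x"
    define kin where "kin = (1/2) * ((norm w)\<^sup>2 / r t x)"
    define cap where "cap = \<epsilon> * \<kappa>r / 2 * (norm (G t x))\<^sup>2"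
    have nonneg: "0 \<le> rel" "0 \<le> kin" "0 \<le> cap"
      using relative_density_parts_nonneg[OF r(1) \<kappa> \<epsilon>(1)] by (auto simp: rel_def kin_def cap_def \<kappa>r_def)
    have \<kappa>r: "0 \<le> \<kappa>r" "(r t x)\<^sup>2 * \<kappa>r \<le> C1 * (r t x powr \<gamma> + r t x)" "\<bar>r t x * \<kappa>r'\<bar> \<le> C2 * \<kappa>r"
      using \<kappa>[of "r t x"] C1(2)[of "r t x"] C2(2)[of "r t x"] r(1)
      by (auto simp: \<kappa>r_def \<kappa>r'_def off_vacuum_def less_imp_le)
    have L: "norm (jacobian (U t) x) \<le> L1" "\<bar>dvg (U t) x\<bar> \<le> L2" "norm (grad (dvg (U t)) x) \<le> L3"
      using L1(2) L2(2) L3(2) t by auto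
    have b1: "- (1 / r t x) * (outer w w \<bullet> jacobian (U t) x) \<le> 2 * L1 * kin"
    proof -
      have "\<bar>outer w w \<bullet> jacobian (U t) x\<bar> \<le> (norm w)\<^sup>2 * L1"
        using abs_outer_inner_le mult_left_mono[OF L(1) zero_le_power2] by (rule order_trans)
      then have "- (outer w w \<bullet> jacobian (U t) x) \<le> (norm w)\<^sup>2 * L1" by linarith
      then have "(1 / r t x) * - (outer w w \<bullet> jacobian (U t) x) \<le> (1 / r t x) * ((norm w)\<^sup>2 * L1)"
        using r(1) by (intro mult_left_mono) auto
      then show ?thesis by (simp add: kin_def mult_ac)
    qed
    have b2: "- ((\<gamma> - 1) * rel * dvg (U t) x) \<le> (\<gamma> - 1) * L2 * rel"
    proof -
      have "(\<gamma> - 1) * rel * (- dvg (U t) x) \<le> (\<gamma> - 1) * rel * L2"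
        using \<gamma> nonneg L(2) by (intro mult_left_mono) auto
      then show ?thesis by (simp add: mult_ac)
    qed
    have b3: "- \<epsilon> * ((r t x * \<kappa>r' + \<kappa>r) / 2) * (norm (G t x))\<^sup>2 * dvg (U t) x \<le> (C2 + 1) * L2 * cap"
    proof -
      have "\<bar>(r t x * \<kappa>r' + \<kappa>r) * dvg (U t) x\<bar> \<le> ((C2 + 1) * \<kappa>r) * L2"
        unfolding abs_mult using \<kappa>r L(2) C2(1) by (intro mult_mono) (auto simp: algebra_simps)
      then have "- ((r t x * \<kappa>r' + \<kappa>r) * dvg (U t) x) \<le> ((C2 + 1) * \<kappa>r) * L2" by linarith
      then have "(\<epsilon> / 2 * (norm (G t x))\<^sup>2) * - ((r t x * \<kappa>r' + \<kappa>r) * dvg (U t) x) \<le> (\<epsilon> / 2 * (norm (G t x))\<^sup>2) * (((C2 + 1) * \<kappa>r) * L2)"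
        using \<epsilon> by (intro mult_left_mono) auto
      then show ?thesis by (simp add: cap_def mult_ac)
    qed
    have b4: "- \<epsilon> * \<kappa>r * (outer (G t x) (G t x) \<bullet> jacobian (U t) x) \<le> 2 * L1 * cap"
    proof -
      have "\<bar>outer (G t x) (G t x) \<bullet> jacobian (U t) x\<bar> \<le> (norm (G t x))\<^sup>2 * L1"
        using abs_outer_inner_le mult_left_mono[OF L(1) zero_le_power2] by (rule order_trans)
      then have "- (outer (G t x) (G t x) \<bullet> jacobian (U t) x) \<le> (norm (G t x))\<^sup>2 * L1" by linarith
      then have "(\<epsilon> * \<kappa>r) * - (outer (G t x) (G t x) \<bullet> jacobian (U t) x) \<le> (\<epsilon> * \<kappa>r) * ((norm (G t x))\<^sup>2 * L1)"
        using \<epsilon> \<kappa>r by (intro mult_left_mono) auto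
      then show ?thesis by (simp add: cap_def mult_ac)
    qed
    have b5: "- \<epsilon> * (r t x * \<kappa>r) * (G t x \<bullet> grad (dvg (U t)) x) \<le> L3 * cap + L3 * C1 * A * (rel + \<epsilon>)"
    proof -
      have "\<bar>G t x \<bullet> grad (dvg (U t)) x\<bar> \<le> norm (G t x) * L3"
        using Cauchy_Schwarz_ineq2 mult_left_mono[OF L(3) norm_ge_zero] by (rule order_trans)
      then have "- (G t x \<bullet> grad (dvg (U t)) x) \<le> norm (G t x) * L3" by linarith
      then have "(\<epsilon> * (r t x * \<kappa>r)) * - (G t x \<bullet> grad (dvg (U t)) x) \<le> (\<epsilon> * (r t x * \<kappa>r)) * (norm (G t x) * L3)"
        using \<epsilon> \<kappa>r r by (intro mult_left_mono) auto
      also have "\<dots> = (\<epsilon> * \<kappa>r * L3) * (r t x * norm (G t x))" by (simp add: mult_ac)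
      also have "\<dots> \<le> (\<epsilon> * \<kappa>r * L3) * ((norm (G t x))\<^sup>2 / 2 + (r t x)\<^sup>2 / 2)"
      proof (intro mult_left_mono)
        show "r t x * norm (G t x) \<le> (norm (G t x))\<^sup>2 / 2 + (r t x)\<^sup>2 / 2"
          using sum_squares_bound[of "r t x" "norm (G t x)"] by linarith
      qed (use \<epsilon> \<kappa>r L3 in auto)
      also have "\<dots> = L3 * cap + (\<epsilon> * L3 / 2) * ((r t x)\<^sup>2 * \<kappa>r)" by (simp add: cap_def field_simps)
      also have "\<dots> \<le> L3 * cap + (\<epsilon> * L3 / 2) * (C1 * (A * (rel + 1)))"
      proof -
        have "R t x \<le> H" using H(2) t by (metis abs_le_D1 real_norm_def)
        then have "r t x powr \<gamma> + r t x \<le> A * (rel + 1)" unfolding rel_def by (intro A(2) R_pos r)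
        then have "(r t x)\<^sup>2 * \<kappa>r \<le> C1 * (A * (rel + 1))" using \<kappa>r(2) C1(1) by (meson mult_left_mono order_trans less_imp_le)
        then show ?thesis using \<epsilon> L3 by (intro add_left_mono mult_left_mono) auto
      qed
      also have "(\<epsilon> * L3 / 2) * (C1 * (A * (rel + 1))) = (L3 * C1 * A) * ((\<epsilon> * rel + \<epsilon>) / 2)" by (simp add: field_simps)
      also have "L3 * cap + (L3 * C1 * A) * ((\<epsilon> * rel + \<epsilon>) / 2) \<le> L3 * cap + (L3 * C1 * A) * (rel + \<epsilon>)"
      proof (intro add_left_mono mult_left_mono)
        have "\<epsilon> * rel \<le> rel" using \<epsilon> nonneg mult_right_mono[of \<epsilon> 1 rel] by simp
        moreover have "(z + \<epsilon>) / 2 \<le> rel + \<epsilon>" if "z \<le> rel" for z using that nonneg(1) \<epsilon>(1) by simp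
        ultimately show "(\<epsilon> * rel + \<epsilon>) / 2 \<le> rel + \<epsilon>" by blast
      qed (use L3 C1 A in auto)
      finally show ?thesis by (simp add: mult_ac)
    qed
    have "korteweg_production \<kappa> \<epsilon> r m G D t x
      \<le> 2 * L1 * kin + (\<gamma> - 1) * L2 * rel + (C2 + 1) * L2 * cap + 2 * L1 * cap + (L3 * cap + L3 * C1 * A * (rel + \<epsilon>))"
      using b1 b2 b3 b4 b5 r(2)
      by (subst production_eq[of r t x m, OF r(1)])
        (auto simp: w_def[symmetric] rel_def[symmetric] \<kappa>r_def[symmetric] \<kappa>r'_def[symmetric] mult.assoc)
    also have "\<dots> \<le> K * (rel + kin + cap) + K * \<epsilon>"
    proof -
      have "2 * L1 * kin \<le> K * kin" "((\<gamma> - 1) * L2 + L3 * C1 * A) * rel \<le> K * rel"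
        "((C2 + 1) * L2 + 2 * L1 + L3) * cap \<le> K * cap" "(L3 * C1 * A) * \<epsilon> \<le> K * \<epsilon>"
        using L1 L2 L3 \<gamma> C1 C2 A \<epsilon> nonneg by (intro mult_right_mono; simp add: K_def)+
      then show ?thesis by (simp add: algebra_simps)
    qed
    also have "rel + kin + cap = rel_density E r m t x"
      using rel_density_eq[of r t x m E \<kappa> \<epsilon> "G t x", OF r(1) _ E] r(2) by (simp add: rel_def kin_def cap_def w_def \<kappa>r_def)
    finally show ?thesis .
  qed
  with K show ?thesis by blast
qed

end


section \<open>Strong solutions of the Euler system\<close>

text \<open>The first term is the one that the mass equation removes from the conservative form of the momentum
  equation.\<close>

lemma tensor_dvg_momentum_flux:
  assumes f: "f differentiable (at x)" and V: "V differentiable (at x)"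
  shows "tensor_dvg (\<lambda>y. f y *\<^sub>R outer (V y) (V y)) x
    = dvg (\<lambda>y. f y *\<^sub>R V y) x *\<^sub>R V x + f x *\<^sub>R (\<Sum>j\<in>UNIV. V x $ j *\<^sub>R pd j V x)"
proof -
  have Vi: "(\<lambda>y. V y $ i) differentiable (at x)" for i
    using bounded_linear.has_derivative[OF bounded_linear_vec_nth pd_has_derivative[OF V]] differentiableI by blast
  have fVi: "(\<lambda>y. f y * V y $ i) differentiable (at x)" for i
    using has_derivative_mult[OF pd_has_derivative[OF f] pd_has_derivative[OF Vi]] differentiableI by blast
  have "tensor_dvg (\<lambda>y. f y *\<^sub>R outer (V y) (V y)) x $ i
      = dvg (\<lambda>y. f y *\<^sub>R V y) x * V x $ i + f x * (\<Sum>j\<in>UNIV. V x $ j * pd j V x $ i)" for i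
  proof -
    have "tensor_dvg (\<lambda>y. f y *\<^sub>R outer (V y) (V y)) x $ i = dvg (\<lambda>y. (f y * V y $ i) *\<^sub>R V y) x"
      unfolding tensor_dvg_def by (simp add: outer_def scaleR_vec_def mult_ac)
    also have "\<dots> = V x \<bullet> grad (\<lambda>y. f y * V y $ i) x + f x * V x $ i * dvg V x"
      by (rule dvg_scaleR[OF fVi V])
    also have "V x \<bullet> grad (\<lambda>y. f y * V y $ i) x = (\<Sum>j\<in>UNIV. V x $ j * (f x * pd j V x $ i + pd j f x * V x $ i))"
      by (simp add: inner_vec_def grad_def bounded_bilinear.pd_product[OF bounded_bilinear_mult f Vi]
          bounded_linear.pd_commute[OF bounded_linear_vec_nth V])
    also have "\<dots> = f x * (\<Sum>j\<in>UNIV. V x $ j * pd j V x $ i) + (V x \<bullet> grad f x) * V x $ i"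
      by (simp add: inner_vec_def grad_def sum.distrib sum_distrib_left sum_distrib_right algebra_simps)
    finally show ?thesis unfolding dvg_scaleR[OF f V] by (simp add: algebra_simps)
  qed
  then show ?thesis by (simp add: vec_eq_iff)
qed

text \<open>In terms of density and velocity the momentum equation reads
  \<open>u\<^sub>t + (u \<cdot> \<nabla>) u = - \<nabla> h'(\<rho>)\<close>, since the density is positive.\<close>

lemma euler_solution_imp_euler_flow:
  fixes \<rho> :: "real \<Rightarrow> real^'n \<Rightarrow> real" and u :: "real \<Rightarrow> real^'n \<Rightarrow> real^'n"
  assumes T: "T > 0" and \<gamma>: "\<gamma> > 1" and pos: "\<And>t x. t \<in> {0..T} \<Longrightarrow> \<rho> t x > 0"
    and \<rho>: "C0_Ck {0..T} 3 \<rho>" "C1_Ck {0<..<T} 1 \<rho>" and u: "C0_Ck {0..T} 2 u" "C1_Ck {0<..<T} 0 u"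
    and sol: "euler_solution (\<lambda>r. r powr \<gamma>) T \<rho> u \<rho>\<^sub>0 u\<^sub>0"
  shows "euler_flow T \<gamma> (\<lambda>t. \<rho> (max 0 (min T t))) (\<lambda>t. u (max 0 (min T t)))"
proof
  define R where "R t = \<rho> (max 0 (min T t))" for t
  define U where "U t = u (max 0 (min T t))" for t
  have R: "joint_Ck 3 R" and U2: "joint_Ck 2 U"
    using C0_Ck_imp_joint_Ck[OF less_imp_le[OF T] \<rho>(1)] C0_Ck_imp_joint_Ck[OF less_imp_le[OF T] u(1)]
    by (simp_all add: R_def[abs_def] U_def[abs_def])
  have R2: "joint_Ck 2 R" by (rule joint_Ck_mono[OF _ R]) simp
  have inner: "R t = \<rho> t" "U t = u t" if "t \<in> {0<..<T}" for t using that by (auto simp: R_def U_def)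
  have Rd: "R t differentiable (at x)" and Ud: "U t differentiable (at x)" for t x
    using R2 U2 by (auto simp: numeral_2_eq_2)
  show "T > 0" "\<gamma> > 1" by fact+
  show "\<rho> (max 0 (min T t)) x > 0" for t x using pos[of "max 0 (min T t)"] T by auto
  show "joint_Ck 2 (\<lambda>t. \<rho> (max 0 (min T t)))" using R2 by (simp add: R_def[abs_def])
  show "joint_Ck 2 (\<lambda>t. u (max 0 (min T t)))" using U2 by (simp add: U_def[abs_def])
  fix t x assume t: "t \<in> {0<..<T}"
  have R_pos: "R t y > 0" for y using pos[of t y] t by (simp add: inner)
  have rt: "((\<lambda>s. \<rho> s x) has_vector_derivative ddt \<rho> t x) (at t)"
    and ut: "((\<lambda>s. u s x) has_vector_derivative ddt u t x) (at t)"
    using C1_Ck_imp_pointwise_derivative[OF \<rho>(2) t] C1_Ck_imp_pointwise_derivative[OF u(2) t] by blast+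
  have mass: "ddt \<rho> t x + dvg (\<lambda>y. R t y *\<^sub>R U t y) x = 0"
    and mom: "ddt (\<lambda>s y. \<rho> s y *\<^sub>R u s y) t x + tensor_dvg (\<lambda>y. R t y *\<^sub>R outer (U t y) (U t y)) x
          = - (R t x *\<^sub>R grad (\<lambda>y. deriv (\<lambda>r. r powr \<gamma>) (R t y)) x)"
    using sol t by (auto simp: euler_solution_def inner[OF t])
  have rate: "ddt \<rho> t x = density_rate R U t x"
    using mass by (simp add: density_rate_def dvg_scaleR[OF Rd Ud])
  have "((\<lambda>s. R s x) has_vector_derivative density_rate R U t x) (at t)"
    unfolding rate[symmetric]
    by (rule has_vector_derivative_transform_within_open[OF rt, of "{0<..<T}"]) (use t inner in auto)
  then show "((\<lambda>s. \<rho> (max 0 (min T s)) x) has_real_derivative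
      density_rate (\<lambda>t. \<rho> (max 0 (min T t))) (\<lambda>t. u (max 0 (min T t))) t x) (at t)"
    by (simp add: has_real_derivative_iff_has_vector_derivative R_def[abs_def] U_def[abs_def])
  have "((\<lambda>s. \<rho> s x *\<^sub>R u s x) has_vector_derivative \<rho> t x *\<^sub>R ddt u t x + ddt \<rho> t x *\<^sub>R u t x) (at t)"
    by (rule bounded_bilinear.has_vector_derivative[OF bounded_bilinear_scaleR rt ut])
  then have prod: "ddt (\<lambda>s y. \<rho> s y *\<^sub>R u s y) t x = R t x *\<^sub>R ddt u t x + ddt \<rho> t x *\<^sub>R U t x"
    unfolding ddt_def[of "\<lambda>s y. \<rho> s y *\<^sub>R u s y"] using inner[OF t] by (simp add: vector_derivative_at)
  have "deriv (\<lambda>r. r powr \<gamma>) (R t y) = \<gamma> * R t y powr (\<gamma> - 1)" for y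
    using R_pos[of y] by (intro DERIV_imp_deriv) (auto intro!: derivative_eq_intros)
  moreover have "((\<lambda>r. \<gamma> * r powr (\<gamma> - 1)) has_real_derivative \<gamma> * (\<gamma> - 1) * R t x powr (\<gamma> - 2)) (at (R t x))"
    using R_pos[of x] by (auto intro!: derivative_eq_intros)
  from pd_real_compose(2)[OF Rd this]
  have "pd j (\<lambda>y. \<gamma> * R t y powr (\<gamma> - 1)) x = \<gamma> * (\<gamma> - 1) * R t x powr (\<gamma> - 2) * pd j (R t) x" for j .
  ultimately have g: "grad (\<lambda>y. deriv (\<lambda>r. r powr \<gamma>) (R t y)) x = (\<gamma> * (\<gamma> - 1) * R t x powr (\<gamma> - 2)) *\<^sub>R grad (R t) x"
    by (simp add: grad_def vec_eq_iff)
  have "ddt \<rho> t x = - dvg (\<lambda>y. R t y *\<^sub>R U t y) x" using mass by linarith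
  then have "R t x *\<^sub>R ddt u t x = R t x *\<^sub>R velocity_rate \<gamma> R U t x"
    using mom unfolding prod tensor_dvg_momentum_flux[OF Rd Ud] g velocity_rate_def
    by (simp add: scaleR_diff_right eq_diff_eq add_eq_0_iff algebra_simps)
  then have urate: "ddt u t x = velocity_rate \<gamma> R U t x" using R_pos[of x] by simp
  have "((\<lambda>s. U s x) has_vector_derivative velocity_rate \<gamma> R U t x) (at t)"
    unfolding urate[symmetric]
    by (rule has_vector_derivative_transform_within_open[OF ut, of "{0<..<T}"]) (use t inner in auto)
  then show "((\<lambda>s. u (max 0 (min T s)) x) has_vector_derivative
      velocity_rate \<gamma> (\<lambda>t. \<rho> (max 0 (min T t))) (\<lambda>t. u (max 0 (min T t))) t x) (at t)"
    by (simp add: R_def[abs_def] U_def[abs_def])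
qed


section \<open>The relative energy of a weak solution\<close>

text \<open>A single member of the family of weak solutions, next to the strong solution. Vacuum values of the
  momentum are zero because it is a product \<open>r v\<close>.\<close>

locale relative_energy_setting = euler_flow +
  fixes \<kappa> :: "real \<Rightarrow> real" and \<epsilon> :: real and r :: "real \<Rightarrow> real^'a \<Rightarrow> real" and m G :: "real \<Rightarrow> real^'a \<Rightarrow> real^'a"
    and E :: "real \<Rightarrow> real^'a \<Rightarrow> real"
  assumes \<epsilon>: "\<epsilon> > 0" and \<kappa>_pos: "\<And>s. s > 0 \<Longrightarrow> \<kappa> s > 0"
    and weak: "EK_weak_solution pot \<kappa> \<epsilon> r m G" and density: "energy_density pot \<kappa> \<epsilon> r m G E"
    and dissipation: "\<And>\<theta> \<theta>'. energy_test_fun \<theta> \<theta>' \<Longrightarrow>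
        - (\<integral>(t,x). E t x * \<theta>' t \<partial>spacetime) \<le> (\<integral>x. E 0 x * \<theta> 0 \<partial>torus)"
    and vacuum: "\<And>t x. r t x = 0 \<Longrightarrow> m t x = 0"
    and initial: "AE x in torus. r 0 x = R 0 x \<and> m 0 x = R 0 x *\<^sub>R U 0 x"
begin

abbreviation rel_energy :: "real \<Rightarrow> real" where
  "rel_energy t \<equiv> (\<integral>x. rel_density E r m t x \<partial>torus)"

lemma r_CL1: "CL1 r" and m_CL1: "CL1 m" and E_CL1: "CL1 E"
  using weak density by (auto simp: EK_weak_solution_def energy_density_def)

lemma AE_nonneg: "AE p in spacetime. 0 \<le> r (fst p) (snd p)"
proof -
  have [measurable]: "(\<lambda>p. r (fst p) (snd p)) \<in> borel_measurable (halfline \<Otimes>\<^sub>M torus)"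
    using r_CL1 by (simp add: CL1_def case_prod_unfold spacetime_def)
  have "{p \<in> space (halfline \<Otimes>\<^sub>M torus). 0 \<le> r (fst p) (snd p)} \<in> sets (halfline \<Otimes>\<^sub>M torus)" by measurable
  moreover have "AE t in halfline. AE x in torus. 0 \<le> r (fst (t, x)) (snd (t, x))"
  proof (rule AE_I2)
    have "\<forall>t\<ge>0. AE x in torus. 0 \<le> r t x" using weak unfolding EK_weak_solution_def by blast
    then show "AE x in torus. 0 \<le> r (fst (t, x)) (snd (t, x))" if "t \<in> space halfline" for t
      using that by (simp add: space_halfline)
  qed
  ultimately show ?thesis unfolding spacetime_def by (rule spacetime.AE_pair_measure)
qed

lemma AE_energy: "AE p in spacetime. E (fst p) (snd p) = energy pot \<kappa> \<epsilon> (r (fst p) (snd p)) (m (fst p) (snd p)) (G (fst p) (snd p))"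
  using density by (simp add: energy_density_def case_prod_unfold)

lemma AE_slices:
  "AE t in lborel. 0 < t \<longrightarrow> (AE x in torus. 0 \<le> r t x \<and> E t x = energy pot \<kappa> \<epsilon> (r t x) (m t x) (G t x))"
proof -
  have "AE p in halfline \<Otimes>\<^sub>M torus. 0 \<le> r (fst p) (snd p) \<and>
      E (fst p) (snd p) = energy pot \<kappa> \<epsilon> (r (fst p) (snd p)) (m (fst p) (snd p)) (G (fst p) (snd p))"
    using AE_nonneg AE_energy unfolding spacetime_def by eventually_elim simp
  from spacetime.AE_pair[OF this] show ?thesis
    unfolding halfline_def by (subst (asm) AE_restrict_space_iff) auto
qed

text \<open>Both densities agree initially, so the weak gradient that enters the initial energy is the classical
  gradient of \<open>R\<close> and does not depend on the weak solution.\<close>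

lemma AE_initial:
  "AE x in torus. r 0 x = R 0 x \<and> m 0 x = R 0 x *\<^sub>R U 0 x \<and>
     E 0 x = energy pot \<kappa> \<epsilon> (R 0 x) (R 0 x *\<^sub>R U 0 x) (grad (R 0) x)"
proof -
  have "AE x in torus. \<forall>j. G 0 x $ j = pd j (R 0) x"
  proof (rule torus_weak_gradient_unique[OF joint_Ck_imp_Ck_torus[OF R_reg1]])
    show "slice_weak_gradient (r 0) (G 0)" using density by (simp add: energy_density_def)
    show "AE x in torus. r 0 x = R 0 x" using initial by eventually_elim simp
  qed
  moreover have "AE x in torus. E 0 x = energy pot \<kappa> \<epsilon> (r 0 x) (m 0 x) (G 0 x)"
    using density by (simp add: energy_density_def)
  ultimately show ?thesis using initial
  proof eventually_elim
    case (elim x)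
    then have "G 0 x = grad (R 0) x" by (simp add: vec_eq_iff grad_def)
    with elim show ?case by simp
  qed
qed

text \<open>The distributional energy inequality is the case \<open>K = c = 0\<close> of Gronwall's inequality.\<close>

lemma energy_decreases:
  assumes "0 < t" "t < T"
  shows "(\<integral>x. E t x \<partial>torus) \<le> (\<integral>x. E 0 x \<partial>torus)"
proof -
  have one: "joint_Ck 0 (\<lambda>t (x :: real^'a). 1 :: real)" by (intro joint_Ck_time continuous_intros)
  have "(\<integral>x. E t x \<partial>torus) \<le> exp (0 * t) * ((\<integral>x. E 0 x \<partial>torus) + 0 * T)"
  proof (rule distributional_gronwall[where T = T and c = 0])
    have "continuous_on {0..} (\<lambda>t. \<integral>x. E t x \<partial>torus)" using CL1_inner_continuous[OF E_CL1 one] by simp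
    then show "continuous_on {0..<T} (\<lambda>t. \<integral>x. E t x \<partial>torus)" by (rule continuous_on_subset) auto
    fix \<theta> \<theta>' :: "real \<Rightarrow> real" and a b assume \<theta>: "cutoff \<theta> \<theta>' a b" "0 < a" "b < T" "\<And>t. 0 \<le> \<theta> t"
    have "(\<integral>t. \<theta>' t * (\<integral>x. E t x \<partial>torus) \<partial>lborel) = (\<integral>t. \<theta>' t * (\<integral>x. E t x \<partial>torus) \<partial>halfline)"
      by (rule halfline_integral[symmetric, of a b]) (use cutoff_zero'[OF \<theta>(1)] \<theta>(2) in auto)
    also have "\<dots> = (\<integral>(t,x). E t x * \<theta>' t \<partial>spacetime)"
      using CL1_cutoff_integral[OF E_CL1 one cutoff_continuous'[OF \<theta>(1)] cutoff_zero'[OF \<theta>(1)] \<theta>(2)]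
      by (simp add: mult.commute)
    finally show "- (\<integral>t. \<theta>' t * (\<integral>x. E t x \<partial>torus) \<partial>lborel) \<le> (\<integral>t. \<theta> t * (0 * (\<integral>x. E t x \<partial>torus) + 0) \<partial>lborel)"
      using dissipation[OF cutoff_energy_test_fun[OF \<theta>(1,2,4)]] cutoff_zero[OF \<theta>(1), of 0] \<theta>(2) by simp
  qed (use assms in auto)
  then show ?thesis by simp
qed

lemma initial_energy:
  assumes "\<And>x. R 0 x / 2 * (norm (U 0 x))\<^sup>2 + R 0 x powr \<gamma> \<le> A" "\<And>x. \<kappa> (R 0 x) / 2 * (norm (grad (R 0) x))\<^sup>2 \<le> B"
  shows "(\<integral>x. E 0 x \<partial>torus) \<le> (A + \<epsilon> * B)" and "rel_energy 0 \<le> \<epsilon> * B"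
proof -
  have cap: "\<epsilon> * off_vacuum \<kappa> (R 0 x) / 2 * (norm (grad (R 0) x))\<^sup>2 \<le> \<epsilon> * B" for x
    using mult_left_mono[OF assms(2)[of x] less_imp_le[OF \<epsilon>]] R_pos[of 0 x] by (simp add: off_vacuum_def mult_ac)
  have "AE x in torus. E 0 x \<le> A + \<epsilon> * B"
    using AE_initial
  proof eventually_elim
    case (elim x)
    have "(norm (R 0 x *\<^sub>R U 0 x))\<^sup>2 / R 0 x = R 0 x * (norm (U 0 x))\<^sup>2"
      using R_pos[of 0 x] by (simp add: power_mult_distrib power2_eq_square)
    then have "E 0 x = (R 0 x / 2 * (norm (U 0 x))\<^sup>2 + R 0 x powr \<gamma>) + \<epsilon> * off_vacuum \<kappa> (R 0 x) / 2 * (norm (grad (R 0) x))\<^sup>2"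
      using elim by (simp add: energy_def)
    then show ?case using assms(1)[of x] cap[of x] by linarith
  qed
  then have "(\<integral>x. E 0 x \<partial>torus) \<le> (\<integral>x. A + \<epsilon> * B \<partial>(torus :: (real^'a) measure))"
    by (intro integral_mono_AE CL1_integrable[OF E_CL1]) auto
  then show "(\<integral>x. E 0 x \<partial>torus) \<le> (A + \<epsilon> * B)" by (simp add: torus_volume)
  have "AE x in torus. rel_density E r m 0 x \<le> \<epsilon> * B"
    using AE_initial
  proof eventually_elim
    case (elim x)
    then have "rel_density E r m 0 x = \<epsilon> * off_vacuum \<kappa> (R 0 x) / 2 * (norm (grad (R 0) x))\<^sup>2"
      using rel_density_eq[of r 0 x m E \<kappa> \<epsilon> "grad (R 0) x"] R_pos[of 0 x]
      by (simp add: relative_def)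
    then show ?case using cap[of x] by simp
  qed
  then have "rel_energy 0 \<le> (\<integral>x. \<epsilon> * B \<partial>(torus :: (real^'a) measure))"
    by (intro integral_mono_AE rel_density_integrable(1)[OF E_CL1 r_CL1 m_CL1]) auto
  then show "rel_energy 0 \<le> \<epsilon> * B" by (simp add: torus_volume)
qed

lemma rel_energy_gronwall:
  assumes K: "K \<ge> 0" and bound: "\<And>D t x. t \<in> {0..T} \<Longrightarrow> r t x \<ge> 0 \<Longrightarrow>
      E t x = energy pot \<kappa> \<epsilon> (r t x) (m t x) (G t x) \<Longrightarrow>
      korteweg_production \<kappa> \<epsilon> r m G D t x
      \<le> K * rel_density E r m t x + K * \<epsilon>"
    and t: "0 < t" "t < T"
  shows "rel_energy t \<le> exp (K * t) * (rel_energy 0 + K * \<epsilon> * T)"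
proof (rule distributional_gronwall)
  show "continuous_on {0..<T} rel_energy"
    by (rule continuous_on_subset[OF rel_density_continuous[OF E_CL1 r_CL1 m_CL1]]) auto
  show "0 \<le> K * \<epsilon>" using K \<epsilon> by simp
  fix \<theta> \<theta>' :: "real \<Rightarrow> real" and a b assume \<theta>: "cutoff \<theta> \<theta>' a b" "0 < a" "b < T" "\<And>t. 0 \<le> \<theta> t"
  let ?MM = "\<lambda>t x. (1 / r t x) *\<^sub>R outer (m t x) (m t x)"
  let ?F = "\<lambda>t x. (r t x * off_vacuum \<kappa> (r t x)) *\<^sub>R G t x"
  obtain D where D: "weak_divergence ?F D" "L1loc (\<lambda>t x. stress pot \<kappa> \<epsilon> (r t x) (G t x) (D t x))"
    and mass: "\<And>\<psi>. test_fun \<psi> \<Longrightarrow> has_bochner_integral spacetime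
        (\<lambda>(t,x). r t x * ddt \<psi> t x + m t x \<bullet> grad (\<psi> t) x) (- (\<integral>x. r 0 x * \<psi> 0 x \<partial>torus))"
    and momentum: "\<And>\<phi>. test_fun \<phi> \<Longrightarrow> has_bochner_integral spacetime
        (\<lambda>(t,x). m t x \<bullet> ddt \<phi> t x + ?MM t x \<bullet> jacobian (\<phi> t) x
           - stress pot \<kappa> \<epsilon> (r t x) (G t x) (D t x) \<bullet> jacobian (\<phi> t) x)
        (- (\<integral>x. m 0 x \<bullet> \<phi> 0 x \<partial>torus))"
    using weak unfolding EK_weak_solution_def by blast
  have MM: "L1loc ?MM" using weak unfolding EK_weak_solution_def by blast
  let ?S = "\<lambda>t x. stress pot \<kappa> \<epsilon> (r t x) (G t x) (D t x)"
  note rel_ineq = relative_energy_distributional[where r = r and m = m and E = E and MM = ?MM and S = ?S and F = ?F and D = D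
      and \<theta> = \<theta> and \<theta>' = \<theta>' and a = a and b = b and \<epsilon> = \<epsilon>, OF r_CL1 m_CL1 E_CL1 MM D(2) D(1)]
  have main: "integrable spacetime (\<lambda>(t,x). \<theta> t * korteweg_production \<kappa> \<epsilon> r m G D t x)"
    "- (\<integral>t. \<theta>' t * rel_energy t \<partial>lborel) \<le> (\<integral>(t,x). \<theta> t * korteweg_production \<kappa> \<epsilon> r m G D t x \<partial>spacetime)"
    by (rule rel_ineq; (assumption | rule mass momentum dissipation \<theta>)+)+
  have one: "joint_Ck 0 (\<lambda>t (x :: real^'a). 1 :: real)" by (intro joint_Ck_time continuous_intros)
  note \<theta>c = cutoff_continuous[OF \<theta>(1)] cutoff_zero[OF \<theta>(1)] \<theta>(2)
  have i1: "integrable spacetime (\<lambda>p. \<theta> (fst p) * rel_density E r m (fst p) (snd p))"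
    using rel_density_st_pair[OF E_CL1 r_CL1 m_CL1 \<theta>c] by (simp add: has_bochner_integral_iff)
  have i2: "integrable spacetime (\<lambda>p :: real \<times> (real^'a). \<theta> (fst p))"
    using L1loc_cutoff_integrable[OF CL1_imp_L1loc[OF joint_Ck_imp_CL1[OF one]] one \<theta>c] by (simp add: case_prod_unfold)
  have I2: "(\<integral>p. \<theta> (fst p) \<partial>(spacetime :: (real \<times> (real^'a)) measure)) = (\<integral>t. \<theta> t \<partial>lborel)"
  proof -
    have "(\<integral>p. \<theta> (fst p) \<partial>(spacetime :: (real \<times> (real^'a)) measure)) = (\<integral>t. \<theta> t \<partial>halfline)"
      by (subst integral_spacetime_iterated[OF i2]) (simp add: torus_volume)
    also have "\<dots> = (\<integral>t. \<theta> t \<partial>lborel)"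
      by (rule halfline_integral[of a b]) (use \<theta>c in auto)
    finally show ?thesis by simp
  qed
  have j1: "integrable lborel (\<lambda>t. \<theta> t * rel_energy t)" "integrable lborel \<theta>"
  proof -
    have "{a..b} \<subseteq> {0..}" using \<theta>(2) by auto
    then show "integrable lborel (\<lambda>t. \<theta> t * rel_energy t)"
      by (intro integrable_continuous_support[of a b] continuous_on_mult
          continuous_on_subset[OF rel_density_continuous[OF E_CL1 r_CL1 m_CL1]]
          continuous_on_subset[OF \<theta>c(1) subset_UNIV]) (auto simp: \<theta>c(2))
    show "integrable lborel \<theta>"
      by (rule integrable_continuous_support[OF continuous_on_subset[OF \<theta>c(1) subset_UNIV] \<theta>c(2)])
  qed
  have "- (\<integral>t. \<theta>' t * rel_energy t \<partial>lborel)
      \<le> (\<integral>p. \<theta> (fst p) * korteweg_production \<kappa> \<epsilon> r m G D (fst p) (snd p) \<partial>spacetime)"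
    using main(2) by (simp add: case_prod_unfold)
  also have "\<dots> \<le> (\<integral>p. K * (\<theta> (fst p) * rel_density E r m (fst p) (snd p)) + K * \<epsilon> * \<theta> (fst p) \<partial>spacetime)"
  proof (rule integral_mono_AE)
    show "integrable spacetime (\<lambda>p. \<theta> (fst p) * korteweg_production \<kappa> \<epsilon> r m G D (fst p) (snd p))"
      using main(1) by (simp add: case_prod_unfold)
    show "AE p in spacetime. \<theta> (fst p) * korteweg_production \<kappa> \<epsilon> r m G D (fst p) (snd p)
        \<le> K * (\<theta> (fst p) * rel_density E r m (fst p) (snd p)) + K * \<epsilon> * \<theta> (fst p)"
      using AE_nonneg AE_energy
    proof eventually_elim
      case (elim p)
      show ?case
      proof (cases "fst p \<in> {a..b}")
        case True
        then have "fst p \<in> {0..T}" using \<theta> by auto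
        from mult_left_mono[OF bound[OF this elim] \<theta>(4)] show ?thesis by (simp add: algebra_simps)
      qed (simp add: \<theta>c(2))
    qed
  qed (use i1 i2 in auto)
  also have "\<dots> = K * (\<integral>p. \<theta> (fst p) * rel_density E r m (fst p) (snd p) \<partial>spacetime) + K * \<epsilon> * ((\<integral>t. \<theta> t \<partial>lborel))"
    using i1 i2 by (simp add: I2)
  also have "(\<integral>p. \<theta> (fst p) * rel_density E r m (fst p) (snd p) \<partial>spacetime) = (\<integral>t. \<theta> t * rel_energy t \<partial>lborel)"
    using rel_density_cutoff_integral[OF E_CL1 r_CL1 m_CL1 \<theta>c] by simp
  also have "K * (\<integral>t. \<theta> t * rel_energy t \<partial>lborel) + K * \<epsilon> * ((\<integral>t. \<theta> t \<partial>lborel))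
      = (\<integral>t. K * (\<theta> t * rel_energy t) + K * \<epsilon> * \<theta> t \<partial>lborel)"
    using j1 by simp
  also have "\<dots> = (\<integral>t. \<theta> t * (K * rel_energy t + K * \<epsilon>) \<partial>lborel)"
    by (intro Bochner_Integration.integral_cong) (auto simp: algebra_simps)
  finally show "- (\<integral>t. \<theta>' t * rel_energy t \<partial>lborel) \<le> (\<integral>t. \<theta> t * (K * rel_energy t + K * \<epsilon>) \<partial>lborel)" .
qed (use K t in auto)

end


section \<open>The rate of convergence\<close>

lemma norm_scaleR_square_div: "(norm (s *\<^sub>R w))\<^sup>2 / s = s * (norm w)\<^sup>2" for s :: real
  by (cases "s = 0") (simp_all add: power_mult_distrib power2_eq_square[of s])

context relative_energy_setting begin

text \<open>The relative energy without its capillary part. In terms of the momentum \<open>m = r v\<close> the kinetic part is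
  \<open>r |v - U|\<^sup>2/2\<close>, also on the vacuum set.\<close>

definition fluid_density :: "real \<Rightarrow> real^'a \<Rightarrow> real" where
  "fluid_density t x = relative pot (r t x) (R t x) + (1/2) * ((norm (m t x - r t x *\<^sub>R U t x))\<^sup>2 / r t x)"

lemma fluid_density_measurable:
  assumes "0 \<le> t"
  shows "fluid_density t \<in> borel_measurable torus"
proof -
  have [measurable]: "r t \<in> borel_measurable torus" "m t \<in> borel_measurable torus"
    "R t \<in> borel_measurable torus" "U t \<in> borel_measurable torus"
    using CL1_integrable[OF r_CL1 assms] CL1_integrable[OF m_CL1 assms]
      joint_Ck_integrable_torus[OF R_reg] joint_Ck_integrable_torus[OF U_reg] by auto
  show ?thesis
    unfolding fluid_density_def[abs_def] relative_powr[OF R_pos] by measurable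
qed

lemma fluid_density_le_rel_density:
  assumes t: "0 \<le> t" and good: "AE x in torus. 0 \<le> r t x \<and> E t x = energy pot \<kappa> \<epsilon> (r t x) (m t x) (G t x)"
  shows "integrable torus (fluid_density t)" "(\<integral>x. fluid_density t x \<partial>torus) \<le> rel_energy t"
proof -
  have AE: "AE x in torus. 0 \<le> fluid_density t x \<and> fluid_density t x \<le> rel_density E r m t x"
    using good
  proof eventually_elim
    case (elim x)
    then show ?case
      using rel_density_eq[of r t x m E \<kappa> \<epsilon> "G t x"] vacuum[of t x]
        relative_density_parts_nonneg[where r = "r t x" and \<kappa> = \<kappa> and \<epsilon> = \<epsilon>] \<kappa>_pos \<epsilon>
      by (simp add: fluid_density_def)
  qed
  show int: "integrable torus (fluid_density t)"
  proof (rule Bochner_Integration.integrable_bound[OF rel_density_integrable(1)[OF E_CL1 r_CL1 m_CL1 t]])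
    show "AE x in torus. norm (fluid_density t x) \<le> norm (rel_density E r m t x)" using AE by eventually_elim auto
  qed (rule fluid_density_measurable[OF t])
  show "(\<integral>x. fluid_density t x \<partial>torus) \<le> rel_energy t"
  proof (intro integral_mono_AE int rel_density_integrable(1)[OF E_CL1 r_CL1 m_CL1 t])
    show "AE x in torus. fluid_density t x \<le> rel_density E r m t x" using AE by eventually_elim simp
  qed
qed

text \<open>A crude bound that uses no cancellation: the linear term of the relative internal energy has the good
  sign, and \<open>r \<le> 1 + r\<^sup>\<gamma>\<close> bounds the mass by the energy.\<close>

lemma fluid_density_le_energy:
  assumes t: "t \<in> {0..T}" and good: "AE x in torus. 0 \<le> r t x \<and> E t x = energy pot \<kappa> \<epsilon> (r t x) (m t x) (G t x)"
    and L: "\<And>x. norm (U t x) \<le> L" and P: "\<And>x. bg_pressure t x \<le> P" "0 \<le> P"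
  shows "(\<integral>x. fluid_density t x \<partial>torus) \<le> (3 + L\<^sup>2 + P) * ((\<integral>x. E t x \<partial>torus) + 1)"
proof -
  have t0: "0 \<le> t" using t by simp
  have AE: "AE x in torus. fluid_density t x \<le> (3 + L\<^sup>2 + P) * (E t x + 1)"
    using good
  proof eventually_elim
    case (elim x)
    define kin where "kin = (norm (m t x))\<^sup>2 / r t x"
    have kin: "0 \<le> kin" using elim by (simp add: kin_def)
    have "0 \<le> \<epsilon> * off_vacuum \<kappa> (r t x) / 2 * (norm (G t x))\<^sup>2"
      by (rule relative_density_parts_nonneg(3)[OF _ \<kappa>_pos \<epsilon>]) (use elim in simp_all)
    then have E: "r t x powr \<gamma> \<le> E t x" "kin / 2 \<le> E t x"
      using elim kin powr_ge_zero[of "r t x" \<gamma>] unfolding energy_def kin_def[symmetric] by linarith+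
    have E0: "0 \<le> E t x" using E(1) powr_ge_zero[of "r t x" \<gamma>] by linarith
    have "relative pot (r t x) (R t x) \<le> r t x powr \<gamma> + bg_pressure t x"
    proof -
      have "R t x powr (\<gamma> - 1) * R t x = R t x powr \<gamma>" using R_powr_base[of t x] by (simp add: power2_eq_square mult_ac)
      then have "relative pot (r t x) (R t x) = r t x powr \<gamma> + bg_pressure t x - \<gamma> * R t x powr (\<gamma> - 1) * r t x"
        by (simp add: relative_powr[OF R_pos] bg_pressure_def algebra_simps)
      moreover have "0 \<le> \<gamma> * R t x powr (\<gamma> - 1) * r t x" using \<gamma> elim by simp
      ultimately show ?thesis by linarith
    qed
    then have rel: "relative pot (r t x) (R t x) \<le> E t x + P" using E(1) P(1)[of x] by linarith
    have "r t x \<le> 1 + E t x"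
    proof (cases "r t x \<le> 1")
      case False
      then have "r t x powr 1 \<le> r t x powr \<gamma>" using \<gamma> by (intro powr_mono) auto
      then show ?thesis using False E(1) by simp
    qed (use E0 in linarith)
    have "(norm (m t x - r t x *\<^sub>R U t x))\<^sup>2 \<le> 2 * (norm (m t x))\<^sup>2 + 2 * (norm (r t x *\<^sub>R U t x))\<^sup>2"
    proof -
      have "0 \<le> (norm (m t x + r t x *\<^sub>R U t x))\<^sup>2" by simp
      then show ?thesis unfolding power2_norm_eq_inner by (simp add: inner_add inner_diff inner_commute algebra_simps)
    qed
    then have "(norm (m t x - r t x *\<^sub>R U t x))\<^sup>2 / r t x \<le> (2 * (norm (m t x))\<^sup>2 + 2 * (norm (r t x *\<^sub>R U t x))\<^sup>2) / r t x"
      using elim by (intro divide_right_mono) auto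
    also have "\<dots> = 2 * kin + 2 * (r t x * (norm (U t x))\<^sup>2)"
      using norm_scaleR_square_div[of "r t x" "U t x"] by (simp add: kin_def add_divide_distrib)
    also have "r t x * (norm (U t x))\<^sup>2 \<le> (1 + E t x) * L\<^sup>2"
      using \<open>r t x \<le> 1 + E t x\<close> elim L[of x] E0 by (intro mult_mono power_mono) auto
    finally have "(1/2) * ((norm (m t x - r t x *\<^sub>R U t x))\<^sup>2 / r t x) \<le> kin + (1 + E t x) * L\<^sup>2" by simp
    then have "fluid_density t x \<le> 3 * E t x + P + (1 + E t x) * L\<^sup>2"
      using rel E(2) unfolding fluid_density_def by linarith
    also have "\<dots> \<le> (3 + L\<^sup>2 + P) * (E t x + 1)"
      using mult_nonneg_nonneg[OF P(2) E0] by (simp add: algebra_simps)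
    finally show ?case .
  qed
  have "(\<integral>x. fluid_density t x \<partial>torus) \<le> (\<integral>x. (3 + L\<^sup>2 + P) * (E t x + 1) \<partial>torus)"
    using AE by (intro integral_mono_AE fluid_density_le_rel_density(1)[OF t0 good]
        integrable_mult_right Bochner_Integration.integrable_add CL1_integrable[OF E_CL1 t0]) auto
  also have "\<dots> = (3 + L\<^sup>2 + P) * ((\<integral>x. E t x \<partial>torus) + 1)"
    using CL1_integrable[OF E_CL1 t0] by (simp add: torus_volume)
  finally show ?thesis .
qed

end

definition (in euler_flow) relative_energy_le :: "(real \<Rightarrow> real^'n \<Rightarrow> real) \<Rightarrow> (real \<Rightarrow> real^'n \<Rightarrow> real^'n) \<Rightarrow> real \<Rightarrow> bool" where
  "relative_energy_le r v c \<longleftrightarrow> (AE t in lborel. t \<in> {0..T} \<longrightarrow>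
     integrable torus (\<lambda>x. relative pot (r t x) (R t x) + r t x / 2 * (norm (v t x - U t x))\<^sup>2) \<and>
     (\<integral>x. relative pot (r t x) (R t x) + r t x / 2 * (norm (v t x - U t x))\<^sup>2 \<partial>torus) \<le> c)"

text \<open>The estimate with all constants determined by the strong solution. For \<open>\<epsilon> \<le> 1\<close> it is the
  relative energy argument; for \<open>\<epsilon> > 1\<close> the energy inequality alone suffices, because the initial
  energy is then of order \<open>\<epsilon>\<close>.\<close>

lemma (in euler_flow) relative_energy_estimate:
  assumes "\<forall>r>0. \<kappa> r > 0" and "C1 > 0" "\<forall>r>0. r\<^sup>2 * \<kappa> r \<le> C1 * (r powr \<gamma> + r)"
    and "C2 > 0" "\<forall>r>0. \<bar>r * deriv \<kappa> r\<bar> \<le> C2 * \<kappa> r"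
  shows "\<exists>C>0. \<forall>\<epsilon> r v E. 0 < \<epsilon> \<longrightarrow>
      (EK_dissipative pot \<kappa> \<epsilon> r (\<lambda>t x. r t x *\<^sub>R v t x) E \<or> EK_conservative pot \<kappa> \<epsilon> r (\<lambda>t x. r t x *\<^sub>R v t x) E) \<longrightarrow>
      (AE x in torus. r 0 x = R 0 x \<and> r 0 x *\<^sub>R v 0 x = R 0 x *\<^sub>R U 0 x) \<longrightarrow>
      relative_energy_le r v (C * \<epsilon>)"
proof -
  note \<kappa> = assms(1)[rule_format] and C1 = assms(2) assms(3)[rule_format] and C2 = assms(4) assms(5)[rule_format]
  obtain K where K: "K > 0" and K_bound: "\<forall>\<epsilon> r m G D E t x. 0 < \<epsilon> \<longrightarrow> \<epsilon> \<le> 1 \<longrightarrow> t \<in> {0..T} \<longrightarrow> r t x \<ge> 0 \<longrightarrow> (r t x = 0 \<longrightarrow> m t x = 0) \<longrightarrow>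
      E t x = energy pot \<kappa> \<epsilon> (r t x) (m t x) (G t x) \<longrightarrow>
      korteweg_production \<kappa> \<epsilon> r m G D t x
      \<le> K * rel_density E r m t x + K * \<epsilon>"
    using production_bound[OF assms] by (elim exE conjE) (rule that)
  obtain L where L: "\<forall>t\<in>{0..T}. \<forall>x. norm (U t x) \<le> L" using joint_Ck_bounded[OF U_reg] by blast
  obtain P where P: "P > 0" "\<forall>t\<in>{0..T}. \<forall>x. norm (bg_pressure t x) \<le> P" using joint_Ck_bounded[OF bg_pressure_reg] by blast
  have P': "bg_pressure t x \<le> P" if "t \<in> {0..T}" for t x using P(2) that by (metis abs_le_D1 real_norm_def)
  have "joint_Ck 0 (\<lambda>t x. R t x * (U t x \<bullet> U t x) + 1 * R t x powr \<gamma>)"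
    by (intro joint_Ck_add joint_Ck_mult joint_Ck_inner joint_Ck_imp_0[OF R_reg] joint_Ck_imp_0[OF U_reg]
        joint_Ck_imp_0[OF R_powr_reg])
  from joint_Ck_bounded[OF this, of 0 0]
  obtain A where A: "A > 0" "\<And>x. \<bar>R 0 x * (norm (U 0 x))\<^sup>2 + R 0 x powr \<gamma>\<bar> \<le> A"
    by (auto simp: power2_norm_eq_inner)
  have A': "R 0 x / 2 * (norm (U 0 x))\<^sup>2 + R 0 x powr \<gamma> \<le> A" for x
  proof -
    have "0 \<le> R 0 x * (norm (U 0 x))\<^sup>2" using R_pos[of 0 x] by simp
    then show ?thesis using A(2)[of x] by simp
  qed
  have "joint_Ck 0 (\<lambda>t x. ((C1 / 2) * R t x powr (\<gamma> - 2) + (C1 / 2) * R t x powr (- 1)) * (grad (R t) x \<bullet> grad (R t) x))"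
    by (intro joint_Ck_add joint_Ck_mult joint_Ck_inner joint_Ck_imp_0[OF R_powr_reg] joint_Ck_imp_0[OF grad_R_reg])
  from joint_Ck_bounded[OF this, of 0 0]
  obtain B where B: "B > 0" "\<And>x. \<bar>((C1 / 2) * R 0 x powr (\<gamma> - 2) + (C1 / 2) * R 0 x powr (- 1)) * (norm (grad (R 0) x))\<^sup>2\<bar> \<le> B"
    by (auto simp: power2_norm_eq_inner)
  have B': "\<kappa> (R 0 x) / 2 * (norm (grad (R 0) x))\<^sup>2 \<le> B" for x
  proof -
    have pos: "R 0 x > 0" by (rule R_pos)
    have "(R 0 x)\<^sup>2 * \<kappa> (R 0 x) \<le> C1 * (R 0 x powr \<gamma> + R 0 x)" by (rule C1(2)[OF pos])
    also have "\<dots> = (R 0 x)\<^sup>2 * (C1 * (R 0 x powr (\<gamma> - 2) + R 0 x powr (- 1)))"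
      using pos by (simp add: R_powr_base powr_minus field_simps power2_eq_square)
    finally have "\<kappa> (R 0 x) \<le> C1 * (R 0 x powr (\<gamma> - 2) + R 0 x powr (- 1))" using pos by simp
    then have "\<kappa> (R 0 x) / 2 * (norm (grad (R 0) x))\<^sup>2 \<le> ((C1 / 2) * R 0 x powr (\<gamma> - 2) + (C1 / 2) * R 0 x powr (- 1)) * (norm (grad (R 0) x))\<^sup>2"
      by (intro mult_right_mono) (auto simp: algebra_simps)
    also have "\<dots> \<le> B" using B(2)[of x] by linarith
    finally show ?thesis .
  qed
  define C where "C = exp (K * T) * (B + K * T) + (3 + L\<^sup>2 + P) * (A + B + 1)"
  have parts: "0 \<le> exp (K * T) * (B + K * T)" "0 < (3 + L\<^sup>2 + P) * (A + B + 1)"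
  proof -
    show "0 \<le> exp (K * T) * (B + K * T)" using B(1) K T by simp
    have "0 < 3 + L\<^sup>2 + P" using P(1) zero_le_power2[of L] by linarith
    then show "0 < (3 + L\<^sup>2 + P) * (A + B + 1)" using A(1) B(1) by (intro mult_pos_pos) auto
  qed
  then have "C > 0" unfolding C_def by linarith
  moreover have "relative_energy_le r v (C * \<epsilon>)"
    if \<epsilon>: "0 < \<epsilon>"
      and sol: "EK_dissipative pot \<kappa> \<epsilon> r (\<lambda>t x. r t x *\<^sub>R v t x) E \<or> EK_conservative pot \<kappa> \<epsilon> r (\<lambda>t x. r t x *\<^sub>R v t x) E"
      and init: "AE x in torus. r 0 x = R 0 x \<and> r 0 x *\<^sub>R v 0 x = R 0 x *\<^sub>R U 0 x" for \<epsilon> r v E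
  proof -
    define m where "m = (\<lambda>t x. r t x *\<^sub>R v t x)"
    obtain G where G: "EK_weak_solution pot \<kappa> \<epsilon> r m G" "energy_density pot \<kappa> \<epsilon> r m G E"
      using sol unfolding EK_dissipative_def EK_conservative_def m_def by blast
    have diss: "- (\<integral>(t,x). E t x * \<theta>' t \<partial>spacetime) \<le> (\<integral>x. E 0 x * \<theta> 0 \<partial>torus)"
      if "energy_test_fun \<theta> \<theta>'" for \<theta> \<theta>'
      using sol that unfolding EK_dissipative_def EK_conservative_def by fastforce
    interpret relative_energy_setting T \<gamma> R U \<kappa> \<epsilon> r m G E
      by unfold_locales (use \<epsilon> \<kappa> G diss init in \<open>auto simp: m_def\<close>)
    have fluid: "fluid_density t = (\<lambda>x. relative pot (r t x) (R t x) + r t x / 2 * (norm (v t x - U t x))\<^sup>2)" for t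
    proof
      fix x
      have "m t x - r t x *\<^sub>R U t x = r t x *\<^sub>R (v t x - U t x)" by (simp add: m_def scaleR_diff_right)
      then show "fluid_density t x = relative pot (r t x) (R t x) + r t x / 2 * (norm (v t x - U t x))\<^sup>2"
        using norm_scaleR_square_div[of "r t x" "v t x - U t x"] by (simp add: fluid_density_def)
    qed
    have bound: "integrable torus (fluid_density t) \<and> (\<integral>x. fluid_density t x \<partial>torus) \<le> C * \<epsilon>"
      if t: "0 < t" "t < T" and good: "AE x in torus. 0 \<le> r t x \<and> E t x = energy pot \<kappa> \<epsilon> (r t x) (m t x) (G t x)" for t
    proof
      have t': "0 \<le> t" "t \<in> {0..T}" using t by auto
      show "integrable torus (fluid_density t)" by (rule fluid_density_le_rel_density(1)[OF t'(1) good])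
      show "(\<integral>x. fluid_density t x \<partial>torus) \<le> C * \<epsilon>"
      proof (cases "\<epsilon> \<le> 1")
        case True
        have "(\<integral>x. fluid_density t x \<partial>torus) \<le> rel_energy t" by (rule fluid_density_le_rel_density(2)[OF t'(1) good])
        also have "\<dots> \<le> exp (K * t) * (rel_energy 0 + K * \<epsilon> * T)"
          by (rule rel_energy_gronwall) (use K t K_bound[rule_format, OF \<epsilon> True] vacuum in auto)
        also have "\<dots> \<le> exp (K * t) * ((B + K * T) * \<epsilon>)"
          using initial_energy(2)[OF A' B'] by (intro mult_left_mono) (auto simp: algebra_simps)
        also have "\<dots> \<le> exp (K * T) * ((B + K * T) * \<epsilon>)"
          using K t T B(1) \<epsilon> by (intro mult_right_mono) auto
        also have "\<dots> = exp (K * T) * (B + K * T) * \<epsilon>" by simp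
        also have "\<dots> \<le> C * \<epsilon>" using parts \<epsilon> by (intro mult_right_mono) (auto simp: C_def)
        finally show ?thesis .
      next
        case False
        have "(\<integral>x. fluid_density t x \<partial>torus) \<le> (3 + L\<^sup>2 + P) * ((\<integral>x. E t x \<partial>torus) + 1)"
          by (rule fluid_density_le_energy[OF t'(2) good]) (use L P P' t' in auto)
        also have "\<dots> \<le> (3 + L\<^sup>2 + P) * ((A + \<epsilon> * B) + 1)"
          using energy_decreases[OF t] initial_energy(1)[OF A' B'] P(1) by (intro mult_left_mono) auto
        also have "\<dots> \<le> (3 + L\<^sup>2 + P) * ((A + B + 1) * \<epsilon>)"
        proof (rule mult_left_mono)
          have "A + 1 \<le> (A + 1) * \<epsilon>" using False A(1) mult_left_mono[of 1 \<epsilon> "A + 1"] by simp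
          then show "A + \<epsilon> * B + 1 \<le> (A + B + 1) * \<epsilon>" by (simp add: algebra_simps)
        qed (use P(1) in simp)
        also have "\<dots> = (3 + L\<^sup>2 + P) * (A + B + 1) * \<epsilon>" by simp
        also have "\<dots> \<le> C * \<epsilon>" using parts \<epsilon> by (intro mult_right_mono) (auto simp: C_def)
        finally show ?thesis .
      qed
    qed
    have "AE t in lborel. t \<noteq> (0::real)" "AE t in lborel. t \<noteq> T" by (rule AE_lborel_singleton)+
    with AE_slices have "AE t in lborel. t \<in> {0..T} \<longrightarrow>
        integrable torus (fluid_density t) \<and> (\<integral>x. fluid_density t x \<partial>torus) \<le> C * \<epsilon>"
      by eventually_elim (use bound in auto)
    then show ?thesis by (simp only: fluid relative_energy_le_def)
  qed
  ultimately show ?thesis by blast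
qed

theorem theorem5p5:
  fixes T \<gamma> :: real and h \<kappa> :: "real \<Rightarrow> real"
    and \<rho> :: "real \<Rightarrow> real^'n \<Rightarrow> real" and u :: "real \<Rightarrow> real^'n \<Rightarrow> real^'n"
    and \<rho>\<^sub>0 :: "real^'n \<Rightarrow> real" and u\<^sub>0 :: "real^'n \<Rightarrow> real^'n"
  assumes "T > 0" and "\<gamma> > 1" and h: "h = (\<lambda>r. r powr \<gamma>)"
    and "C2_on_pos \<kappa>"
    and "\<And>r. r > 0 \<Longrightarrow> \<kappa> r > 0"
    and "\<And>r. r > 0 \<Longrightarrow> \<kappa> r * deriv (deriv \<kappa>) r - 2 * (deriv \<kappa> r)\<^sup>2 \<ge> 0"
    and "\<exists>C>0. \<forall>r>0. r\<^sup>2 * \<kappa> r \<le> C * (h r + r)"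
    and "\<exists>C>0. \<forall>r>0. \<bar>r * deriv \<kappa> r\<bar> \<le> C * \<kappa> r"
    and "\<And>t x. t \<in> {0..T} \<Longrightarrow> \<rho> t x > 0"
    and "C0_Ck {0..T} 3 \<rho>" and "C1_Ck {0<..<T} 1 \<rho>"
    and "C0_Ck {0..T} 2 u" and "C1_Ck {0<..<T} 0 u"
    and "euler_solution h T \<rho> u \<rho>\<^sub>0 u\<^sub>0"
  shows "\<exists>C>0. \<forall>(\<rho>e :: real \<Rightarrow> real \<Rightarrow> real^'n \<Rightarrow> real) (ue :: real \<Rightarrow> real \<Rightarrow> real^'n \<Rightarrow> real^'n).
     (\<forall>\<epsilon>>0.
        (\<exists>E. (EK_dissipative h \<kappa> \<epsilon> (\<rho>e \<epsilon>) (\<lambda>t x. \<rho>e \<epsilon> t x *\<^sub>R ue \<epsilon> t x) E \<or>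
              EK_conservative h \<kappa> \<epsilon> (\<rho>e \<epsilon>) (\<lambda>t x. \<rho>e \<epsilon> t x *\<^sub>R ue \<epsilon> t x) E) \<and>
             finite_mass_energy (\<rho>e \<epsilon>) E) \<and>
        (AE x in torus. \<rho>e \<epsilon> 0 x = \<rho>\<^sub>0 x \<and> \<rho>e \<epsilon> 0 x *\<^sub>R ue \<epsilon> 0 x = \<rho>\<^sub>0 x *\<^sub>R u\<^sub>0 x))
     \<longrightarrow>
     (\<forall>\<epsilon>>0. AE t in lborel. t \<in> {0..T} \<longrightarrow>
        integrable torus (\<lambda>x. relative h (\<rho>e \<epsilon> t x) (\<rho> t x)
                              + \<rho>e \<epsilon> t x / 2 * (norm (ue \<epsilon> t x - u t x))\<^sup>2) \<and>
        (\<integral>x. relative h (\<rho>e \<epsilon> t x) (\<rho> t x)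
              + \<rho>e \<epsilon> t x / 2 * (norm (ue \<epsilon> t x - u t x))\<^sup>2 \<partial>torus) \<le> C * \<epsilon>)"
proof -
  define R where "R = (\<lambda>t. \<rho> (max 0 (min T t)))"
  define U where "U = (\<lambda>t. u (max 0 (min T t)))"
  interpret euler_flow T \<gamma> R U
    unfolding R_def U_def using assms by (intro euler_solution_imp_euler_flow[where \<rho>\<^sub>0 = \<rho>\<^sub>0 and u\<^sub>0 = u\<^sub>0]) (auto simp: h)
  have init: "R 0 = \<rho>\<^sub>0" "U 0 = u\<^sub>0" using assms(1,14) by (auto simp: R_def U_def euler_solution_def)
  have on_T: "R t = \<rho> t" "U t = u t" if "t \<in> {0..T}" for t using that by (auto simp: R_def U_def)
  have \<kappa>: "\<forall>r>0. \<kappa> r > 0" using assms(5) by blast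
  obtain C1 where C1: "C1 > 0" "\<forall>r>0. r\<^sup>2 * \<kappa> r \<le> C1 * (r powr \<gamma> + r)" using assms(7) by (auto simp: h)
  obtain C2 where C2: "C2 > 0" "\<forall>r>0. \<bar>r * deriv \<kappa> r\<bar> \<le> C2 * \<kappa> r" using assms(8) by auto
  obtain C where C: "C > 0" and est: "\<forall>\<epsilon> r v E. 0 < \<epsilon> \<longrightarrow>
      (EK_dissipative pot \<kappa> \<epsilon> r (\<lambda>t x. r t x *\<^sub>R v t x) E \<or> EK_conservative pot \<kappa> \<epsilon> r (\<lambda>t x. r t x *\<^sub>R v t x) E) \<longrightarrow>
      (AE x in torus. r 0 x = R 0 x \<and> r 0 x *\<^sub>R v 0 x = R 0 x *\<^sub>R U 0 x) \<longrightarrow>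
      relative_energy_le r v (C * \<epsilon>)"
    using relative_energy_estimate[OF \<kappa> C1 C2] by (elim exE conjE) (rule that)
  show ?thesis
  proof (intro exI[of _ C] conjI allI impI C)
    fix \<rho>e :: "real \<Rightarrow> real \<Rightarrow> real^'n \<Rightarrow> real" and ue :: "real \<Rightarrow> real \<Rightarrow> real^'n \<Rightarrow> real^'n" and \<epsilon> :: real
    assume \<epsilon>: "\<epsilon> > 0" and fam: "\<forall>\<epsilon>>0.
        (\<exists>E. (EK_dissipative h \<kappa> \<epsilon> (\<rho>e \<epsilon>) (\<lambda>t x. \<rho>e \<epsilon> t x *\<^sub>R ue \<epsilon> t x) E \<or>
              EK_conservative h \<kappa> \<epsilon> (\<rho>e \<epsilon>) (\<lambda>t x. \<rho>e \<epsilon> t x *\<^sub>R ue \<epsilon> t x) E) \<and>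
             finite_mass_energy (\<rho>e \<epsilon>) E) \<and>
        (AE x in torus. \<rho>e \<epsilon> 0 x = \<rho>\<^sub>0 x \<and> \<rho>e \<epsilon> 0 x *\<^sub>R ue \<epsilon> 0 x = \<rho>\<^sub>0 x *\<^sub>R u\<^sub>0 x)"
    obtain E where "EK_dissipative h \<kappa> \<epsilon> (\<rho>e \<epsilon>) (\<lambda>t x. \<rho>e \<epsilon> t x *\<^sub>R ue \<epsilon> t x) E \<or>
              EK_conservative h \<kappa> \<epsilon> (\<rho>e \<epsilon>) (\<lambda>t x. \<rho>e \<epsilon> t x *\<^sub>R ue \<epsilon> t x) E"
      and "AE x in torus. \<rho>e \<epsilon> 0 x = \<rho>\<^sub>0 x \<and> \<rho>e \<epsilon> 0 x *\<^sub>R ue \<epsilon> 0 x = \<rho>\<^sub>0 x *\<^sub>R u\<^sub>0 x"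
      using fam \<epsilon> by blast
    then have "relative_energy_le (\<rho>e \<epsilon>) (ue \<epsilon>) (C * \<epsilon>)"
      unfolding h init[symmetric] by (rule est[rule_format, OF \<epsilon>])
    then show "AE t in lborel. t \<in> {0..T} \<longrightarrow>
        integrable torus (\<lambda>x. relative h (\<rho>e \<epsilon> t x) (\<rho> t x) + \<rho>e \<epsilon> t x / 2 * (norm (ue \<epsilon> t x - u t x))\<^sup>2) \<and>
        (\<integral>x. relative h (\<rho>e \<epsilon> t x) (\<rho> t x) + \<rho>e \<epsilon> t x / 2 * (norm (ue \<epsilon> t x - u t x))\<^sup>2 \<partial>torus) \<le> C * \<epsilon>"
      unfolding h relative_energy_le_def by eventually_elim (auto simp: on_T)
  qed
qed

end
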